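(* Let $u$ be a weak solution of the 3D Navier-Stokes equations defined on an interval of the form $(t_0,\infty)$ or $[t_0,\infty)$ for some $t_0\in\mathbb{R}$. If $\omega_{\mathrm{w}}(u)$ is a bounded subset of $V$, then $\omega_{\mathrm{w}}(u)$ attracts $u$ in the strong topology of $H$.
   Context: Setting. Either (periodic case) $\Omega=\prod_{i=1}^3(0,L_i)$, flows are defined on $\mathbb{R}^3$, periodic with period $L_i$ in each direction $x_i$, with zero average $\int_\Omega u\,dx=0$, and $\mathcal{V}$ is the set of smooth divergence-free vector fields with these properties; or (no-slip case) $\Omega\subset\mathbb{R}^3$ is a bounded domain with smooth boundary and $\mathcal{V}$ is the set of $u\in\mathcal{C}_c^\infty(\Omega)^3$ with $\nabla\cdot u=0$. $H$ is the completion of $\mathcal{V}$ in the $L^2(\Omega)^3$ norm and $V$ its completion in the $H^1(\Omega)^3$ norm. Inner products: $(u,v)=\int_\Omega u\cdot v\,dx$ on $H$ and $((u,v))=\int_\Omega\sum_{i=1}^3\partial_{x_i}u\cdot\partial_{x_i}v\,dx$ on $V$, with norms $|u|=(u,u)^{1/2}$ and $\|u\|=((u,u))^{1/2}$. $H$ is identified with its dual, so $V\subset H\subset V'$. $H_{\mathrm{w}}$ denotes $H$ with its weak topology. $P$ is the orthogonal projector of $L^2(\Omega)^3$ onto $H$, $Au=-P\Delta u$ is the Stokes operator, and $B(u,v)=P((u\cdot\nabla)v)$; as maps into $V'$, $\langle Au,w\rangle=((u,w))$ and $\langle B(u,v),w\rangle=\int_\Omega((u\cdot\nabla)v)\cdot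 w\,dx$ for $u,v,w\in V$. The viscosity $\nu>0$ and the time-independent force $f\in H$ are fixed. The 3D Navier-Stokes equations are $\frac{du}{dt}+\nu Au+B(u,u)=f$. Weak solutions. A weak (Leray-Hopf) solution on an open interval $I=(t_0,t_1)$, $-\infty\le t_0<t_1\le\infty$, is a function $u:I\to H$ such that: (i) $u\in L^\infty(t_0,t_1;H)\cap L^2_{\mathrm{loc}}(t_0,t_1;V)$; (ii) $\partial u/\partial t\in L^{4/3}_{\mathrm{loc}}(t_0,t_1;V')$; (iii) $u\in\mathcal{C}(I;H_{\mathrm{w}})$; (iv) $u$ satisfies the equation $\frac{du}{dt}+\nu Au+B(u,u)=f$ almost everywhere on $I$; (v) $\frac12\frac{d}{dt}|u(t)|^2+\nu\|u(t)\|^2\le(f,u(t))$ in the distribution sense on $I$. A weak solution on $[t_0,t_1)$ is a weak solution on $(t_0,t_1)$, also defined at $t_0$, with $u(t)\to u(t_0)$ strongly in $H$ as $t\to t_0^+$. Weak $\omega$-limit set. For a weak solution $u$ on $(t_0,\infty)$ or $[t_0,\infty)$, $\omega_{\mathrm{w}}(u)=\{v_0\in H:\ \exists\{t_n\}_n,\ t_n>t_0,\ t_n\to\infty,\ u(t_n)\rightharpoonup v_0 \text{ weakly in } H\}$. Attraction. $\omega_{\mathrm{w}}(u)$ attracts $u$ in the strong topology of $H$ if for every open set $\mathcal{O}$ of $H$ (norm topology) containing $\omega_{\mathrm{w}}(u)$ there exists $T>t_0$ such that $u(t)\in\mathcal{O}$ for all $t\ge T$. *)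

theory Defs
  imports "HOL-Analysis.Analysis"
begin

definition dir_deriv :: "'a::real_normed_vector \<Rightarrow> ('a \<Rightarrow> 'b::real_normed_vector) \<Rightarrow> 'a \<Rightarrow> 'b" where
  "dir_deriv v f x = frechet_derivative f (at x) v"

text \<open>Meant for open \<open>S\<close>: all iterated directional derivatives exist and are differentiable
  (hence continuous) on \<open>S\<close>, i.e. \<open>f\<close> is of class \<open>C\<^sup>\<infinity>\<close> on \<open>S\<close>.\<close>

definition smooth_fun_on :: "'a::real_normed_vector set \<Rightarrow> ('a \<Rightarrow> 'b::real_normed_vector) \<Rightarrow> bool" where
  "smooth_fun_on S f \<longleftrightarrow> (\<forall>vs. \<forall>x\<in>S. fold dir_deriv vs f differentiable (at x))"

text \<open>\<open>C\<^sub>c\<^sup>\<infinity>(S)\<close>, its members being extended by zero outside \<open>S\<close>.\<close>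

definition test_functions :: "'a::real_normed_vector set \<Rightarrow> ('a \<Rightarrow> 'b::real_normed_vector) set" where
  "test_functions S =
    {\<phi>. smooth_fun_on UNIV \<phi> \<and> compact (closure {x. \<phi> x \<noteq> 0}) \<and> closure {x. \<phi> x \<noteq> 0} \<subseteq> S}"

type_synonym field3 = "real^3 \<Rightarrow> real^3"

definition divergence :: "field3 \<Rightarrow> real^3 \<Rightarrow> real" where
  "divergence u x = (\<Sum>i\<in>UNIV. dir_deriv (axis i 1) u x $ i)"

definition periodic_fields :: "real^3 \<Rightarrow> field3 set" where
  "periodic_fields L =
    {u. smooth_fun_on UNIV u \<and> (\<forall>x. divergence u x = 0)
      \<and> (\<forall>i x. u (x + axis i (L $ i)) = u x)
      \<and> (LINT x|lebesgue_on (box 0 L). u x) = 0}"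

definition noslip_fields :: "(real^3) set \<Rightarrow> field3 set" where
  "noslip_fields \<Omega> = {u \<in> test_functions \<Omega>. \<forall>x. divergence u x = 0}"

text \<open>Near each boundary point, \<open>\<Omega>\<close> is the sublevel set of a smooth function without critical
  points.\<close>

definition smooth_boundary :: "(real^3) set \<Rightarrow> bool" where
  "smooth_boundary \<Omega> \<longleftrightarrow>
    (\<forall>x\<in>frontier \<Omega>. \<exists>U (\<rho> :: real^3 \<Rightarrow> real). open U \<and> x \<in> U \<and> smooth_fun_on U \<rho>
      \<and> (\<forall>y\<in>U. \<exists>v. dir_deriv v \<rho> y \<noteq> 0) \<and> \<Omega> \<inter> U = {y\<in>U. \<rho> y < 0})"

definition flow_setting :: "(real^3) set \<Rightarrow> field3 set \<Rightarrow> bool" where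
  "flow_setting \<Omega> \<V> \<longleftrightarrow>
     (\<exists>L. (\<forall>i. 0 < L $ i) \<and> \<Omega> = box 0 L \<and> \<V> = periodic_fields L)
   \<or> (open \<Omega> \<and> connected \<Omega> \<and> \<Omega> \<noteq> {} \<and> bounded \<Omega> \<and> smooth_boundary \<Omega> \<and> \<V> = noslip_fields \<Omega>)"

text \<open>Elements of \<open>L\<^sup>2(\<Omega>)\<^sup>3\<close> and its subspaces are given by representatives, whose values outside
  \<open>\<Omega>\<close> are irrelevant. All the sets of fields below are closed under equality almost everywhere on
  \<open>\<Omega>\<close>, and all norms and inner products are invariant under it.\<close>

definition L2 :: "(real^3) set \<Rightarrow> field3 set" where
  "L2 \<Omega> = {u. u \<in> borel_measurable (lebesgue_on \<Omega>) \<and> integrable (lebesgue_on \<Omega>) (\<lambda>x. (norm (u x))\<^sup>2)}"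

definition ip :: "(real^3) set \<Rightarrow> field3 \<Rightarrow> field3 \<Rightarrow> real" where
  "ip \<Omega> u v = (LINT x|lebesgue_on \<Omega>. u x \<bullet> v x)"

definition L2_norm :: "(real^3) set \<Rightarrow> field3 \<Rightarrow> real" where
  "L2_norm \<Omega> u = sqrt (ip \<Omega> u u)"

definition has_weak_partial :: "(real^3) set \<Rightarrow> 3 \<Rightarrow> field3 \<Rightarrow> field3 \<Rightarrow> bool" where
  "has_weak_partial \<Omega> i u g \<longleftrightarrow>
    (\<forall>\<phi> \<in> test_functions \<Omega>. (LINT x|lebesgue_on \<Omega>. dir_deriv (axis i 1) \<phi> x *\<^sub>R u x)
                          = - (LINT x|lebesgue_on \<Omega>. (\<phi> x :: real) *\<^sub>R g x))"

definition weak_partial :: "(real^3) set \<Rightarrow> 3 \<Rightarrow> field3 \<Rightarrow> field3" where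
  "weak_partial \<Omega> i u = (SOME g. g \<in> L2 \<Omega> \<and> has_weak_partial \<Omega> i u g)"

definition H1 :: "(real^3) set \<Rightarrow> field3 set" where
  "H1 \<Omega> = {u \<in> L2 \<Omega>. \<forall>i. \<exists>g \<in> L2 \<Omega>. has_weak_partial \<Omega> i u g}"

text \<open>The inner product \<open>((u,v))\<close> of \<open>V\<close>.\<close>

definition ipV :: "(real^3) set \<Rightarrow> field3 \<Rightarrow> field3 \<Rightarrow> real" where
  "ipV \<Omega> u v = (LINT x|lebesgue_on \<Omega>. (\<Sum>i\<in>UNIV. weak_partial \<Omega> i u x \<bullet> weak_partial \<Omega> i v x))"

definition V_norm :: "(real^3) set \<Rightarrow> field3 \<Rightarrow> real" where
  "V_norm \<Omega> u = sqrt (ipV \<Omega> u u)"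

definition H1_norm :: "(real^3) set \<Rightarrow> field3 \<Rightarrow> real" where
  "H1_norm \<Omega> u = sqrt ((L2_norm \<Omega> u)\<^sup>2 + (V_norm \<Omega> u)\<^sup>2)"

text \<open>The completions of \<open>\<V>\<close>, realised as closures in \<open>L\<^sup>2(\<Omega>)\<^sup>3\<close> and \<open>H\<^sup>1(\<Omega>)\<^sup>3\<close>.\<close>

definition spaceH :: "(real^3) set \<Rightarrow> field3 set \<Rightarrow> field3 set" where
  "spaceH \<Omega> \<V> = {u \<in> L2 \<Omega>. \<exists>\<phi>. (\<forall>n::nat. \<phi> n \<in> \<V>) \<and> (\<lambda>n. L2_norm \<Omega> (\<phi> n - u)) \<longlonglongrightarrow> 0}"

definition spaceV :: "(real^3) set \<Rightarrow> field3 set \<Rightarrow> field3 set" where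
  "spaceV \<Omega> \<V> = {u \<in> H1 \<Omega>. \<exists>\<phi>. (\<forall>n::nat. \<phi> n \<in> \<V>) \<and> (\<lambda>n. H1_norm \<Omega> (\<phi> n - u)) \<longlonglongrightarrow> 0}"

text \<open>The dual \<open>V'\<close>. Only the values of a functional on \<open>V\<close> matter. Vector fields are combined
  pointwise.\<close>

type_synonym functional = "field3 \<Rightarrow> real"

definition dualV :: "(real^3) set \<Rightarrow> field3 set \<Rightarrow> functional set" where
  "dualV \<Omega> \<V> =
    {l. (\<forall>v\<in>spaceV \<Omega> \<V>. \<forall>w\<in>spaceV \<Omega> \<V>. l (\<lambda>x. v x + w x) = l v + l w)
      \<and> (\<forall>c. \<forall>w\<in>spaceV \<Omega> \<V>. l (\<lambda>x. c *\<^sub>R w x) = c * l w)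
      \<and> (\<exists>C. \<forall>w\<in>spaceV \<Omega> \<V>. \<bar>l w\<bar> \<le> C * V_norm \<Omega> w)}"

definition dualV_norm :: "(real^3) set \<Rightarrow> field3 set \<Rightarrow> functional \<Rightarrow> real" where
  "dualV_norm \<Omega> \<V> l = (SUP w \<in> {w \<in> spaceV \<Omega> \<V>. V_norm \<Omega> w \<le> 1}. \<bar>l w\<bar>)"

text \<open>The operators \<open>A\<close> and \<open>B\<close>, taken directly as maps into \<open>V'\<close>.\<close>

definition stokes :: "(real^3) set \<Rightarrow> field3 \<Rightarrow> functional" where
  "stokes \<Omega> u = (\<lambda>w. ipV \<Omega> u w)"

definition convection :: "(real^3) set \<Rightarrow> field3 \<Rightarrow> field3 \<Rightarrow> functional" where
  "convection \<Omega> u v =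
    (\<lambda>w. LINT x|lebesgue_on \<Omega>. (\<Sum>i\<in>UNIV. (u x $ i) *\<^sub>R weak_partial \<Omega> i v x) \<bullet> w x)"

text \<open>Strong measurability on \<open>J\<close> with values in the space \<open>X\<close> with (semi)norm \<open>N\<close>: almost everywhere
  the limit of a sequence of simple \<open>X\<close>-valued functions.\<close>

definition bochner_measurable ::
    "'a::minus set \<Rightarrow> ('a \<Rightarrow> real) \<Rightarrow> real set \<Rightarrow> (real \<Rightarrow> 'a) \<Rightarrow> bool" where
  "bochner_measurable X N J u \<longleftrightarrow>
     (AE t in lebesgue_on J. u t \<in> X)
   \<and> (\<exists>s :: nat \<Rightarrow> real \<Rightarrow> 'a.
        (\<forall>n. finite (s n ` J) \<and> s n ` J \<subseteq> X \<and> (\<forall>y. {t\<in>J. s n t = y} \<in> sets lebesgue))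
      \<and> (AE t in lebesgue_on J. (\<lambda>n. N (s n t - u t)) \<longlonglongrightarrow> 0))"

definition bochner_Linf ::
    "'a::minus set \<Rightarrow> ('a \<Rightarrow> real) \<Rightarrow> real set \<Rightarrow> (real \<Rightarrow> 'a) set" where
  "bochner_Linf X N J =
    {u. bochner_measurable X N J u \<and> (\<exists>C. AE t in lebesgue_on J. N (u t) \<le> C)}"

definition bochner_Lp ::
    "real \<Rightarrow> 'a::minus set \<Rightarrow> ('a \<Rightarrow> real) \<Rightarrow> real set \<Rightarrow> (real \<Rightarrow> 'a) set" where
  "bochner_Lp p X N J =
    {u. bochner_measurable X N J u \<and> integrable (lebesgue_on J) (\<lambda>t. N (u t) powr p)}"

definition bochner_Lp_loc ::
    "real \<Rightarrow> 'a::minus set \<Rightarrow> ('a \<Rightarrow> real) \<Rightarrow> real set \<Rightarrow> (real \<Rightarrow> 'a) set" where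
  "bochner_Lp_loc p X N I = {u. \<forall>a b. {a..b} \<subseteq> I \<longrightarrow> u \<in> bochner_Lp p X N {a..b}}"

text \<open>\<open>g\<close> is the distributional derivative of \<open>u\<close> on \<open>I\<close> as a \<open>V'\<close>-valued distribution, \<open>u t \<in> H\<close> being
  identified with the functional \<open>w \<mapsto> (u t, w)\<close>. The integrals are those of \<open>V'\<close>-valued functions,
  evaluated at \<open>w\<close>.\<close>

definition time_derivative ::
    "(real^3) set \<Rightarrow> field3 set \<Rightarrow> real set \<Rightarrow> (real \<Rightarrow> field3) \<Rightarrow> (real \<Rightarrow> functional) \<Rightarrow> bool" where
  "time_derivative \<Omega> \<V> I u g \<longleftrightarrow>
    (\<forall>\<phi> \<in> test_functions I. \<forall>w \<in> spaceV \<Omega> \<V>.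
       (LINT t|lebesgue_on I. deriv \<phi> t * ip \<Omega> (u t) w) = - (LINT t|lebesgue_on I. \<phi> t * g t w))"

definition weakly_continuous_on ::
    "(real^3) set \<Rightarrow> field3 set \<Rightarrow> real set \<Rightarrow> (real \<Rightarrow> field3) \<Rightarrow> bool" where
  "weakly_continuous_on \<Omega> \<V> I u \<longleftrightarrow>
     (\<forall>t\<in>I. u t \<in> spaceH \<Omega> \<V>) \<and> (\<forall>w \<in> spaceH \<Omega> \<V>. continuous_on I (\<lambda>t. ip \<Omega> (u t) w))"

definition energy_inequality ::
    "(real^3) set \<Rightarrow> real \<Rightarrow> field3 \<Rightarrow> real set \<Rightarrow> (real \<Rightarrow> field3) \<Rightarrow> bool" where
  "energy_inequality \<Omega> \<nu> f I u \<longleftrightarrow>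
    (\<forall>\<phi> \<in> test_functions I. (\<forall>t. 0 \<le> \<phi> t) \<longrightarrow>
        - (1/2) * (LINT t|lebesgue_on I. deriv \<phi> t * (L2_norm \<Omega> (u t))\<^sup>2)
        + \<nu> * (LINT t|lebesgue_on I. \<phi> t * (V_norm \<Omega> (u t))\<^sup>2)
      \<le> (LINT t|lebesgue_on I. \<phi> t * ip \<Omega> f (u t)))"

definition weak_solution_open ::
    "(real^3) set \<Rightarrow> field3 set \<Rightarrow> real \<Rightarrow> field3 \<Rightarrow> ereal \<Rightarrow> ereal \<Rightarrow> (real \<Rightarrow> field3) \<Rightarrow> bool" where
  "weak_solution_open \<Omega> \<V> \<nu> f t0 t1 u \<longleftrightarrow>
    t0 < t1 \<and>
    (let I = einterval t0 t1; H = spaceH \<Omega> \<V>; V = spaceV \<Omega> \<V> in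
       u \<in> bochner_Linf H (L2_norm \<Omega>) I
     \<and> u \<in> bochner_Lp_loc 2 V (V_norm \<Omega>) I
     \<and> weakly_continuous_on \<Omega> \<V> I u
     \<and> (\<exists>g \<in> bochner_Lp_loc (4/3) (dualV \<Omega> \<V>) (dualV_norm \<Omega> \<V>) I.
          time_derivative \<Omega> \<V> I u g
        \<and> (AE t in lebesgue_on I. \<forall>w\<in>V.
             g t w + \<nu> * stokes \<Omega> (u t) w + convection \<Omega> (u t) (u t) w = ip \<Omega> f w))
     \<and> energy_inequality \<Omega> \<nu> f I u)"

definition weak_solution_closed ::
    "(real^3) set \<Rightarrow> field3 set \<Rightarrow> real \<Rightarrow> field3 \<Rightarrow> real \<Rightarrow> ereal \<Rightarrow> (real \<Rightarrow> field3) \<Rightarrow> bool" where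
  "weak_solution_closed \<Omega> \<V> \<nu> f t0 t1 u \<longleftrightarrow>
     weak_solution_open \<Omega> \<V> \<nu> f (ereal t0) t1 u \<and> u t0 \<in> spaceH \<Omega> \<V>
   \<and> ((\<lambda>t. L2_norm \<Omega> (u t - u t0)) \<longlongrightarrow> 0) (at_right t0)"

definition weakly_converges ::
    "(real^3) set \<Rightarrow> field3 set \<Rightarrow> (nat \<Rightarrow> field3) \<Rightarrow> field3 \<Rightarrow> bool" where
  "weakly_converges \<Omega> \<V> v v0 \<longleftrightarrow> (\<forall>w \<in> spaceH \<Omega> \<V>. (\<lambda>n. ip \<Omega> (v n) w) \<longlonglongrightarrow> ip \<Omega> v0 w)"

definition weak_omega_limit ::
    "(real^3) set \<Rightarrow> field3 set \<Rightarrow> real \<Rightarrow> (real \<Rightarrow> field3) \<Rightarrow> field3 set" where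
  "weak_omega_limit \<Omega> \<V> t0 u =
    {v0 \<in> spaceH \<Omega> \<V>. \<exists>s. (\<forall>n. t0 < s n) \<and> filterlim s at_top sequentially
        \<and> weakly_converges \<Omega> \<V> (\<lambda>n. u (s n)) v0}"

definition bounded_in_V :: "(real^3) set \<Rightarrow> field3 set \<Rightarrow> field3 set \<Rightarrow> bool" where
  "bounded_in_V \<Omega> \<V> S \<longleftrightarrow> S \<subseteq> spaceV \<Omega> \<V> \<and> (\<exists>M. \<forall>v\<in>S. V_norm \<Omega> v \<le> M)"

definition openH :: "(real^3) set \<Rightarrow> field3 set \<Rightarrow> field3 set \<Rightarrow> bool" where
  "openH \<Omega> \<V> G \<longleftrightarrow> G \<subseteq> spaceH \<Omega> \<V> \<and>
    (\<forall>v\<in>G. \<exists>e>0. \<forall>w\<in>spaceH \<Omega> \<V>. L2_norm \<Omega> (w - v) < e \<longrightarrow> w \<in> G)"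

definition strongly_attracts ::
    "(real^3) set \<Rightarrow> field3 set \<Rightarrow> field3 set \<Rightarrow> real \<Rightarrow> (real \<Rightarrow> field3) \<Rightarrow> bool" where
  "strongly_attracts \<Omega> \<V> S t0 u \<longleftrightarrow>
    (\<forall>G. openH \<Omega> \<V> G \<and> S \<subseteq> G \<longrightarrow> (\<exists>T>t0. \<forall>t\<ge>T. u t \<in> G))"

end

theory Submission
  imports Defs "HOL-Complex_Analysis.Great_Picard"
begin

text \<open>
  Otherwise there are an open set \<open>G\<close> containing the limit set and times \<open>T n \<rightarrow> \<infinity>\<close> with
  \<open>u (T n) \<notin> G\<close>. The energy inequality bounds the dissipation on intervals of bounded length, so for
  every \<open>k\<close> there are times \<open>s k n\<close> in \<open>(T n - 1/k, T n)\<close> at which \<open>u\<close> is bounded in \<open>V\<close>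
  uniformly in \<open>n\<close>, while \<open>|u (T n)|\<^sup>2 \<le> |u (s k n)|\<^sup>2 + C/k\<close>. By Rellich's theorem, along one
  subsequence, \<open>u (s k n)\<close> converges strongly as \<open>n \<rightarrow> \<infinity>\<close> to some \<open>w k\<close> in the weak limit set.
  As that set is bounded in \<open>V\<close>, a subsequence of the \<open>w k\<close> converges strongly to some \<open>v\<close>. The
  equation gives the equicontinuity in time of \<open>(u, \<phi>)\<close> for smooth \<open>\<phi>\<close>, whence \<open>u (T n)\<close>
  converges weakly to \<open>v\<close>; since also \<open>limsup |u (T n)| \<le> |v|\<close>, it converges strongly. Then \<open>v\<close>
  belongs to the limit set and so to \<open>G\<close>, a contradiction. No compactness theorem for
  time-dependent functions is needed, and Rellich's theorem reduces to a Poincare inequality on the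
  cells of a fine grid.
\<close>

subsection \<open>Smooth functions\<close>

text \<open>The obstacle is that the bound in \<open>V\<close> at the times near \<open>T n\<close>
  depends on \<open>k\<close>: it comes from averaging the dissipation over an interval of length at
  most \<open>1/k\<close> and may grow with \<open>k\<close>. Rellich's theorem thus says nothing
  about \<open>u (T n)\<close> itself, nor anything uniform in \<open>k\<close>, and the limit in
  \<open>n\<close> has to be taken first, for fixed \<open>k\<close>. The assumption on the limit
  set then restores what was lost, one bound in \<open>V\<close> for all the \<open>w k\<close>. The
  energy comparison is one-sided, and the good times lie before \<open>T n\<close> so that the later
  energy is the one bounded from above; this is what turns weak convergence into strong convergence.
  The energy inequality is given only in the distribution sense. Tested with differences of smooth
  steps it relates averages of the energy. Weak continuity replaces the later average by the value
  at \<open>T n\<close>; the earlier one stays an average, and a good time is extracted from it by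
  contradiction. Elements of \<open>H\<close> and \<open>V\<close> are representatives and
  \<open>weak_partial\<close> is an arbitrary choice, so identities between weak derivatives hold
  only almost everywhere.\<close>

lemma dir_deriv_eqI: "(f has_derivative f') (at x) \<Longrightarrow> dir_deriv v f x = f' v"
  unfolding dir_deriv_def by (metis frechet_derivative_at)

lemma has_derivative_dir_deriv:
  "f differentiable (at x) \<Longrightarrow> (f has_derivative (\<lambda>v. dir_deriv v f x)) (at x)"
  unfolding dir_deriv_def using frechet_derivative_works by (auto simp: eta_contract_eq)

abbreviation smooth :: "('a::real_normed_vector \<Rightarrow> 'b::real_normed_vector) \<Rightarrow> bool" where
  "smooth \<equiv> smooth_fun_on UNIV"

lemma smooth_differentiable: "smooth f \<Longrightarrow> f differentiable (at x)"
  unfolding smooth_fun_on_def by (metis UNIV_I fold_simps(1))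

lemma smooth_dir_deriv: "smooth f \<Longrightarrow> smooth (dir_deriv v f)"
  unfolding smooth_fun_on_def by (metis fold_simps(2))

text \<open>By induction on the list of directions. Each closure property of smooth functions below
  thus amounts to the choice of an invariant set \<open>S\<close>; the alternative in the last
  premise lets a derivative leave \<open>S\<close> as soon as it is known to be smooth.\<close>

lemma smooth_coinduct:
  assumes "f \<in> S" and "\<And>g x. g \<in> S \<Longrightarrow> g differentiable (at x)"
    and "\<And>g v. g \<in> S \<Longrightarrow> dir_deriv v g \<in> S \<or> smooth (dir_deriv v g)"
  shows "smooth f"
proof -
  have "fold dir_deriv vs g differentiable (at x)" if "g \<in> S" for vs g x
    using that
  proof (induction vs arbitrary: g)
    case (Cons v vs)
    then show ?case
      using assms(3)[of g v] by (auto simp: smooth_fun_on_def)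
  qed (use assms in auto)
  then show ?thesis
    using assms(1) by (auto simp: smooth_fun_on_def)
qed

lemma smooth_continuous_on: "smooth f \<Longrightarrow> continuous_on S f"
  by (meson continuous_at_imp_continuous_on differentiable_imp_continuous_within smooth_differentiable)

lemma smooth_const [simp]: "smooth (\<lambda>x. c)"
proof (rule smooth_coinduct[where S = "range (\<lambda>c x. c)"])
  fix g :: "'a \<Rightarrow> 'b" and v assume "g \<in> range (\<lambda>c x. c)"
  then obtain c where g: "g = (\<lambda>x. c)" by auto
  have "dir_deriv v g = (\<lambda>x. 0)"
    unfolding g by (rule ext, rule dir_deriv_eqI, rule has_derivative_const)
  then show "dir_deriv v g \<in> range (\<lambda>c x. c) \<or> smooth (dir_deriv v g)" by auto
qed auto

lemma dir_deriv_add: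
  assumes "f differentiable (at x)" "g differentiable (at x)"
  shows "dir_deriv v (\<lambda>x. f x + g x) x = dir_deriv v f x + dir_deriv v g x"
  by (rule dir_deriv_eqI[OF has_derivative_add[OF assms[THEN has_derivative_dir_deriv]]])

lemma dir_deriv_diff:
  assumes "f differentiable (at x)" "g differentiable (at x)"
  shows "dir_deriv v (\<lambda>x. f x - g x) x = dir_deriv v f x - dir_deriv v g x"
  by (rule dir_deriv_eqI[OF has_derivative_diff[OF assms[THEN has_derivative_dir_deriv]]])

lemma dir_deriv_scaleR:
  assumes "f differentiable (at x)" "g differentiable (at x)"
  shows "dir_deriv v (\<lambda>x. f x *\<^sub>R g x) x = f x *\<^sub>R dir_deriv v g x + dir_deriv v f x *\<^sub>R g x"
  by (rule dir_deriv_eqI[OF has_derivative_scaleR[OF assms[THEN has_derivative_dir_deriv]]])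

lemma smooth_add:
  assumes "smooth f" "smooth g"
  shows "smooth (\<lambda>x. f x + g x)"
proof (rule smooth_coinduct[where S = "{\<lambda>x. f x + g x | f g. smooth f \<and> smooth g}"])
  fix h v
  assume "h \<in> {\<lambda>x::'a. f x + g x :: 'b | f g. smooth f \<and> smooth g}"
  then obtain f g where h: "h = (\<lambda>x. f x + g x)" "smooth f" "smooth g" by auto
  have "dir_deriv v h = (\<lambda>x. dir_deriv v f x + dir_deriv v g x)"
    unfolding h(1) using h(2,3) by (intro ext dir_deriv_add smooth_differentiable)
  then show "dir_deriv v h \<in> {\<lambda>x. f x + g x | f g. smooth f \<and> smooth g} \<or> smooth (dir_deriv v h)"
    using smooth_dir_deriv[OF h(2)] smooth_dir_deriv[OF h(3)] by auto
next
  show "h differentiable (at x)" if "h \<in> {\<lambda>x::'a. f x + g x :: 'b | f g. smooth f \<and> smooth g}" for h x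
    using that by (auto simp: smooth_differentiable intro!: differentiable_add)
qed (use assms in blast)

lemma smooth_scaleR:
  assumes "smooth f" "smooth g"
  shows "smooth (\<lambda>x. f x *\<^sub>R g x)"
proof -
  \<comment> \<open>The product rule leads out of the set of products. \<open>S n\<close> therefore
    collects the sums of \<open>2^n\<close> products; differentiation maps it into
    \<open>S (Suc n)\<close>, and the union over \<open>n\<close> is the invariant set.\<close>
  define S where "S = rec_nat {\<lambda>x::'a. f x *\<^sub>R g x :: 'b | f g. smooth f \<and> smooth g}
    (\<lambda>_ A. {\<lambda>x. f x + g x | f g. f \<in> A \<and> g \<in> A})"
  have 1: "g differentiable (at x)" if "g \<in> S n" for g x n
    using that
  proof (induction n arbitrary: g)
    case 0
    then show ?case
      by (auto simp: S_def smooth_differentiable intro!: differentiable_scaleR)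
  next
    case (Suc n)
    then show ?case
      by (auto simp: S_def intro!: differentiable_add)
  qed
  have add: "(\<lambda>x. f x + g x) \<in> S (Suc n)" if "f \<in> S n" "g \<in> S n" for f g n
    using that by (auto simp: S_def)
  have 2: "dir_deriv v g \<in> S (Suc n)" if "g \<in> S n" for g v n
    using that
  proof (induction n arbitrary: g)
    case 0
    then obtain a b where h: "g = (\<lambda>x. a x *\<^sub>R b x)" "smooth a" "smooth b" by (auto simp: S_def)
    have "dir_deriv v g = (\<lambda>x. a x *\<^sub>R dir_deriv v b x + dir_deriv v a x *\<^sub>R b x)"
      unfolding h(1) using h(2,3) by (intro ext dir_deriv_scaleR smooth_differentiable)
    moreover have "(\<lambda>x. a x *\<^sub>R dir_deriv v b x) \<in> S 0" "(\<lambda>x. dir_deriv v a x *\<^sub>R b x) \<in> S 0"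
      using h smooth_dir_deriv unfolding S_def by auto
    ultimately show ?case by (simp only: add)
  next
    case (Suc n)
    then obtain a b where h: "g = (\<lambda>x. a x + b x)" "a \<in> S n" "b \<in> S n" by (auto simp: S_def)
    have "dir_deriv v g = (\<lambda>x. dir_deriv v a x + dir_deriv v b x)"
      unfolding h(1) using h(2,3) by (intro ext dir_deriv_add 1)
    then show ?case using Suc.IH[OF h(2)] Suc.IH[OF h(3)] unfolding S_def by auto
  qed
  show ?thesis
  proof (rule smooth_coinduct[where S = "\<Union>n. S n"])
    show "(\<lambda>x. f x *\<^sub>R g x) \<in> (\<Union>n. S n)"
      using assms by (intro UN_I[of 0]) (auto simp: S_def)
    show "g differentiable (at x)" if "g \<in> (\<Union>n. S n)" for g x
      using that 1 by auto
    show "dir_deriv v g \<in> (\<Union>n. S n) \<or> smooth (dir_deriv v g)" if "g \<in> (\<Union>n. S n)" for g v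
      using that 2 by (meson UN_iff UNIV_I)
  qed
qed

lemma smooth_mult: "smooth f \<Longrightarrow> smooth g \<Longrightarrow> smooth (\<lambda>x. f x * g x :: real)"
  using smooth_scaleR[of f g] by simp

lemma smooth_diff: "smooth f \<Longrightarrow> smooth g \<Longrightarrow> smooth (\<lambda>x. f x - g x)"
  using smooth_add[of f "\<lambda>x. (-1) *\<^sub>R g x"] smooth_scaleR[of "\<lambda>_. -1" g] by simp

lemma dir_deriv_compose_inner:
  fixes g :: "real \<Rightarrow> 'b::real_normed_vector"
  assumes "g differentiable (at ((x - p) \<bullet> b))"
  shows "dir_deriv v (\<lambda>x. g ((x - p) \<bullet> b)) x = dir_deriv (v \<bullet> b) g ((x - p) \<bullet> b)"
proof -
  have "((\<lambda>x. g ((x - p) \<bullet> b)) has_derivative (\<lambda>v. dir_deriv (v \<bullet> b) g ((x - p) \<bullet> b))) (at x)"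
    by (rule has_derivative_compose[where f = "\<lambda>x. (x - p) \<bullet> b" and f' = "\<lambda>v. v \<bullet> b",
          OF _ has_derivative_dir_deriv[OF assms]])
      (auto intro!: derivative_eq_intros)
  then show ?thesis by (rule dir_deriv_eqI)
qed

lemma smooth_compose_inner:
  fixes g :: "real \<Rightarrow> 'b::real_normed_vector"
  assumes "smooth g"
  shows "smooth (\<lambda>x. g ((x - p) \<bullet> b))"
proof (rule smooth_coinduct[where S = "{\<lambda>x. g ((x - p) \<bullet> b) | g. smooth g}"])
  fix h assume "h \<in> {\<lambda>x. g ((x - p) \<bullet> b) :: 'b | g. smooth g}"
  then obtain g where h: "h = (\<lambda>x. g ((x - p) \<bullet> b))" "smooth g" by auto
  then show "h differentiable (at x)" for x
    unfolding h(1) using smooth_differentiable[OF h(2)]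
    by (intro differentiable_compose[where f = g and g = "\<lambda>x. (x - p) \<bullet> b"])
      (auto intro!: differentiable_inner differentiable_diff)
  have "dir_deriv v h = (\<lambda>x. dir_deriv (v \<bullet> b) g ((x - p) \<bullet> b))" for v
    unfolding h(1) using h(2) by (intro ext dir_deriv_compose_inner smooth_differentiable)
  then show "dir_deriv v h \<in> {\<lambda>x. g ((x - p) \<bullet> b) | g. smooth g} \<or> smooth (dir_deriv v h)" for v
    using smooth_dir_deriv[OF h(2)] by auto
qed (use assms in auto)

lemma dir_deriv_real:
  assumes "(f has_real_derivative d) (at x)"
  shows "dir_deriv v f x = v * d"
  using dir_deriv_eqI[OF assms[unfolded has_field_derivative_def], of v] by (simp add: mult.commute)

text \<open>The singleton of \<open>f\<close> is invariant in the weak sense of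
  \<open>smooth_coinduct\<close>: one derivative already gives a multiple of the smooth
  \<open>g\<close>.\<close>

lemma smooth_antiderivative:
  assumes "\<And>x. (f has_real_derivative g x) (at x)" and "smooth g"
  shows "smooth f"
proof (rule smooth_coinduct[where S = "{f}"])
  fix h v assume "h \<in> {f}"
  then have "dir_deriv v h = (\<lambda>x. v * g x)"
    using dir_deriv_real[OF assms(1)] by auto
  then show "dir_deriv v h \<in> {f} \<or> smooth (dir_deriv v h)"
    using smooth_mult[OF smooth_const assms(2)] by auto
qed (use assms(1) in \<open>auto simp: real_differentiable_def\<close>)

lemma test_functionsI:
  assumes "smooth f" "compact K" "K \<subseteq> S" "\<And>x. x \<notin> K \<Longrightarrow> f x = 0"
  shows "f \<in> test_functions S"
proof -
  have "closure {x. f x \<noteq> 0} \<subseteq> K"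
    by (rule closure_minimal) (use assms compact_imp_closed in auto)
  moreover from this have "compact (closure {x. f x \<noteq> 0})"
    using assms(2) compact_Int_closed[of K "closure {x. f x \<noteq> 0}"] by (simp add: Int_absorb1)
  ultimately show ?thesis
    using assms by (auto simp: test_functions_def)
qed

subsection \<open>Bump functions on the line\<close>

text \<open>The classical flat function is the case \<open>p = 1\<close>. The polynomial in
  \<open>1/x\<close> is carried along because differentiation produces powers of \<open>1/x\<close>;
  with it the family is closed under derivatives.\<close>

definition flat_exp :: "real poly \<Rightarrow> real \<Rightarrow> real" where
  "flat_exp p x = (if x > 0 then poly p (inverse x) * exp (- inverse x) else 0)"

lemma poly_times_exp_tendsto_0: "((\<lambda>y. poly p y * exp (- y)) \<longlongrightarrow> (0::real)) at_top"
proof -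
  have "((\<lambda>y. \<Sum>i\<le>degree p. coeff p i * (y ^ i / exp y)) \<longlongrightarrow> (\<Sum>i\<le>degree p. coeff p i * 0)) at_top"
    by (intro tendsto_intros tendsto_power_div_exp_0)
  then show ?thesis
    by (simp add: poly_altdef sum_distrib_right exp_minus divide_inverse mult.assoc)
qed

lemma flat_exp_tendsto_0: "(flat_exp p \<longlongrightarrow> 0) (at 0)"
proof (rule filterlim_split_at)
  have "eventually (\<lambda>x. flat_exp p x = 0) (at_left 0)"
    by (auto simp: eventually_at_filter flat_exp_def intro!: always_eventually)
  then show "(flat_exp p \<longlongrightarrow> 0) (at_left 0)"
    by (rule tendsto_eventually)
  have "((\<lambda>x. poly p (inverse x) * exp (- inverse x)) \<longlongrightarrow> 0) (at_right 0)"
    by (rule filterlim_compose[OF poly_times_exp_tendsto_0 filterlim_inverse_at_top_right])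
  then show "(flat_exp p \<longlongrightarrow> 0) (at_right 0)"
    by (rule Lim_transform_eventually)
      (auto simp: eventually_at_filter flat_exp_def intro!: always_eventually)
qed

text \<open>With \<open>y = 1/x\<close> one has \<open>dy/dx = - y^2\<close>, so the derivative of
  \<open>p y * exp (- y)\<close> in \<open>x\<close> is
  \<open>y^2 * (p - p') y * exp (- y)\<close>.\<close>

definition flat_exp_deriv :: "real poly \<Rightarrow> real poly" where
  "flat_exp_deriv p = [:0, 0, 1:] * (p - pderiv p)"

lemma flat_exp_has_derivative: "(flat_exp p has_real_derivative flat_exp (flat_exp_deriv p) x) (at x)"
proof -
  consider "x > 0" | "x < 0" | "x = 0" by linarith
  then show ?thesis
  proof cases
    case 1
    have "((\<lambda>x. poly p (inverse x) * exp (- inverse x)) has_real_derivative flat_exp (flat_exp_deriv p) x) (at x)"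
      using 1 by (auto intro!: derivative_eq_intros DERIV_chain2[OF poly_DERIV]
          simp: flat_exp_def flat_exp_deriv_def power2_eq_square algebra_simps)
    then show ?thesis
      by (rule has_field_derivative_transform_within_open[where S = "{0<..}"])
        (use 1 in \<open>auto simp: flat_exp_def\<close>)
  next
    case 2
    have "((\<lambda>x. 0) has_real_derivative flat_exp (flat_exp_deriv p) x) (at x)"
      using 2 by (auto simp: flat_exp_def)
    then show ?thesis
      by (rule has_field_derivative_transform_within_open[where S = "{..<0}"])
        (use 2 in \<open>auto simp: flat_exp_def\<close>)
  next
    case 3
    \<comment> \<open>At the origin the difference quotient is again a flat function: division by
      \<open>h\<close> multiplies the polynomial by its variable, and all flat functions tend to
      0.\<close>
    have *: "(flat_exp p h - flat_exp p 0) / (h - 0) = flat_exp ([:0, 1:] * p) h" if "h \<noteq> 0" for h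
      using that by (simp add: flat_exp_def field_simps)
    have "((\<lambda>h. (flat_exp p h - flat_exp p 0) / (h - 0)) \<longlongrightarrow> 0) (at 0)"
      by (rule Lim_transform_eventually[OF flat_exp_tendsto_0[of "[:0, 1:] * p"]])
        (unfold eventually_at_filter, intro always_eventually allI impI *[symmetric])
    then show ?thesis
      using 3 by (simp add: has_field_derivative_iff flat_exp_def)
  qed
qed

lemma smooth_flat_exp: "smooth (flat_exp p)"
proof (rule smooth_coinduct[where S = "range flat_exp"])
  fix g v assume "g \<in> range flat_exp"
  then obtain q where g: "g = flat_exp q" by auto
  have "dir_deriv v g = flat_exp (smult v (flat_exp_deriv q))"
    unfolding g using dir_deriv_real[OF flat_exp_has_derivative] by (auto simp: fun_eq_iff flat_exp_def)
  then show "dir_deriv v g \<in> range flat_exp \<or> smooth (dir_deriv v g)" by auto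
qed (use flat_exp_has_derivative real_differentiable_def in auto)

text \<open>\<open>\<sigma>\<close> climbs from 0 to 1 across the interval, and its derivative
  \<open>\<eta>\<close> is a probability density there. The density serves as a weight for averages
  in time; the difference of two steps is a plateau, a nonnegative test function whose derivative is
  a difference of two densities.\<close>

definition smooth_step_on :: "real \<Rightarrow> real \<Rightarrow> (real \<Rightarrow> real) \<Rightarrow> (real \<Rightarrow> real) \<Rightarrow> bool" where
  "smooth_step_on a b \<eta> \<sigma> \<longleftrightarrow> smooth \<eta> \<and> smooth \<sigma> \<and> (\<forall>x. 0 \<le> \<eta> x) \<and> (\<forall>x. x \<notin> {a<..<b} \<longrightarrow> \<eta> x = 0)
    \<and> (\<forall>x. (\<sigma> has_real_derivative \<eta> x) (at x)) \<and> (\<forall>x\<le>a. \<sigma> x = 0) \<and> (\<forall>x\<ge>b. \<sigma> x = 1)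
    \<and> (\<forall>x. 0 \<le> \<sigma> x \<and> \<sigma> x \<le> 1)"

lemma smooth_step_on_exists:
  assumes "a < b"
  obtains \<eta> \<sigma> where "smooth_step_on a b \<eta> \<sigma>"
proof -
  define \<rho> where "\<rho> x = flat_exp 1 ((x - a) \<bullet> 1) * flat_exp 1 ((x - b) \<bullet> (-1))" for x :: real
  have sm: "smooth \<rho>"
    unfolding \<rho>_def by (intro smooth_mult smooth_compose_inner smooth_flat_exp)
  have nn: "\<rho> x \<ge> 0" for x by (auto simp: \<rho>_def flat_exp_def)
  have z: "\<rho> x = 0" if "x \<notin> {a<..<b}" for x using that by (auto simp: \<rho>_def flat_exp_def)
  have pos: "\<rho> x > 0" if "x \<in> {a<..<b}" for x using that by (auto simp: \<rho>_def flat_exp_def)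
  \<comment> \<open>Starting at \<open>a - 1\<close> makes every \<open>x \<ge> a\<close> an
    interior point of the interval of integration, so that the derivative obtained there is
    two-sided.\<close>
  define F where "F y = integral {a-1..y} \<rho>" for y
  have Fz: "F y = 0" if "y \<le> a" for y
    unfolding F_def using that z by (intro integral_unique has_integral_is_0) auto
  have F': "(F has_real_derivative \<rho> x) (at x)" for x
  proof (cases "x < a")
    case True
    have "((\<lambda>x. 0) has_real_derivative \<rho> x) (at x)" using True z[of x] by auto
    then show ?thesis
      by (rule has_field_derivative_transform_within_open[where S = "{..<a}"]) (use True Fz in auto)
  next
    case False
    have "(F has_real_derivative \<rho> x) (at x within {a-1..x+1})"
      unfolding F_def[abs_def] using False
      by (intro integral_has_real_derivative smooth_continuous_on sm) auto
    then have "(F has_real_derivative \<rho> x) (at x within {a-1<..<x+1})"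
      by (rule has_field_derivative_subset) auto
    then show ?thesis using False by (simp add: at_within_open[of x "{a-1<..<x+1}"])
  qed
  have mono: "F x \<le> F y" if "x \<le> y" for x y
    using DERIV_nonneg_imp_nondecreasing[OF that, of F] F' nn by blast
  define c where "c = F b"
  \<comment> \<open>If the total mass vanished, monotonicity would make \<open>F\<close> zero on the
    whole interval, against its positive derivative at the midpoint.\<close>
  have "F b \<noteq> 0"
  proof
    assume 0: "F b = 0"
    have Fx: "F x = 0" if "x \<in> {a<..<b}" for x
      using mono[of x b] mono[of a x] 0 Fz[of a] that by auto
    have "((\<lambda>x. 0) has_real_derivative 0) (at ((a+b)/2))" by auto
    then have "(F has_real_derivative 0) (at ((a+b)/2))"
      by (rule has_field_derivative_transform_within_open[where S = "{a<..<b}"]) (use assms Fx in auto)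
    then show False
      using DERIV_unique[OF F'] pos[of "(a+b)/2"] assms by fastforce
  qed
  then have c: "c > 0" using mono[of a b] Fz[of a] assms by (auto simp: c_def)
  have Fb: "F y = c" if "y \<ge> b" for y
  proof -
    have "\<exists>k. \<forall>x\<in>{b..}. F x = k"
      by (rule has_field_derivative_zero_constant)
        (use z has_field_derivative_at_within[OF F', of _ "{b..}"] in \<open>(simp, metis atLeast_iff greaterThanLessThan_iff not_less)+\<close>)
    then show ?thesis using that by (auto simp: c_def)
  qed
  have "smooth F" by (rule smooth_antiderivative[OF F' sm])
  have "smooth_step_on a b (\<lambda>x. inverse c * \<rho> x) (\<lambda>x. inverse c * F x)"
    unfolding smooth_step_on_def
  proof (intro conjI allI impI)
    show "smooth (\<lambda>x. inverse c * \<rho> x)" by (rule smooth_mult[OF smooth_const sm])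
    show "smooth (\<lambda>x. inverse c * F x)" by (rule smooth_mult[OF smooth_const \<open>smooth F\<close>])
    show "((\<lambda>x. inverse c * F x) has_real_derivative inverse c * \<rho> x) (at x)" for x
      by (rule DERIV_cmult[OF F'])
    have F0: "0 \<le> F x" for x using mono[of "min x a" x] Fz[of "min x a"] by auto
    then show "0 \<le> inverse c * F x" for x using c by auto
    have "F x \<le> c" for x using mono[of x "max x b"] Fb[of "max x b"] by auto
    then show "inverse c * F x \<le> 1" for x using c by (auto simp: field_simps)
    show "0 \<le> inverse c * \<rho> x" for x using c nn[of x] by simp
    show "inverse c * \<rho> x = 0" if "x \<notin> {a<..<b}" for x using z[OF that] by simp
    show "inverse c * F x = 0" if "x \<le> a" for x using Fz[OF that] by simp
    show "inverse c * F x = 1" if "x \<ge> b" for x using Fb[OF that] c by simp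
  qed
  then show thesis by (rule that)
qed

lemma smooth_step_onD:
  assumes "smooth_step_on a b \<eta> \<sigma>"
  shows "smooth \<eta>" "smooth \<sigma>" "0 \<le> \<eta> x" "x \<notin> {a<..<b} \<Longrightarrow> \<eta> x = 0"
    "(\<sigma> has_real_derivative \<eta> x) (at x)" "x \<le> a \<Longrightarrow> \<sigma> x = 0" "x \<ge> b \<Longrightarrow> \<sigma> x = 1" "0 \<le> \<sigma> x" "\<sigma> x \<le> 1"
  using assms unfolding smooth_step_on_def by blast+

text \<open>Testing a law in time with this plateau turns the term with \<open>deriv\<close> into an
  average near the left end minus an average near the right end.\<close>

lemma test_function_steps:
  assumes "smooth_step_on a b \<eta>1 \<sigma>1" "smooth_step_on c d \<eta>2 \<sigma>2" "t0 < a" "a < b" "b \<le> c" "c < d"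
  shows "(\<lambda>t. \<sigma>1 t - \<sigma>2 t) \<in> test_functions {t0<..}"
    and "deriv (\<lambda>t. \<sigma>1 t - \<sigma>2 t) t = \<eta>1 t - \<eta>2 t"
    and "0 \<le> \<sigma>1 t - \<sigma>2 t" and "\<sigma>1 t - \<sigma>2 t \<le> 1"
    and "t \<notin> {a..d} \<Longrightarrow> \<sigma>1 t - \<sigma>2 t = 0"
    and "b \<le> t \<Longrightarrow> t \<le> c \<Longrightarrow> \<sigma>1 t - \<sigma>2 t = 1"
proof -
  note S1 = smooth_step_onD[OF assms(1)] and S2 = smooth_step_onD[OF assms(2)]
  show z: "\<sigma>1 t - \<sigma>2 t = 0" if "t \<notin> {a..d}" for t
    using that S1(6,7)[of t] S2(6,7)[of t] assms by (cases "t < a") auto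
  show "0 \<le> \<sigma>1 t - \<sigma>2 t" for t
    using S1(7,8)[of t] S2(6,9)[of t] assms by (cases "t \<le> c") auto
  show "\<sigma>1 t - \<sigma>2 t \<le> 1" for t
    using S1(9)[of t] S2(8)[of t] by auto
  show "b \<le> t \<Longrightarrow> t \<le> c \<Longrightarrow> \<sigma>1 t - \<sigma>2 t = 1"
    using S1(7)[of t] S2(6)[of t] by auto
  show "deriv (\<lambda>t. \<sigma>1 t - \<sigma>2 t) t = \<eta>1 t - \<eta>2 t"
    by (rule DERIV_imp_deriv[OF DERIV_diff[OF S1(5) S2(5)]])
  show "(\<lambda>t. \<sigma>1 t - \<sigma>2 t) \<in> test_functions {t0<..}"
    by (rule test_functionsI[OF smooth_diff[OF S1(2) S2(2)], of "{a..d}"]) (use z assms(3) in auto)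
qed

subsection \<open>The space \<open>L\<^sup>2(\<Omega>)\<close>\<close>

lemma norm_power2_add_le: "(norm (a + b))\<^sup>2 \<le> 2 * (norm a)\<^sup>2 + 2 * (norm (b::'a::real_normed_vector))\<^sup>2"
proof -
  have "(norm (a + b))\<^sup>2 \<le> (norm a + norm b)\<^sup>2"
    by (intro power_mono norm_triangle_ineq) auto
  also have "\<dots> \<le> 2 * (norm a)\<^sup>2 + 2 * (norm b)\<^sup>2"
    using sum_squares_bound[of "norm a" "norm b"] by (simp add: power2_sum)
  finally show ?thesis .
qed

lemma norm_power2_diff_le: "(norm (a - b))\<^sup>2 \<le> 2 * (norm a)\<^sup>2 + 2 * (norm (b::'a::real_normed_vector))\<^sup>2"
  using norm_power2_add_le[of a "- b"] by simp

text \<open>The discriminant criterion behind Cauchy-Schwarz. If \<open>c = 0\<close>, the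
  expression is affine in \<open>l\<close> and a suitable \<open>l\<close> would make it negative
  for positive \<open>b\<close>; otherwise its minimum at \<open>l = - b / c\<close> is
  tested.\<close>

lemma quadratic_nonneg_discriminant:
  fixes a b c :: real
  assumes "\<And>l. 0 \<le> a + 2 * l * b + l\<^sup>2 * c" and "0 \<le> a" "0 \<le> c"
  shows "b \<le> sqrt a * sqrt c"
proof (cases "c = 0")
  case True
  have "b \<le> 0"
  proof (rule ccontr)
    assume "\<not> b \<le> 0"
    then have "a + 2 * (- (a + 1) / b) * b = - a - 2" by (simp add: field_simps)
    then show False
      using assms(1)[of "- (a + 1) / b"] True \<open>0 \<le> a\<close> by simp
  qed
  then show ?thesis using True by simp
next
  case False
  then have c: "c > 0" using assms by auto
  have "0 \<le> c * (a + 2 * (- b / c) * b + (- b / c)\<^sup>2 * c)"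
    using assms(1)[of "- b / c"] c by (intro mult_nonneg_nonneg) auto
  also have "\<dots> = a * c - b\<^sup>2"
    using c by (simp add: field_simps power2_eq_square)
  finally have "sqrt (b\<^sup>2) \<le> sqrt (a * c)"
    by (intro real_sqrt_le_mono) auto
  then show ?thesis by (simp add: real_sqrt_mult)
qed

locale bounded_domain =
  fixes \<Omega> :: "(real^3) set"
  assumes open_dom: "open \<Omega>" and bounded_dom: "bounded \<Omega>"
begin

lemma lmeasurable_dom: "\<Omega> \<in> lmeasurable"
  using lmeasurable_open[OF bounded_dom open_dom] .

lemma sets_lebesgue_dom [simp, measurable]: "\<Omega> \<in> sets lebesgue"
  using lmeasurable_dom by blast

lemma finite_measure_dom: "finite_measure (lebesgue_on \<Omega>)"
  by (rule finite_measure_lebesgue_on[OF lmeasurable_dom])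

sublocale finite_measure "lebesgue_on \<Omega>" by (rule finite_measure_dom)

lemma L2_measurable: "u \<in> L2 \<Omega> \<Longrightarrow> u \<in> borel_measurable (lebesgue_on \<Omega>)"
  by (simp add: L2_def)

lemma L2_integrable_power2: "u \<in> L2 \<Omega> \<Longrightarrow> integrable (lebesgue_on \<Omega>) (\<lambda>x. (norm (u x))\<^sup>2)"
  by (simp add: L2_def)

lemma L2_I_dominated:
  assumes "u \<in> borel_measurable (lebesgue_on \<Omega>)" "integrable (lebesgue_on \<Omega>) g"
    and "AE x in lebesgue_on \<Omega>. (norm (u x))\<^sup>2 \<le> g x"
  shows "u \<in> L2 \<Omega>"
proof -
  note [measurable] = assms(1)
  have "integrable (lebesgue_on \<Omega>) (\<lambda>x. (norm (u x))\<^sup>2)"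
    by (rule Bochner_Integration.integrable_bound[OF assms(2)]) (use assms(3) in auto)
  then show ?thesis using assms(1) by (simp add: L2_def)
qed

lemma L2_bounded:
  assumes "u \<in> borel_measurable (lebesgue_on \<Omega>)" and "\<And>x. x \<in> \<Omega> \<Longrightarrow> norm (u x) \<le> C"
  shows "u \<in> L2 \<Omega>"
proof (rule L2_I_dominated[OF assms(1), where g = "\<lambda>_. C\<^sup>2"])
  show "AE x in lebesgue_on \<Omega>. (norm (u x))\<^sup>2 \<le> C\<^sup>2"
    using assms(2) by (intro AE_I2) (auto intro: power_mono)
qed auto

lemma L2_diff:
  assumes "u \<in> L2 \<Omega>" "v \<in> L2 \<Omega>"
  shows "u - v \<in> L2 \<Omega>"
proof (rule L2_I_dominated)
  show "u - v \<in> borel_measurable (lebesgue_on \<Omega>)"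
    using assms[THEN L2_measurable] unfolding fun_diff_def by measurable
  show "integrable (lebesgue_on \<Omega>) (\<lambda>x. 2 * (norm (u x))\<^sup>2 + 2 * (norm (v x))\<^sup>2)"
    using assms[THEN L2_integrable_power2] by auto
qed (simp add: norm_power2_diff_le)

lemma L2_integrable_inner:
  assumes "u \<in> L2 \<Omega>" "v \<in> L2 \<Omega>"
  shows "integrable (lebesgue_on \<Omega>) (\<lambda>x. u x \<bullet> v x)"
    and "integrable (lebesgue_on \<Omega>) (\<lambda>x. norm (u x) * norm (v x))"
proof -
  have le: "norm (u x) * norm (v x) \<le> (norm (u x))\<^sup>2 + (norm (v x))\<^sup>2" for x
    using sum_squares_bound[of "norm (u x)" "norm (v x)"] mult_nonneg_nonneg[of "norm (u x)" "norm (v x)"]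
      norm_ge_zero[of "u x"] norm_ge_zero[of "v x"] by linarith
  have i: "integrable (lebesgue_on \<Omega>) (\<lambda>x. (norm (u x))\<^sup>2 + (norm (v x))\<^sup>2)"
    using assms[THEN L2_integrable_power2] by auto
  note [measurable] = assms[THEN L2_measurable]
  show "integrable (lebesgue_on \<Omega>) (\<lambda>x. norm (u x) * norm (v x))"
    by (rule Bochner_Integration.integrable_bound[OF i]) (use le in auto)
  show "integrable (lebesgue_on \<Omega>) (\<lambda>x. u x \<bullet> v x)"
    by (rule Bochner_Integration.integrable_bound[OF i])
      (auto intro!: AE_I2 order_trans[OF Cauchy_Schwarz_ineq2 le])
qed

lemma L2_const: "(\<lambda>_. c) \<in> L2 \<Omega>"
  by (rule L2_bounded) auto

lemma L2_integrable:
  assumes "u \<in> L2 \<Omega>"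
  shows "integrable (lebesgue_on \<Omega>) u"
  using L2_integrable_inner(2)[OF assms L2_const[of "axis 1 1"]] L2_measurable[OF assms]
  by (auto intro: Bochner_Integration.integrable_bound simp: norm_axis_1)

lemma ip_commute: "ip \<Omega> u v = ip \<Omega> v u"
  by (simp add: ip_def inner_commute)

lemma ip_diff_left: "u \<in> L2 \<Omega> \<Longrightarrow> v \<in> L2 \<Omega> \<Longrightarrow> w \<in> L2 \<Omega> \<Longrightarrow> ip \<Omega> (u - v) w = ip \<Omega> u w - ip \<Omega> v w"
  by (simp add: ip_def inner_diff_left L2_integrable_inner)

lemma ip_diff_right: "u \<in> L2 \<Omega> \<Longrightarrow> v \<in> L2 \<Omega> \<Longrightarrow> w \<in> L2 \<Omega> \<Longrightarrow> ip \<Omega> w (u - v) = ip \<Omega> w u - ip \<Omega> w v"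
  by (simp add: ip_def inner_diff_right L2_integrable_inner)

lemma ip_nonneg: "0 \<le> ip \<Omega> u u"
  unfolding ip_def by (rule integral_nonneg_AE) auto

lemma L2_norm_nonneg: "0 \<le> L2_norm \<Omega> u"
  by (simp add: L2_norm_def ip_nonneg)

lemma L2_norm_power2: "(L2_norm \<Omega> u)\<^sup>2 = ip \<Omega> u u"
  by (simp add: L2_norm_def ip_nonneg)

text \<open>Integrate the square of \<open>norm u + l * norm v\<close>. The version with norms
  covers both the inner product and, later, the convection term.\<close>

lemma L2_norm_mult_le:
  assumes "u \<in> L2 \<Omega>" "v \<in> L2 \<Omega>"
  shows "(LINT x|lebesgue_on \<Omega>. norm (u x) * norm (v x)) \<le> L2_norm \<Omega> u * L2_norm \<Omega> v"
  unfolding L2_norm_def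
proof (rule quadratic_nonneg_discriminant)
  fix l :: real
  have "0 \<le> (LINT x|lebesgue_on \<Omega>. (norm (u x) + l * norm (v x))\<^sup>2)"
    by (rule integral_nonneg_AE) auto
  also have "\<dots> = (LINT x|lebesgue_on \<Omega>. (norm (u x))\<^sup>2 + 2 * l * (norm (u x) * norm (v x)) + l\<^sup>2 * (norm (v x))\<^sup>2)"
    by (rule arg_cong[where f = "integral\<^sup>L _"]) (auto simp: power2_eq_square algebra_simps)
  also have "\<dots> = ip \<Omega> u u + 2 * l * (LINT x|lebesgue_on \<Omega>. norm (u x) * norm (v x)) + l\<^sup>2 * ip \<Omega> v v"
    using assms[THEN L2_integrable_power2] L2_integrable_inner[OF assms]
    by (simp add: ip_def dot_square_norm)
  finally show "0 \<le> ip \<Omega> u u + 2 * l * (LINT x|lebesgue_on \<Omega>. norm (u x) * norm (v x)) + l\<^sup>2 * ip \<Omega> v v" .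
qed (auto simp: ip_nonneg)

lemma ip_abs_le:
  assumes "u \<in> L2 \<Omega>" "v \<in> L2 \<Omega>"
  shows "\<bar>ip \<Omega> u v\<bar> \<le> L2_norm \<Omega> u * L2_norm \<Omega> v"
proof -
  have "\<bar>ip \<Omega> u v\<bar> \<le> (LINT x|lebesgue_on \<Omega>. norm (u x) * norm (v x))"
    unfolding ip_def
    by (rule integral_abs_bound[THEN order_trans], rule integral_mono)
      (use L2_integrable_inner[OF assms] in \<open>auto intro: Cauchy_Schwarz_ineq2\<close>)
  then show ?thesis using L2_norm_mult_le[OF assms] by linarith
qed

lemma L2_norm_diff_power2:
  assumes "u \<in> L2 \<Omega>" "v \<in> L2 \<Omega>"
  shows "(L2_norm \<Omega> (u - v))\<^sup>2 = (L2_norm \<Omega> u)\<^sup>2 - 2 * ip \<Omega> u v + (L2_norm \<Omega> v)\<^sup>2"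
  using assms L2_diff[OF assms] by (simp add: L2_norm_power2 ip_diff_left ip_diff_right ip_commute)

lemma L2_norm_diff_le:
  assumes "u \<in> L2 \<Omega>" "v \<in> L2 \<Omega>"
  shows "L2_norm \<Omega> (u - v) \<le> L2_norm \<Omega> u + L2_norm \<Omega> v"
proof (rule power2_le_imp_le)
  show "(L2_norm \<Omega> (u - v))\<^sup>2 \<le> (L2_norm \<Omega> u + L2_norm \<Omega> v)\<^sup>2"
    using ip_abs_le[OF assms] by (auto simp: L2_norm_diff_power2[OF assms] power2_sum abs_le_iff)
qed (simp add: L2_norm_nonneg)

lemma L2_norm_diff_commute: "L2_norm \<Omega> (u - v) = L2_norm \<Omega> (v - u)"
  unfolding L2_norm_def ip_def by (simp add: inner_diff inner_commute algebra_simps)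

lemma L2_norm_triangle:
  assumes "u \<in> L2 \<Omega>" "v \<in> L2 \<Omega>" "w \<in> L2 \<Omega>"
  shows "L2_norm \<Omega> (u - w) \<le> L2_norm \<Omega> (u - v) + L2_norm \<Omega> (v - w)"
proof -
  have "u - w = (u - v) - (w - v)" by (auto simp: fun_eq_iff)
  then show ?thesis
    using L2_norm_diff_le[of "u - v" "w - v"] assms L2_diff L2_norm_diff_commute[of w v] by simp
qed

lemma L2_norm_diff_abs:
  assumes "u \<in> L2 \<Omega>" "v \<in> L2 \<Omega>"
  shows "\<bar>L2_norm \<Omega> u - L2_norm \<Omega> v\<bar> \<le> L2_norm \<Omega> (u - v)"
proof -
  have 0: "(\<lambda>x. 0) \<in> L2 \<Omega>" by (rule L2_const)
  have "u - (\<lambda>x. 0) = u" "v - (\<lambda>x. 0) = v" by (auto simp: fun_eq_iff)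
  then show ?thesis
    using L2_norm_triangle[OF assms 0] L2_norm_triangle[OF assms(2,1) 0] L2_norm_diff_commute[of u v]
    by auto
qed

lemma L2_norm_AE_cong:
  assumes "u \<in> L2 \<Omega>" "v \<in> L2 \<Omega>" "AE x in lebesgue_on \<Omega>. u x = v x"
  shows "L2_norm \<Omega> u = L2_norm \<Omega> v"
  unfolding L2_norm_def ip_def
  using assms(3) L2_integrable_inner(1)[OF assms(1,1)] L2_integrable_inner(1)[OF assms(2,2)]
  by (intro arg_cong[where f = sqrt] integral_cong_AE) auto

lemma nn_integral_L2_norm:
  "u \<in> L2 \<Omega> \<Longrightarrow> (\<integral>\<^sup>+ x. ennreal ((norm (u x))\<^sup>2) \<partial>lebesgue_on \<Omega>) = ennreal ((L2_norm \<Omega> u)\<^sup>2)"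
  unfolding L2_norm_power2 ip_def dot_square_norm
  by (rule nn_integral_eq_integral[OF L2_integrable_power2]) auto

text \<open>Riesz-Fischer for representatives and a seminorm. Along a subsequence with geometrically
  decreasing steps the increments are summable in the mean, because the domain has finite measure,
  so it converges almost everywhere; Fatou's lemma carries the Cauchy bounds over to the
  limit.\<close>

lemma L2_complete:
  assumes L2: "\<And>n. u n \<in> L2 \<Omega>"
    and Cauchy: "\<And>e. 0 < e \<Longrightarrow> \<exists>N. \<forall>m\<ge>N. \<forall>n\<ge>N. L2_norm \<Omega> (u m - u n) < e"
  shows "\<exists>w\<in>L2 \<Omega>. (\<lambda>n. L2_norm \<Omega> (u n - w)) \<longlonglongrightarrow> 0"
proof -
  let ?M = "lebesgue_on \<Omega>"
  have [measurable]: "u n \<in> borel_measurable ?M" for n using L2 L2_measurable by blast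
  have "\<exists>N. \<forall>m\<ge>N. \<forall>n\<ge>N. L2_norm \<Omega> (u m - u n) < (1/2)^k" for k :: nat
    by (rule Cauchy) simp
  then obtain N where N: "\<And>k m n. m \<ge> N k \<Longrightarrow> n \<ge> N k \<Longrightarrow> L2_norm \<Omega> (u m - u n) < (1/2)^k" by metis
  \<comment> \<open>The partial sums give \<open>r k \<ge> N k\<close> and
    \<open>r k \<ge> k\<close> and make \<open>r\<close> nondecreasing, without a recursive choice
    of indices.\<close>
  define r where "r k = k + (\<Sum>i\<le>k. N i)" for k
  have rN: "N k \<le> r k" for k by (auto simp: r_def intro!: trans_le_add2 member_le_sum)
  have rk: "k \<le> r k" for k by (simp add: r_def)
  have rS: "r k \<le> r (Suc k)" for k by (simp add: r_def)
  define d where "d k x = u (r (Suc k)) x - u (r k) x" for k x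
  have d_eq: "d k = u (r (Suc k)) - u (r k)" for k by (auto simp: d_def)
  have dL2: "d k \<in> L2 \<Omega>" for k unfolding d_eq by (intro L2_diff L2)
  have [measurable]: "(\<lambda>x. d k x) \<in> borel_measurable ?M" for k unfolding d_def by measurable
  have dn: "L2_norm \<Omega> (d k) \<le> (1/2)^k" for k
    unfolding d_eq using N[of k "r (Suc k)" "r k"] rN[of k] rS[of k] by linarith
  \<comment> \<open>The norm of a constant unit field, that is, the square root of the volume of the
    domain; Cauchy-Schwarz against it passes from square integrals to integrals of the norm.\<close>
  let ?c = "L2_norm \<Omega> (\<lambda>_. axis 1 1)"
  have "(\<integral>\<^sup>+ x. ennreal (norm (d k x)) \<partial>?M) \<le> ennreal ((1/2)^k * ?c)" for k
  proof -
    have "(LINT x|?M. norm (d k x)) \<le> L2_norm \<Omega> (d k) * ?c"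
      using L2_norm_mult_le[OF dL2 L2_const[of "axis 1 1"], of k] by (simp add: norm_axis_1)
    also have "\<dots> \<le> (1/2)^k * ?c"
      by (intro mult_right_mono dn L2_norm_nonneg)
    finally show ?thesis
      using L2_integrable[OF dL2] by (subst nn_integral_eq_integral) (auto intro: ennreal_leI)
  qed
  then have "(\<Sum>k. (\<integral>\<^sup>+ x. ennreal (norm (d k x)) \<partial>?M)) \<le> (\<Sum>k. ennreal ((1/2)^k * ?c))"
    by (intro suminf_le) auto
  also have "\<dots> = ennreal (\<Sum>k. (1/2)^k * ?c)"
    by (intro suminf_ennreal2) (auto simp: L2_norm_nonneg intro!: summable_mult2 summable_geometric)
  finally have "(\<integral>\<^sup>+ x. (\<Sum>k. ennreal (norm (d k x))) \<partial>?M) < \<infinity>"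
    by (subst nn_integral_suminf) (auto intro: le_less_trans)
  then have "AE x in ?M. (\<Sum>k. ennreal (norm (d k x))) \<noteq> \<infinity>"
    by (intro nn_integral_PInf_AE) (auto simp: less_top)
  then have conv: "AE x in ?M. convergent (\<lambda>k. u (r k) x)"
  proof (rule AE_mp, intro AE_I2 impI)
    fix x assume "(\<Sum>k. ennreal (norm (d k x))) \<noteq> \<infinity>"
    then have "summable (\<lambda>k. norm (d k x))" by (intro summable_suminf_not_top) auto
    then have "summable (\<lambda>k. d k x)" by (rule summable_norm_cancel)
    then have "convergent (\<lambda>n. \<Sum>k<n. d k x)" by (simp add: summable_iff_convergent)
    moreover have "(\<Sum>k<n. d k x) = u (r n) x - u (r 0) x" for n
      unfolding d_def by (rule sum_lessThan_telescope)
    ultimately show "convergent (\<lambda>k. u (r k) x)"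
      using convergent_add[OF _ convergent_const, of "\<lambda>k. u (r k) x - u (r 0) x" "u (r 0) x"] by simp
  qed
  define w where "w x = lim (\<lambda>k. u (r k) x)" for x
  have [measurable]: "w \<in> borel_measurable ?M" unfolding w_def by measurable
  have fatou: "(\<integral>\<^sup>+ x. ennreal ((norm (u n x - w x))\<^sup>2) \<partial>?M) \<le> ennreal (e\<^sup>2)"
    if "\<forall>m\<ge>K. L2_norm \<Omega> (u n - u m) \<le> e" and "e \<ge> 0" for n K e
  proof -
    have "(\<integral>\<^sup>+ x. ennreal ((norm (u n x - w x))\<^sup>2) \<partial>?M)
      = (\<integral>\<^sup>+ x. liminf (\<lambda>k. ennreal ((norm (u n x - u (r k) x))\<^sup>2)) \<partial>?M)"
    proof (rule nn_integral_cong_AE, rule AE_mp[OF conv], intro AE_I2 impI)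
      fix x assume "convergent (\<lambda>k. u (r k) x)"
      then have "(\<lambda>k. u (r k) x) \<longlonglongrightarrow> w x" by (simp add: w_def convergent_LIMSEQ_iff)
      then have "(\<lambda>k. ennreal ((norm (u n x - u (r k) x))\<^sup>2)) \<longlonglongrightarrow> ennreal ((norm (u n x - w x))\<^sup>2)"
        by (intro tendsto_intros)
      then show "ennreal ((norm (u n x - w x))\<^sup>2) = liminf (\<lambda>k. ennreal ((norm (u n x - u (r k) x))\<^sup>2))"
        by (intro lim_imp_Liminf[symmetric] trivial_limit_sequentially)
    qed
    also have "\<dots> \<le> liminf (\<lambda>k. \<integral>\<^sup>+ x. ennreal ((norm (u n x - u (r k) x))\<^sup>2) \<partial>?M)"
      by (rule nn_integral_liminf) auto
    also have "\<dots> \<le> ennreal (e\<^sup>2)"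
    proof -
      have "\<forall>\<^sub>F k in sequentially. (\<integral>\<^sup>+ x. ennreal ((norm (u n x - u (r k) x))\<^sup>2) \<partial>?M) \<le> ennreal (e\<^sup>2)"
        using eventually_ge_at_top[of K]
      proof eventually_elim
        case (elim k)
        then have "L2_norm \<Omega> (u n - u (r k)) \<le> e" using that(1) rk[of k] by auto
        then show ?case
          using nn_integral_L2_norm[OF L2_diff[OF L2 L2], of n "r k"]
          by (auto intro!: ennreal_leI power_mono L2_norm_nonneg)
      qed
      then show ?thesis by (intro Liminf_le) auto
    qed
    finally show ?thesis .
  qed
  have diffL2: "u n - w \<in> L2 \<Omega> \<and> L2_norm \<Omega> (u n - w) \<le> e"
    if "\<forall>m\<ge>K. L2_norm \<Omega> (u n - u m) \<le> e" and "e \<ge> 0" for n K e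
  proof -
    have le: "(\<integral>\<^sup>+ x. ennreal ((norm ((u n - w) x))\<^sup>2) \<partial>?M) \<le> ennreal (e\<^sup>2)"
      using fatou[OF that] by simp
    have "u n - w \<in> borel_measurable ?M" unfolding fun_diff_def by measurable
    moreover from this have "integrable ?M (\<lambda>x. (norm ((u n - w) x))\<^sup>2)"
      using le_less_trans[OF le ennreal_less_top] by (intro integrableI_bounded) auto
    ultimately have L: "u n - w \<in> L2 \<Omega>" by (simp add: L2_def)
    from le[unfolded nn_integral_L2_norm[OF L]] have "(L2_norm \<Omega> (u n - w))\<^sup>2 \<le> e\<^sup>2"
      by (simp add: ennreal_le_iff)
    then show ?thesis using L power2_le_imp_le[OF _ \<open>e \<ge> 0\<close>] by blast
  qed
  have fin: "\<exists>K. \<forall>n\<ge>K. u n - w \<in> L2 \<Omega> \<and> L2_norm \<Omega> (u n - w) \<le> e" if e: "e > 0" for e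
  proof -
    obtain N where "\<And>m n. m \<ge> N \<Longrightarrow> n \<ge> N \<Longrightarrow> L2_norm \<Omega> (u m - u n) < e" using Cauchy[OF e] by blast
    then show ?thesis using diffL2[of N _ e] e by (meson less_imp_le)
  qed
  obtain K where "u K - w \<in> L2 \<Omega>" using fin[of 1] by auto
  then have "u K - (u K - w) \<in> L2 \<Omega>" by (rule L2_diff[OF L2])
  moreover have "u K - (u K - w) = w" by (simp add: fun_eq_iff)
  ultimately have "w \<in> L2 \<Omega>" by (simp only:)
  moreover have "(\<lambda>n. L2_norm \<Omega> (u n - w)) \<longlonglongrightarrow> 0"
  proof (rule LIMSEQ_I)
    fix e :: real assume "e > 0"
    then obtain K where K: "\<And>n. n \<ge> K \<Longrightarrow> L2_norm \<Omega> (u n - w) \<le> e/2"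
      using fin[of "e/2"] by auto
    have "norm (L2_norm \<Omega> (u n - w) - 0) < e" if "n \<ge> K" for n
      using K[OF that] L2_norm_nonneg[of "u n - w"] \<open>e > 0\<close> by simp
    then show "\<exists>no. \<forall>n\<ge>no. norm (L2_norm \<Omega> (u n - w) - 0) < e" by blast
  qed
  ultimately show ?thesis by blast
qed

end

subsection \<open>Weak partial derivatives\<close>

lemma smooth_plateau_sequence:
  fixes a b :: real
  assumes "a < b"
  obtains \<psi> :: "nat \<Rightarrow> real \<Rightarrow> real" and c d :: "nat \<Rightarrow> real"
  where "\<And>n. smooth (\<psi> n)" "\<And>n x. 0 \<le> \<psi> n x" "\<And>n x. \<psi> n x \<le> 1"
    "\<And>n x. x \<notin> {c n..d n} \<Longrightarrow> \<psi> n x = 0" "\<And>n. a < c n" "\<And>n. d n < b"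
    "\<And>x. (\<lambda>n. \<psi> n x) \<longlonglongrightarrow> indicator {a<..<b} x"
proof -
  \<comment> \<open>The 5 in the denominator guarantees \<open>5 * h n \<le> b - a\<close>, which
    leaves room for two margins and two ramps of width \<open>h n\<close> and a plateau between
    them.\<close>
  define h where "h n = (b - a) / (real n + 5)" for n
  have h0: "h n > 0" for n using assms by (auto simp: h_def)
  have h5: "5 * h n \<le> b - a" for n
    using assms mult_right_mono[of a b "real n"] by (auto simp: h_def field_simps)
  have hlim: "h \<longlonglongrightarrow> 0"
    unfolding h_def by (rule real_tendsto_divide_at_top[OF tendsto_const])
      (auto intro!: filterlim_tendsto_add_at_top tendsto_const filterlim_real_sequentially simp: add.commute[of _ 5])
  have "\<exists>\<phi>. smooth \<phi> \<and> (\<forall>x. 0 \<le> \<phi> x \<and> \<phi> x \<le> 1) \<and> (\<forall>x. x \<notin> {a + h n..b - h n} \<longrightarrow> \<phi> x = (0::real))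
    \<and> (\<forall>x. a + 2 * h n \<le> x \<longrightarrow> x \<le> b - 2 * h n \<longrightarrow> \<phi> x = 1)" for n
  proof -
    have ord: "a < a + h n" "a + h n < a + 2 * h n" "a + 2 * h n \<le> b - 2 * h n" "b - 2 * h n < b - h n"
      using h0[of n] h5[of n] by auto
    obtain \<eta>1 \<sigma>1 where S1: "smooth_step_on (a + h n) (a + 2 * h n) \<eta>1 \<sigma>1"
      by (rule smooth_step_on_exists[OF ord(2)])
    obtain \<eta>2 \<sigma>2 where S2: "smooth_step_on (b - 2 * h n) (b - h n) \<eta>2 \<sigma>2"
      by (rule smooth_step_on_exists[OF ord(4)])
    show ?thesis
      by (intro exI[of _ "\<lambda>t. \<sigma>1 t - \<sigma>2 t"] conjI allI impI smooth_diff test_function_steps[OF S1 S2 ord]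
          smooth_step_onD(2)[OF S1] smooth_step_onD(2)[OF S2])
  qed
  then obtain \<psi> where \<psi>: "\<And>n. smooth (\<psi> n)" "\<And>n x. 0 \<le> \<psi> n x" "\<And>n x. \<psi> n x \<le> (1::real)"
    "\<And>n x. x \<notin> {a + h n..b - h n} \<Longrightarrow> \<psi> n x = 0"
    "\<And>n x. a + 2 * h n \<le> x \<Longrightarrow> x \<le> b - 2 * h n \<Longrightarrow> \<psi> n x = 1"
    by metis
  have "(\<lambda>n. \<psi> n x) \<longlonglongrightarrow> indicator {a<..<b} x" for x
  proof (cases "x \<in> {a<..<b}")
    case True
    then have "min (x - a) (b - x) / 2 > 0" by auto
    then have "\<forall>\<^sub>F n in sequentially. h n < min (x - a) (b - x) / 2"
      by (rule order_tendstoD(2)[OF hlim])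
    then have "\<forall>\<^sub>F n in sequentially. \<psi> n x = 1"
      by eventually_elim (rule \<psi>(5), auto)
    then show ?thesis using True by (simp add: tendsto_eventually)
  next
    case False
    then have "\<psi> n x = 0" for n using h0[of n] by (intro \<psi>(4)) auto
    then show ?thesis using False by simp
  qed
  then show ?thesis
    using h0 by (intro that[of \<psi> "\<lambda>n. a + h n" "\<lambda>n. b - h n"] \<psi>(1-3)) (auto intro: \<psi>(4))
qed

lemma smooth_component: "smooth g \<Longrightarrow> smooth (\<lambda>x::real^3. g (x $ i) :: real)"
  using smooth_compose_inner[of g 0 "axis i 1"] by (simp add: cart_eq_inner_axis)

lemma test_functions_approx_box:
  fixes a b :: "real^3"
  assumes "box a b \<subseteq> S"
  obtains \<phi> :: "nat \<Rightarrow> real^3 \<Rightarrow> real"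
  where "\<And>n. \<phi> n \<in> test_functions S" "\<And>n x. 0 \<le> \<phi> n x" "\<And>n x. \<phi> n x \<le> 1"
    "\<And>x. (\<lambda>n. \<phi> n x) \<longlonglongrightarrow> indicator (box a b) x"
proof (cases "box a b = {}")
  case True
  have "(\<lambda>x. 0) \<in> test_functions S"
    by (rule test_functionsI[where K = "{}"]) auto
  then show ?thesis using True by (intro that[of "\<lambda>n x. 0"]) auto
next
  case False
  then have ab: "a $ i < b $ i" for i
    by (simp add: interval_ne_empty_cart)
  have "\<exists>\<psi> c d. (\<forall>n. smooth (\<psi> n)) \<and> (\<forall>n x. 0 \<le> \<psi> n x) \<and> (\<forall>n x. \<psi> n x \<le> 1) \<and>
    (\<forall>n x. x \<notin> {c n..d n} \<longrightarrow> \<psi> n x = 0) \<and> (\<forall>n. a $ i < c n) \<and> (\<forall>n. d n < b $ i) \<and>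
    (\<forall>x. (\<lambda>n. \<psi> n x) \<longlonglongrightarrow> (indicator {a $ i<..<b $ i} x :: real))" for i
    by (rule smooth_plateau_sequence[OF ab[of i]]) (intro exI conjI allI impI; assumption | blast)
  then obtain \<psi> c d where \<psi>: "\<And>i n. smooth (\<psi> i n)" "\<And>i n x. 0 \<le> \<psi> i n x" "\<And>i n x. \<psi> i n x \<le> (1::real)"
    "\<And>i n x. x \<notin> {c i n..d i n} \<Longrightarrow> \<psi> i n x = 0" "\<And>i n. a $ i < c i n" "\<And>i n. d i n < b $ i"
    "\<And>i x. (\<lambda>n. \<psi> i n x) \<longlonglongrightarrow> indicator {a $ i<..<b $ i} x"
    by metis
  define \<phi> where "\<phi> n x = \<psi> 1 n (x $ 1) * (\<psi> 2 n (x $ 2) * \<psi> 3 n (x $ 3))" for n and x :: "real^3"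
  show ?thesis
  proof (rule that[of \<phi>])
    show "\<phi> n \<in> test_functions S" for n
    proof (rule test_functionsI[where K = "cbox (\<chi> i. c i n) (\<chi> i. d i n)"])
      show "smooth (\<phi> n)" unfolding \<phi>_def by (intro smooth_mult smooth_component \<psi>)
      have "cbox (\<chi> i. c i n) (\<chi> i. d i n) \<subseteq> box a b"
        by (auto simp: mem_box_cart) (meson \<psi>(5) less_le_trans, meson \<psi>(6) le_less_trans)
      then show "cbox (\<chi> i. c i n) (\<chi> i. d i n) \<subseteq> S" using assms by auto
      show "\<phi> n x = 0" if "x \<notin> cbox (\<chi> i. c i n) (\<chi> i. d i n)" for x
      proof -
        have "\<exists>i. x $ i \<notin> {c i n..d i n}" using that by (simp add: mem_box_cart)
        then obtain i where "x $ i \<notin> {c i n..d i n}" ..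
        then have "\<psi> i n (x $ i) = 0" by (rule \<psi>(4))
        then show ?thesis using exhaust_3[of i] by (auto simp: \<phi>_def)
      qed
    qed auto
    show "0 \<le> \<phi> n x" for n x using \<psi>(2) by (simp add: \<phi>_def)
    show "\<phi> n x \<le> 1" for n x using \<psi>(2,3) unfolding \<phi>_def by (intro mult_le_one) auto
    show "(\<lambda>n. \<phi> n x) \<longlonglongrightarrow> indicator (box a b) x" for x
    proof -
      have "(\<lambda>n. \<phi> n x) \<longlonglongrightarrow> indicator {a $ 1<..<b $ 1} (x $ 1) *
          (indicator {a $ 2<..<b $ 2} (x $ 2) * indicator {a $ 3<..<b $ 3} (x $ 3))"
        unfolding \<phi>_def by (intro tendsto_mult \<psi>(7))
      moreover have "indicator {a $ 1<..<b $ 1} (x $ 1) * (indicator {a $ 2<..<b $ 2} (x $ 2) *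
          indicator {a $ 3<..<b $ 3} (x $ 3)) = (indicator (box a b) x :: real)"
        by (auto simp: indicator_def mem_box_cart forall_3)
      ultimately show ?thesis by simp
    qed
  qed
qed

text \<open>Boxes are stable under intersection and generate the Borel sets, so Dynkin's argument
  extends the vanishing of the integrals. It is run for \<open>g\<close> cut off outside
  \<open>box p q\<close>: intersecting with this box keeps every box inside \<open>S\<close>, and
  the total integral vanishes as well, which the step to complements requires.\<close>

lemma AE_zero_if_box_integrals_zero:
  fixes g :: "real^3 \<Rightarrow> 'b::euclidean_space"
  assumes g: "integrable lebesgue g"
    and zero: "\<And>c d. box c d \<subseteq> S \<Longrightarrow> (LINT x|lebesgue. indicator (box c d) x *\<^sub>R g x) = 0"
    and pq: "box p q \<subseteq> S"
  shows "AE x in lebesgue. x \<in> box p q \<longrightarrow> g x = 0"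
proof -
  define h where "h x = indicator (box p q) x *\<^sub>R g x" for x
  have h: "integrable lebesgue h" unfolding h_def
    by (rule integrable_mult_indicator[OF _ g]) auto
  have boxes: "\<exists>r s. box a b \<inter> box c d = box r s" for a b c d :: "real^3"
    by (intro exI, rule box_Int_box)
  have hbox: "(LINT x|lebesgue. indicator (box c d) x *\<^sub>R h x) = 0" for c d
  proof -
    obtain r s where "box c d \<inter> box p q = box r s" using boxes by blast
    then have "indicator (box c d) x *\<^sub>R h x = indicator (box r s) x *\<^sub>R g x" for x
      by (auto simp: h_def indicator_def)
    moreover have "box r s \<subseteq> S" using \<open>box c d \<inter> box p q = box r s\<close> pq by auto
    ultimately show ?thesis using zero by simp
  qed
  have int: "integrable lebesgue (\<lambda>x. indicator A x *\<^sub>R h x)" if "A \<in> sets lebesgue" for A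
    using integrable_mult_indicator[OF that h] .
  have borel: "(LINT x|lebesgue. indicator A x *\<^sub>R h x) = 0" if "A \<in> sets borel" for A
  proof -
    have "Int_stable (range (\<lambda>(a, b). box a b :: (real^3) set))"
      using boxes by (auto simp: Int_stable_def image_iff)
    moreover have "range (\<lambda>(a, b). box a b :: (real^3) set) \<subseteq> Pow UNIV" by simp
    moreover have "A \<in> sigma_sets UNIV (range (\<lambda>(a, b). box a b :: (real^3) set))"
      using that by (simp add: borel_eq_box)
    ultimately show ?thesis
    proof (induction rule: sigma_sets_induct_disjoint)
      case (compl A)
      then have "A \<in> sets borel" by (simp add: borel_eq_box)
      have "h x = indicator (box p q) x *\<^sub>R h x" for x by (auto simp: h_def indicator_def)
      then have "(LINT x|lebesgue. h x) = 0" using hbox[of p q] by simp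
      moreover have "indicator (UNIV - A) x *\<^sub>R h x = h x - indicator A x *\<^sub>R h x" for x
        by (auto simp: indicator_def)
      ultimately show ?case
        using compl h int[of A] \<open>A \<in> sets borel\<close> by simp
    next
      case (union A)
      have A: "A i \<in> sets lebesgue" for i
        using union(2) by (intro sets_completionI_sets) (simp add: borel_eq_box; blast)
      have "(LINT x:(\<Union>i. A i)|lebesgue. h x) = (\<Sum>i. (LINT x:A i|lebesgue. h x))"
      proof (rule lebesgue_integral_countable_add[OF A])
        show "A i \<inter> A j = {}" if "i \<noteq> j" for i j
          using union(1) that by (auto simp: disjoint_family_on_def)
        show "set_integrable lebesgue (\<Union>i. A i) h"
          unfolding set_integrable_def using A by (intro int) auto
      qed
      then show ?case using union by (simp add: set_lebesgue_integral_def)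
    qed (use hbox in auto)
  qed
  have leb: "(LINT x|lebesgue. indicator A x *\<^sub>R h x) = 0" if A: "A \<in> sets lebesgue" for A
  proof -
    \<comment> \<open>A Lebesgue set is an F-sigma set up to a null set, which reduces the claim to
      Borel sets.\<close>
    obtain C T where CT: "fsigma C" "T \<in> null_sets lebesgue" "C \<union> T = A"
      by (rule lebesgue_set_almost_fsigma[OF A]) (simp add: negligible_iff_null_sets)
    have C: "C \<in> sets borel" using CT(1) by (auto elim!: fsigma.cases)
    have "(LINT x|lebesgue. indicator A x *\<^sub>R h x) = (LINT x|lebesgue. indicator C x *\<^sub>R h x)"
    proof (rule integral_cong_AE)
      have "AE x in lebesgue. x \<notin> T"
        using CT(2) by (rule AE_not_in)
      then show "AE x in lebesgue. indicat_real A x *\<^sub>R h x = indicat_real C x *\<^sub>R h x"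
        by eventually_elim (use CT in \<open>auto simp: indicator_def\<close>)
      show "(\<lambda>x. indicat_real A x *\<^sub>R h x) \<in> borel_measurable lebesgue"
        using int[OF A] by (rule borel_measurable_integrable)
      have "C \<in> sets lebesgue" using C by simp
      then show "(\<lambda>x. indicat_real C x *\<^sub>R h x) \<in> borel_measurable lebesgue"
        by (intro borel_measurable_integrable int)
    qed
    then show ?thesis using borel[OF C] by simp
  qed
  let ?B = "box p q"
  have B: "?B \<in> sets lebesgue" by simp
  interpret finite_measure "lebesgue_on ?B" by (rule finite_measure_lebesgue_on) simp
  have "AE x in lebesgue_on ?B. g x = 0"
  proof (rule density_zero)
    show "integrable (lebesgue_on ?B) g"
      using h by (subst integrable_restrict_space) (auto simp flip: h_def)
    fix A assume "A \<in> sets (lebesgue_on ?B)"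
    then have A: "A \<in> sets lebesgue" "A \<subseteq> ?B"
      by (auto simp: sets_restrict_space_iff)
    have "indicator ?B x *\<^sub>R indicator A x *\<^sub>R g x = indicator A x *\<^sub>R h x" for x
      by (simp add: h_def mult.commute)
    then show "set_lebesgue_integral (lebesgue_on ?B) A g = 0"
      using leb[OF A(1)] by (simp add: set_lebesgue_integral_def integral_restrict_space)
  qed
  then show ?thesis by (subst (asm) AE_restrict_space_iff) auto
qed

context bounded_domain
begin

lemma AE_lebesgue_on_dom: "(AE x in lebesgue_on \<Omega>. P x) \<longleftrightarrow> (AE x in lebesgue. x \<in> \<Omega> \<longrightarrow> P x)"
  by (subst AE_restrict_space_iff) auto

text \<open>By dominated convergence the test functions may be replaced by indicators of boxes
  inside the domain. Countably many such boxes cover it, so the exceptional sets add up to a null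
  set.\<close>

lemma fundamental_lemma_variations:
  fixes g :: field3
  assumes g: "integrable (lebesgue_on \<Omega>) g"
    and zero: "\<And>\<phi>. \<phi> \<in> test_functions \<Omega> \<Longrightarrow> (LINT x|lebesgue_on \<Omega>. \<phi> x *\<^sub>R g x) = 0"
  shows "AE x in lebesgue_on \<Omega>. g x = 0"
proof -
  define G where "G x = indicator \<Omega> x *\<^sub>R g x" for x
  have G: "integrable lebesgue G"
    using g unfolding G_def[abs_def] by (subst (asm) integrable_restrict_space) auto
  have boxz: "(LINT x|lebesgue. indicator (box c d) x *\<^sub>R G x) = 0" if cd: "box c d \<subseteq> \<Omega>" for c d
  proof -
    obtain \<phi> where \<phi>: "\<And>n. \<phi> n \<in> test_functions \<Omega>" "\<And>n x. 0 \<le> \<phi> n x" "\<And>n x. \<phi> n x \<le> (1::real)"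
      "\<And>x. (\<lambda>n. \<phi> n x) \<longlonglongrightarrow> indicator (box c d) x"
      using test_functions_approx_box[OF cd] by metis
    have meas: "\<phi> n \<in> borel_measurable lebesgue" for n
    proof -
      have "continuous_on UNIV (\<phi> n)" using \<phi>(1)[of n] by (simp add: test_functions_def smooth_continuous_on)
      then have "\<phi> n \<in> borel_measurable borel" by (rule borel_measurable_continuous_onI)
      then show ?thesis by (simp add: measurable_completion)
    qed
    have "(\<lambda>n. LINT x|lebesgue. \<phi> n x *\<^sub>R G x) \<longlonglongrightarrow> (LINT x|lebesgue. indicator (box c d) x *\<^sub>R G x)"
    proof (rule integral_dominated_convergence[where w = "\<lambda>x. norm (G x)"])
      show "AE x in lebesgue. norm (\<phi> n x *\<^sub>R G x) \<le> norm (G x)" for n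
        using \<phi>(2,3) by (intro AE_I2) (simp add: mult_left_le_one_le)
      show "AE x in lebesgue. (\<lambda>n. \<phi> n x *\<^sub>R G x) \<longlonglongrightarrow> indicat_real (box c d) x *\<^sub>R G x"
        by (intro AE_I2 tendsto_scaleR \<phi>(4) tendsto_const)
      show "(\<lambda>x. \<phi> n x *\<^sub>R G x) \<in> borel_measurable lebesgue" for n
        using borel_measurable_integrable[OF G] meas by (rule borel_measurable_scaleR[rotated])
      show "(\<lambda>x. indicat_real (box c d) x *\<^sub>R G x) \<in> borel_measurable lebesgue"
        using borel_measurable_integrable[OF G] by (intro borel_measurable_scaleR borel_measurable_indicator) simp_all
      show "integrable lebesgue (\<lambda>x. norm (G x))" using G by (rule integrable_norm)
    qed
    moreover have "(LINT x|lebesgue. \<phi> n x *\<^sub>R G x) = 0" for n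
    proof -
      have "(LINT x|lebesgue. indicator \<Omega> x *\<^sub>R \<phi> n x *\<^sub>R g x) = 0"
        using zero[OF \<phi>(1)[of n]] by (simp add: integral_restrict_space)
      moreover have "indicator \<Omega> x *\<^sub>R \<phi> n x *\<^sub>R g x = \<phi> n x *\<^sub>R G x" for x
        by (simp add: G_def mult.commute)
      ultimately show ?thesis by simp
    qed
    ultimately show ?thesis by (simp add: LIMSEQ_const_iff)
  qed
  obtain D where D: "countable D" "D \<subseteq> Pow \<Omega>" "\<And>X. X \<in> D \<Longrightarrow> \<exists>a b. X = box a b" "\<Union>D = \<Omega>"
    using open_countable_Union_open_box[OF open_dom] by metis
  have "AE x in lebesgue. \<forall>X\<in>D. x \<in> X \<longrightarrow> G x = 0"
  proof (rule AE_ball_countable[THEN iffD2, OF D(1)], rule)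
    fix X assume X: "X \<in> D"
    then obtain a b where "X = box a b" using D(3) by blast
    then show "AE x in lebesgue. x \<in> X \<longrightarrow> G x = 0"
      using AE_zero_if_box_integrals_zero[where S = \<Omega> and p = a and q = b, OF G boxz] X D(2) by auto
  qed
  then show ?thesis
    unfolding AE_lebesgue_on_dom by eventually_elim (use D(4) in \<open>auto simp: G_def indicator_def split: if_splits\<close>)
qed

end

section \<open>Integration by parts with compactly supported functions\<close>

lemma integrable_compact_support:
  fixes f :: "'a::euclidean_space \<Rightarrow> 'b::euclidean_space"
  assumes "continuous_on UNIV f" "compact K" "\<And>x. x \<notin> K \<Longrightarrow> f x = 0"
  shows "integrable lborel f"
proof -
  have "integrable lborel (\<lambda>x. indicator K x *\<^sub>R f x)"
    using borel_integrable_compact[OF assms(2) continuous_on_subset[OF assms(1)]] by simp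
  moreover have "indicator K x *\<^sub>R f x = f x" for x using assms(3) by (auto simp: indicator_def)
  ultimately show ?thesis by simp
qed

lemma bounded_compact_support:
  fixes f :: "'a::euclidean_space \<Rightarrow> 'b::euclidean_space"
  assumes "continuous_on UNIV f" "compact K" "\<And>x. x \<notin> K \<Longrightarrow> f x = 0"
  obtains C where "C \<ge> 0" "\<And>x. norm (f x) \<le> C"
proof -
  have "bounded (f ` K)"
    by (intro compact_imp_bounded compact_continuous_image continuous_on_subset[OF assms(1)] assms(2)) simp
  then obtain C where C: "\<And>x. x \<in> K \<Longrightarrow> norm (f x) \<le> C" by (auto simp: bounded_iff)
  show ?thesis
  proof (rule that[of "max C 0"])
    show "norm (f x) \<le> max C 0" for x
      using C[of x] assms(3)[of x] by (cases "x \<in> K") auto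
  qed auto
qed

lemma lborel_integral_translate:
  fixes f :: "'a::euclidean_space \<Rightarrow> 'b::euclidean_space"
  assumes "f \<in> borel_measurable borel"
  shows "(LINT x|lborel. f (x + c)) = (LINT x|lborel. f x)"
    and "integrable lborel (\<lambda>x. f (x + c)) = integrable lborel f"
proof -
  have m: "(+) c \<in> lborel \<rightarrow>\<^sub>M borel" by simp
  have eq: "distr lborel borel ((+) c) = lborel" by (rule lborel_distr_plus)
  show "(LINT x|lborel. f (x + c)) = (LINT x|lborel. f x)"
    using integral_distr[OF m assms] unfolding eq by (simp add: add.commute)
  show "integrable lborel (\<lambda>x. f (x + c)) = integrable lborel f"
    using integrable_distr_eq[OF m assms] unfolding eq by (simp add: add.commute)
qed

lemma dir_deriv_vanish:
  assumes "closed K" "\<And>x. x \<notin> K \<Longrightarrow> f x = 0" "x \<notin> K"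
  shows "dir_deriv v f x = 0"
proof (rule dir_deriv_eqI)
  have "((\<lambda>x. 0) has_derivative (\<lambda>v. 0)) (at x)" by simp
  then show "(f has_derivative (\<lambda>v. 0)) (at x)"
    by (rule has_derivative_transform_within_open[where s = "- K"]) (use assms in auto)
qed

lemma has_derivative_along_line:
  assumes "f differentiable (at (x + t *\<^sub>R v))"
  shows "((\<lambda>t. f (x + t *\<^sub>R v)) has_derivative (\<lambda>s. s *\<^sub>R dir_deriv v f (x + t *\<^sub>R v))) (at t within S)"
proof -
  note D = has_derivative_dir_deriv[OF assms]
  have "((\<lambda>t. x + t *\<^sub>R v) has_derivative (\<lambda>s. s *\<^sub>R v)) (at t within S)"
    by (auto intro!: derivative_eq_intros)
  from has_derivative_compose[OF this D]
  have "((\<lambda>t. f (x + t *\<^sub>R v)) has_derivative (\<lambda>s. dir_deriv (s *\<^sub>R v) f (x + t *\<^sub>R v))) (at t within S)" .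
  moreover have "dir_deriv (s *\<^sub>R v) f (x + t *\<^sub>R v) = s *\<^sub>R dir_deriv v f (x + t *\<^sub>R v)" for s
    using has_derivative_bounded_linear[OF D] by (rule linear_simps(5))
  ultimately show ?thesis by simp
qed

text \<open>By translation invariance every difference quotient of \<open>h\<close> has integral zero.\<close>

lemma integral_dir_deriv_compact_support:
  fixes h :: "'a::euclidean_space \<Rightarrow> 'b::euclidean_space"
  assumes "smooth h" "compact K" "\<And>x. x \<notin> K \<Longrightarrow> h x = 0"
  shows "(LINT x|lborel. dir_deriv v h x) = 0"
proof -
  let ?D = "dir_deriv v h"
  have cont: "continuous_on UNIV h" "continuous_on UNIV ?D"
    by (intro smooth_continuous_on smooth_dir_deriv assms(1))+
  have Dz: "?D x = 0" if "x \<notin> K" for x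
    using dir_deriv_vanish[OF compact_imp_closed[OF assms(2)] assms(3) that] .
  obtain C where C: "C \<ge> 0" "\<And>x. norm (?D x) \<le> C"
    using bounded_compact_support[OF cont(2) assms(2) Dz] by blast
  obtain R where "\<And>x. x \<in> K \<Longrightarrow> norm x \<le> R"
    using compact_imp_bounded[OF assms(2)] unfolding bounded_iff by blast
  then have R: "K \<subseteq> cball 0 R" by auto
  have hm: "h \<in> borel_measurable borel" by (rule borel_measurable_continuous_onI[OF cont(1)])
  have hi: "integrable lborel h" by (rule integrable_compact_support[OF cont(1) assms(2,3)])
  have hit: "integrable lborel (\<lambda>x. h (x + c))" for c
    using lborel_integral_translate(2)[OF hm] hi by blast
  \<comment> \<open>As \<open>t n \<le> 1\<close>, the difference quotients all vanish outside one
    ball of radius \<open>R + norm v\<close>, and the mean value inequality bounds them by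
    \<open>C\<close>; together this gives the dominating function.\<close>
  define t where "t n = 1 / real (Suc n)" for n
  have t: "0 < t n" "t n \<le> 1" for n by (auto simp: t_def)
  have t0: "t \<longlonglongrightarrow> 0" unfolding t_def by (rule LIMSEQ_Suc[OF lim_1_over_n])
  define q where "q n x = (1 / t n) *\<^sub>R (h (x + t n *\<^sub>R v) - h x)" for n x
  have "(\<lambda>n. LINT x|lborel. q n x) \<longlonglongrightarrow> (LINT x|lborel. ?D x)"
  proof (rule integral_dominated_convergence[where w = "\<lambda>x. indicator (cball 0 (R + norm v)) x *\<^sub>R C"])
    show "?D \<in> borel_measurable lborel"
      using borel_measurable_continuous_onI[OF cont(2)] by simp
    show "q n \<in> borel_measurable lborel" for n
      unfolding q_def using hm by measurable
    show "integrable lborel (\<lambda>x. indicator (cball 0 (R + norm v)) x *\<^sub>R C)"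
      by (rule borel_integrable_compact) auto
    show "AE x in lborel. (\<lambda>n. q n x) \<longlonglongrightarrow> ?D x"
    proof (rule AE_I2)
      fix x
      have "((\<lambda>t. h (x + t *\<^sub>R v)) has_derivative (\<lambda>s. s *\<^sub>R ?D (x + 0 *\<^sub>R v))) (at 0)"
        by (rule has_derivative_along_line[OF smooth_differentiable[OF assms(1)]])
      then have "((\<lambda>s. norm (h (x + s *\<^sub>R v) - h x - s *\<^sub>R ?D x) / norm s) \<longlongrightarrow> 0) (at 0)"
        by (simp add: has_derivative_at)
      moreover have "filterlim t (at 0) sequentially"
        using t(1) by (intro filterlim_atI t0) (simp add: less_imp_neq[symmetric])
      ultimately have "(\<lambda>n. norm (h (x + t n *\<^sub>R v) - h x - t n *\<^sub>R ?D x) / norm (t n)) \<longlonglongrightarrow> 0"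
        by (rule filterlim_compose)
      moreover have "norm (h (x + t n *\<^sub>R v) - h x - t n *\<^sub>R ?D x) / norm (t n) = norm (q n x - ?D x)" for n
      proof -
        have "q n x - ?D x = (1 / t n) *\<^sub>R (h (x + t n *\<^sub>R v) - h x - t n *\<^sub>R ?D x)"
          using t(1)[of n] by (simp add: q_def scaleR_diff_right)
        then show ?thesis using t(1)[of n] by (simp add: divide_inverse mult.commute)
      qed
      ultimately show "(\<lambda>n. q n x) \<longlonglongrightarrow> ?D x"
        by (simp add: tendsto_norm_zero_iff LIM_zero_iff)
    qed
    show "AE x in lborel. norm (q n x) \<le> indicat_real (cball 0 (R + norm v)) x *\<^sub>R C" for n
    proof (rule AE_I2)
      fix x
      have "norm (h (x + t n *\<^sub>R v) - h (x + 0 *\<^sub>R v)) \<le> C * norm (t n - 0)"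
      proof (rule differentiable_bound[where S = "{0..t n}" and f = "\<lambda>t. h (x + t *\<^sub>R v)"])
        show "((\<lambda>t. h (x + t *\<^sub>R v)) has_derivative (\<lambda>s. s *\<^sub>R ?D (x + y *\<^sub>R v))) (at y within {0..t n})" for y
          by (rule has_derivative_along_line[OF smooth_differentiable[OF assms(1)]])
        show "onorm (\<lambda>s. s *\<^sub>R ?D (x + y *\<^sub>R v)) \<le> C" for y
          by (rule onorm_le) (use C in \<open>auto simp: mult.commute[of C] intro: mult_left_mono\<close>)
      qed (use t[of n] in auto)
      moreover have "norm (q n x) = norm (h (x + t n *\<^sub>R v) - h x) / t n"
        using t(1)[of n] by (simp add: q_def divide_inverse mult.commute)
      ultimately have b: "norm (q n x) \<le> C"
        using t(1)[of n] by (simp add: pos_divide_le_eq)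
      have "q n x = 0" if "x \<notin> cball 0 (R + norm v)"
      proof -
        have "norm (t n *\<^sub>R v) \<le> norm v" using t[of n] by (simp add: mult_left_le_one_le)
        then have "norm (x + t n *\<^sub>R v) > R" "norm x > R"
          using that norm_diff_ineq[of x "t n *\<^sub>R v"] norm_ge_zero[of v] by (auto simp del: norm_ge_zero)
        then have "h (x + t n *\<^sub>R v) = 0" "h x = 0"
          using R by (auto intro!: assms(3))
        then show ?thesis by (simp add: q_def)
      qed
      then show "norm (q n x) \<le> indicat_real (cball 0 (R + norm v)) x *\<^sub>R C"
        using b by (auto simp: indicator_def)
    qed
  qed
  moreover have "(LINT x|lborel. q n x) = 0" for n
    unfolding q_def using hi hit lborel_integral_translate(1)[OF hm] by simp
  ultimately show ?thesis by (simp add: LIMSEQ_const_iff)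
qed

lemma test_functions_support:
  assumes "\<phi> \<in> test_functions S"
  obtains K where "compact K" "K \<subseteq> S" "\<And>x. x \<notin> K \<Longrightarrow> \<phi> x = 0" "smooth \<phi>"
proof (rule that[of "closure {x. \<phi> x \<noteq> 0}"])
  show "\<phi> x = 0" if "x \<notin> closure {x. \<phi> x \<noteq> 0}" for x
    using that closure_subset[of "{x. \<phi> x \<noteq> 0}"] by auto
qed (use assms in \<open>auto simp: test_functions_def\<close>)

context bounded_domain
begin

lemma continuous_in_L2:
  assumes "continuous_on UNIV u"
  shows "u \<in> L2 \<Omega>"
proof -
  have "compact (closure \<Omega>)" using bounded_dom by (simp add: compact_closure)
  then have "bounded (u ` closure \<Omega>)"
    by (intro compact_imp_bounded compact_continuous_image continuous_on_subset[OF assms]) simp_all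
  then obtain C where "\<And>x. x \<in> \<Omega> \<Longrightarrow> norm (u x) \<le> C"
    using closure_subset[of \<Omega>] by (auto simp: bounded_iff)
  moreover have "u \<in> borel_measurable (lebesgue_on \<Omega>)"
    using continuous_on_subset[OF assms] by (intro continuous_imp_measurable_on_sets_lebesgue) auto
  ultimately show ?thesis by (intro L2_bounded)
qed

lemma integral_dom_eq_lborel:
  fixes F :: "real^3 \<Rightarrow> 'b::euclidean_space"
  assumes "F \<in> borel_measurable borel" "\<And>x. x \<notin> \<Omega> \<Longrightarrow> F x = 0"
  shows "(LINT x|lebesgue_on \<Omega>. F x) = (LINT x|lborel. F x)"
proof -
  have "indicator \<Omega> x *\<^sub>R F x = F x" for x using assms(2) by (auto simp: indicator_def)
  then have "(LINT x|lebesgue_on \<Omega>. F x) = (LINT x|lebesgue. F x)"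
    by (simp add: integral_restrict_space)
  also have "\<dots> = (LINT x|lborel. F x)"
    using assms(1) by (intro integral_completion) simp
  finally show ?thesis .
qed

text \<open>Integration by parts: the derivative of the product of \<open>\<phi>\<close> and
  \<open>u\<close> has integral zero over the whole space, and since \<open>\<phi>\<close> is
  supported inside the domain, integrals over the domain and over the space agree.\<close>

lemma has_weak_partial_smooth:
  assumes "smooth u"
  shows "has_weak_partial \<Omega> i u (dir_deriv (axis i 1) u)"
  unfolding has_weak_partial_def
proof
  fix \<phi> :: "real^3 \<Rightarrow> real" assume "\<phi> \<in> test_functions \<Omega>"
  then obtain K where K: "compact K" "K \<subseteq> \<Omega>" "\<And>x. x \<notin> K \<Longrightarrow> \<phi> x = 0" "smooth \<phi>"
    by (rule test_functions_support) blast
  let ?e = "axis i 1 :: real^3"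
  have z: "dir_deriv ?e \<phi> x = 0" if "x \<notin> K" for x
    using dir_deriv_vanish[OF compact_imp_closed[OF K(1)] K(3) that] .
  have c: "continuous_on UNIV \<phi>" "continuous_on UNIV (dir_deriv ?e \<phi>)"
      "continuous_on UNIV u" "continuous_on UNIV (dir_deriv ?e u)"
    by (intro smooth_continuous_on smooth_dir_deriv K(4) assms)+
  have cc: "continuous_on UNIV (\<lambda>x. dir_deriv ?e \<phi> x *\<^sub>R u x)"
    "continuous_on UNIV (\<lambda>x. \<phi> x *\<^sub>R dir_deriv ?e u x)"
    by (intro continuous_on_scaleR c)+
  have i: "integrable lborel (\<lambda>x. dir_deriv ?e \<phi> x *\<^sub>R u x)"
    "integrable lborel (\<lambda>x. \<phi> x *\<^sub>R dir_deriv ?e u x)"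
    using integrable_compact_support[OF cc(1) K(1)] integrable_compact_support[OF cc(2) K(1)] z K(3) by auto
  have "(LINT x|lborel. dir_deriv ?e (\<lambda>x. \<phi> x *\<^sub>R u x) x) = 0"
    using K by (intro integral_dir_deriv_compact_support[OF smooth_scaleR[OF K(4) assms] K(1)]) auto
  moreover have "dir_deriv ?e (\<lambda>x. \<phi> x *\<^sub>R u x) x = \<phi> x *\<^sub>R dir_deriv ?e u x + dir_deriv ?e \<phi> x *\<^sub>R u x" for x
    using K(4) assms by (intro dir_deriv_scaleR smooth_differentiable)
  ultimately have "(LINT x|lborel. \<phi> x *\<^sub>R dir_deriv ?e u x) + (LINT x|lborel. dir_deriv ?e \<phi> x *\<^sub>R u x) = 0"
    using i by simp
  moreover have "(LINT x|lebesgue_on \<Omega>. dir_deriv ?e \<phi> x *\<^sub>R u x) = (LINT x|lborel. dir_deriv ?e \<phi> x *\<^sub>R u x)"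
    using z K(2) by (intro integral_dom_eq_lborel borel_measurable_continuous_onI[OF cc(1)]) auto
  moreover have "(LINT x|lebesgue_on \<Omega>. \<phi> x *\<^sub>R dir_deriv ?e u x) = (LINT x|lborel. \<phi> x *\<^sub>R dir_deriv ?e u x)"
    using K by (intro integral_dom_eq_lborel borel_measurable_continuous_onI[OF cc(2)]) auto
  ultimately show "(LINT x|lebesgue_on \<Omega>. dir_deriv ?e \<phi> x *\<^sub>R u x) = - (LINT x|lebesgue_on \<Omega>. \<phi> x *\<^sub>R dir_deriv ?e u x)"
    by (simp add: eq_neg_iff_add_eq_0 add.commute)
qed

lemma integrable_test_scaleR:
  fixes \<phi> :: "real^3 \<Rightarrow> real"
  assumes "smooth \<phi>" "compact K" "\<And>x. x \<notin> K \<Longrightarrow> \<phi> x = 0" "g \<in> L2 \<Omega>"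
  shows "integrable (lebesgue_on \<Omega>) (\<lambda>x. \<phi> x *\<^sub>R g x)"
proof -
  have c: "continuous_on UNIV \<phi>" using assms(1) by (rule smooth_continuous_on)
  obtain C where C: "C \<ge> 0" "\<And>x. norm (\<phi> x) \<le> C"
    using bounded_compact_support[OF c assms(2,3)] by blast
  have [measurable]: "\<phi> \<in> borel_measurable (lebesgue_on \<Omega>)"
    using continuous_on_subset[OF c] by (intro continuous_imp_measurable_on_sets_lebesgue) auto
  note [measurable] = L2_measurable[OF assms(4)]
  have i: "integrable (lebesgue_on \<Omega>) (\<lambda>x. C *\<^sub>R g x)" using L2_integrable[OF assms(4)] by simp
  show ?thesis
    by (rule Bochner_Integration.integrable_bound[OF i])
      (use C in \<open>auto intro!: AE_I2 mult_right_mono\<close>)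
qed

text \<open>Since \<open>weak_partial\<close> is chosen by \<open>SOME\<close>, this is what permits
  its replacement, up to a null set, by any weak derivative known explicitly.\<close>

lemma weak_partial_unique:
  assumes "g \<in> L2 \<Omega>" "g' \<in> L2 \<Omega>" "has_weak_partial \<Omega> i u g" "has_weak_partial \<Omega> i u g'"
  shows "AE x in lebesgue_on \<Omega>. g x = g' x"
proof -
  have "AE x in lebesgue_on \<Omega>. (g - g') x = 0"
  proof (rule fundamental_lemma_variations)
    show "integrable (lebesgue_on \<Omega>) (g - g')" by (rule L2_integrable[OF L2_diff[OF assms(1,2)]])
    fix \<phi> :: "real^3 \<Rightarrow> real" assume \<phi>: "\<phi> \<in> test_functions \<Omega>"
    then obtain K where K: "compact K" "K \<subseteq> \<Omega>" "\<And>x. x \<notin> K \<Longrightarrow> \<phi> x = 0" "smooth \<phi>"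
      by (rule test_functions_support) blast
    have "(LINT x|lebesgue_on \<Omega>. \<phi> x *\<^sub>R g x) = (LINT x|lebesgue_on \<Omega>. \<phi> x *\<^sub>R g' x)"
      using bspec[OF assms(3)[unfolded has_weak_partial_def] \<phi>]
        bspec[OF assms(4)[unfolded has_weak_partial_def] \<phi>] by simp
    then show "(LINT x|lebesgue_on \<Omega>. \<phi> x *\<^sub>R (g - g') x) = 0"
      using integrable_test_scaleR[OF K(4,1,3) assms(1)] integrable_test_scaleR[OF K(4,1,3) assms(2)]
      by (simp add: scaleR_diff_right)
  qed
  then show ?thesis by auto
qed

section \<open>Calculus of weak derivatives up to null sets, and the seminorm
  \<open>V_norm\<close>\<close>

lemma H1_L2: "u \<in> H1 \<Omega> \<Longrightarrow> u \<in> L2 \<Omega>"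
  by (simp add: H1_def)

lemma
  assumes "u \<in> H1 \<Omega>"
  shows weak_partial_L2: "weak_partial \<Omega> i u \<in> L2 \<Omega>"
    and has_weak_partial_weak_partial: "has_weak_partial \<Omega> i u (weak_partial \<Omega> i u)"
proof -
  have "\<exists>g. g \<in> L2 \<Omega> \<and> has_weak_partial \<Omega> i u g" using assms by (auto simp: H1_def)
  then have "weak_partial \<Omega> i u \<in> L2 \<Omega> \<and> has_weak_partial \<Omega> i u (weak_partial \<Omega> i u)"
    unfolding weak_partial_def by (rule someI_ex)
  then show "weak_partial \<Omega> i u \<in> L2 \<Omega>" "has_weak_partial \<Omega> i u (weak_partial \<Omega> i u)" by auto
qed

lemma smooth_H1:
  assumes "smooth u"
  shows "u \<in> H1 \<Omega>"
proof -
  have "dir_deriv (axis i 1) u \<in> L2 \<Omega>" for i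
    by (intro continuous_in_L2 smooth_continuous_on smooth_dir_deriv assms)
  moreover have "u \<in> L2 \<Omega>"
    by (intro continuous_in_L2 smooth_continuous_on assms)
  ultimately show ?thesis
    using has_weak_partial_smooth[OF assms] by (auto simp: H1_def)
qed

lemma weak_partial_smooth:
  assumes "smooth u"
  shows "AE x in lebesgue_on \<Omega>. weak_partial \<Omega> i u x = dir_deriv (axis i 1) u x"
  using assms
  by (intro weak_partial_unique[of _ _ i u] weak_partial_L2 has_weak_partial_weak_partial smooth_H1
      has_weak_partial_smooth continuous_in_L2 smooth_continuous_on smooth_dir_deriv)

lemma has_weak_partial_diff:
  assumes "u \<in> H1 \<Omega>" "v \<in> H1 \<Omega>"
  shows "has_weak_partial \<Omega> i (u - v) (weak_partial \<Omega> i u - weak_partial \<Omega> i v)"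
  unfolding has_weak_partial_def
proof
  fix \<phi> :: "real^3 \<Rightarrow> real" assume \<phi>: "\<phi> \<in> test_functions \<Omega>"
  then obtain K where K: "compact K" "K \<subseteq> \<Omega>" "\<And>x. x \<notin> K \<Longrightarrow> \<phi> x = 0" "smooth \<phi>"
    by (rule test_functions_support) blast
  let ?d = "dir_deriv (axis i 1) \<phi>"
  have z: "?d x = 0" if "x \<notin> K" for x
    using dir_deriv_vanish[OF compact_imp_closed[OF K(1)] K(3) that] .
  have I: "integrable (lebesgue_on \<Omega>) (\<lambda>x. \<phi> x *\<^sub>R g x)" "integrable (lebesgue_on \<Omega>) (\<lambda>x. ?d x *\<^sub>R g x)"
    if "g \<in> L2 \<Omega>" for g
    using integrable_test_scaleR[OF K(4,1,3) that] integrable_test_scaleR[OF smooth_dir_deriv[OF K(4)] K(1) _ that] z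
    by auto
  have eq: "(LINT x|lebesgue_on \<Omega>. ?d x *\<^sub>R w x) = - (LINT x|lebesgue_on \<Omega>. \<phi> x *\<^sub>R weak_partial \<Omega> i w x)"
    if "w \<in> H1 \<Omega>" for w
    using has_weak_partial_weak_partial[OF that, of i] \<phi> unfolding has_weak_partial_def by simp
  show "(LINT x|lebesgue_on \<Omega>. ?d x *\<^sub>R (u - v) x)
      = - (LINT x|lebesgue_on \<Omega>. \<phi> x *\<^sub>R (weak_partial \<Omega> i u - weak_partial \<Omega> i v) x)"
    using I(1)[OF weak_partial_L2[OF assms(1)]] I(1)[OF weak_partial_L2[OF assms(2)]]
      I(2)[OF H1_L2[OF assms(1)]] I(2)[OF H1_L2[OF assms(2)]] eq[OF assms(1)] eq[OF assms(2)]
    by (simp add: scaleR_diff_right)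
qed

lemma H1_diff:
  assumes "u \<in> H1 \<Omega>" "v \<in> H1 \<Omega>"
  shows "u - v \<in> H1 \<Omega>"
proof -
  have "weak_partial \<Omega> i u - weak_partial \<Omega> i v \<in> L2 \<Omega>" for i
    by (intro L2_diff weak_partial_L2 assms)
  then show ?thesis
    using has_weak_partial_diff[OF assms] L2_diff[OF H1_L2[OF assms(1)] H1_L2[OF assms(2)]]
    unfolding H1_def by blast
qed

lemma weak_partial_diff:
  assumes "u \<in> H1 \<Omega>" "v \<in> H1 \<Omega>"
  shows "AE x in lebesgue_on \<Omega>. weak_partial \<Omega> i (u - v) x = weak_partial \<Omega> i u x - weak_partial \<Omega> i v x"
  using weak_partial_unique[OF weak_partial_L2[OF H1_diff[OF assms]] L2_diff[OF weak_partial_L2[OF assms(1)]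
        weak_partial_L2[OF assms(2)]] has_weak_partial_weak_partial[OF H1_diff[OF assms]]
      has_weak_partial_diff[OF assms], of i] by simp

lemma ipV_eq_sum:
  assumes "u \<in> H1 \<Omega>" "v \<in> H1 \<Omega>"
  shows "ipV \<Omega> u v = (\<Sum>i\<in>UNIV. ip \<Omega> (weak_partial \<Omega> i u) (weak_partial \<Omega> i v))"
  unfolding ipV_def ip_def
  by (rule Bochner_Integration.integral_sum)
    (intro L2_integrable_inner weak_partial_L2 assms)

lemma V_norm_nonneg: "0 \<le> V_norm \<Omega> u"
  unfolding V_norm_def ipV_def by (intro real_sqrt_ge_zero integral_nonneg_AE AE_I2 sum_nonneg) simp

lemma V_norm_power2:
  assumes "u \<in> H1 \<Omega>"
  shows "(V_norm \<Omega> u)\<^sup>2 = (\<Sum>i\<in>UNIV. (L2_norm \<Omega> (weak_partial \<Omega> i u))\<^sup>2)"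
  unfolding V_norm_def L2_norm_power2 ipV_eq_sum[OF assms assms]
  by (simp add: sum_nonneg ip_nonneg)

lemma weak_partial_norm_le:
  assumes "u \<in> H1 \<Omega>"
  shows "L2_norm \<Omega> (weak_partial \<Omega> i u) \<le> V_norm \<Omega> u"
proof (rule power2_le_imp_le)
  show "(L2_norm \<Omega> (weak_partial \<Omega> i u))\<^sup>2 \<le> (V_norm \<Omega> u)\<^sup>2"
    unfolding V_norm_power2[OF assms]
    by (rule member_le_sum[where f = "\<lambda>i. (L2_norm \<Omega> (weak_partial \<Omega> i u))\<^sup>2"]) auto
qed (rule V_norm_nonneg)

lemma L2_norm_diff_power2_le:
  assumes "u \<in> L2 \<Omega>" "v \<in> L2 \<Omega>"
  shows "(L2_norm \<Omega> (u - v))\<^sup>2 \<le> 2 * (L2_norm \<Omega> u)\<^sup>2 + 2 * (L2_norm \<Omega> v)\<^sup>2"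
proof -
  have "(L2_norm \<Omega> (u - v))\<^sup>2 \<le> (L2_norm \<Omega> u + L2_norm \<Omega> v)\<^sup>2"
    by (intro power_mono L2_norm_diff_le assms L2_norm_nonneg)
  then show ?thesis
    using sum_squares_bound[of "L2_norm \<Omega> u" "L2_norm \<Omega> v"] by (simp add: power2_sum)
qed

lemma V_norm_diff_power2_le:
  assumes "u \<in> H1 \<Omega>" "v \<in> H1 \<Omega>"
  shows "(V_norm \<Omega> (u - v))\<^sup>2 \<le> 2 * (V_norm \<Omega> u)\<^sup>2 + 2 * (V_norm \<Omega> v)\<^sup>2"
proof -
  have "(L2_norm \<Omega> (weak_partial \<Omega> i (u - v)))\<^sup>2
      \<le> 2 * (L2_norm \<Omega> (weak_partial \<Omega> i u))\<^sup>2 + 2 * (L2_norm \<Omega> (weak_partial \<Omega> i v))\<^sup>2" for i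
  proof -
    note L = weak_partial_L2[OF assms(1), of i] weak_partial_L2[OF assms(2), of i]
    have "L2_norm \<Omega> (weak_partial \<Omega> i (u - v)) = L2_norm \<Omega> (weak_partial \<Omega> i u - weak_partial \<Omega> i v)"
      using weak_partial_diff[OF assms, of i]
      by (intro L2_norm_AE_cong weak_partial_L2 H1_diff L2_diff L assms) auto
    then show ?thesis using L2_norm_diff_power2_le[OF L] by simp
  qed
  then have "(V_norm \<Omega> (u - v))\<^sup>2 \<le> (\<Sum>i\<in>UNIV. 2 * (L2_norm \<Omega> (weak_partial \<Omega> i u))\<^sup>2 + 2 * (L2_norm \<Omega> (weak_partial \<Omega> i v))\<^sup>2)"
    unfolding V_norm_power2[OF H1_diff[OF assms]] by (intro sum_mono)
  then show ?thesis
    unfolding V_norm_power2[OF assms(1)] V_norm_power2[OF assms(2)] by (simp add: sum.distrib sum_distrib_left)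
qed

text \<open>Not immediate, since \<open>weak_partial\<close> makes unrelated choices for
  \<open>u - v\<close> and \<open>v - u\<close>; they are opposite to each other only almost
  everywhere.\<close>

lemma V_norm_diff_commute:
  assumes "u \<in> H1 \<Omega>" "v \<in> H1 \<Omega>"
  shows "V_norm \<Omega> (u - v) = V_norm \<Omega> (v - u)"
proof -
  have "L2_norm \<Omega> (weak_partial \<Omega> i (u - v)) = L2_norm \<Omega> (weak_partial \<Omega> i (v - u))" for i
  proof -
    note L = weak_partial_L2[OF assms(1), of i] weak_partial_L2[OF assms(2), of i]
    have "L2_norm \<Omega> (weak_partial \<Omega> i (u - v)) = L2_norm \<Omega> (weak_partial \<Omega> i u - weak_partial \<Omega> i v)"
      using weak_partial_diff[OF assms, of i]
      by (intro L2_norm_AE_cong weak_partial_L2 H1_diff L2_diff L assms) auto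
    also have "\<dots> = L2_norm \<Omega> (weak_partial \<Omega> i v - weak_partial \<Omega> i u)"
      by (rule L2_norm_diff_commute)
    also have "\<dots> = L2_norm \<Omega> (weak_partial \<Omega> i (v - u))"
      using weak_partial_diff[OF assms(2,1), of i]
      by (intro L2_norm_AE_cong weak_partial_L2 H1_diff L2_diff L assms) auto
    finally show ?thesis .
  qed
  then have "(V_norm \<Omega> (u - v))\<^sup>2 = (V_norm \<Omega> (v - u))\<^sup>2"
    unfolding V_norm_power2[OF H1_diff[OF assms]] V_norm_power2[OF H1_diff[OF assms(2,1)]] by simp
  then show ?thesis by (rule power2_eq_imp_eq[OF _ V_norm_nonneg V_norm_nonneg])
qed

end

subsection \<open>A Poincare inequality on small boxes\<close>

definition grad_power2 :: "field3 \<Rightarrow> real^3 \<Rightarrow> real" where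
  "grad_power2 \<phi> x = (\<Sum>i\<in>UNIV. (norm (dir_deriv (axis i 1) \<phi> x))\<^sup>2)"

lemma grad_power2_nonneg: "0 \<le> grad_power2 \<phi> x"
  by (simp add: grad_power2_def sum_nonneg)

lemma continuous_on_grad_power2: "smooth \<phi> \<Longrightarrow> continuous_on S (grad_power2 \<phi>)"
  unfolding grad_power2_def by (intro continuous_intros smooth_continuous_on smooth_dir_deriv)

text \<open>Linearity of the derivative in its direction, expanded along the axes, and
  Cauchy-Schwarz for the finite sum.\<close>

lemma dir_deriv_power2_le:
  assumes "smooth \<phi>"
  shows "(norm (dir_deriv z \<phi> x))\<^sup>2 \<le> (norm z)\<^sup>2 * grad_power2 \<phi> x"
proof -
  let ?d = "\<lambda>i. dir_deriv (axis i 1) \<phi> x"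
  have lin: "linear (\<lambda>v. dir_deriv v \<phi> x)"
    using has_derivative_bounded_linear[OF has_derivative_dir_deriv[OF smooth_differentiable[OF assms]]]
    by (rule bounded_linear.linear)
  have "dir_deriv z \<phi> x = dir_deriv (\<Sum>i\<in>UNIV. z $ i *\<^sub>R axis i 1) \<phi> x"
    using basis_expansion[of z] by (simp add: scalar_mult_eq_scaleR)
  also have "\<dots> = (\<Sum>i\<in>UNIV. z $ i *\<^sub>R ?d i)"
    using linear_sum[OF lin, of "\<lambda>i. z $ i *\<^sub>R axis i 1"] linear_cmul[OF lin] by simp
  finally have "norm (dir_deriv z \<phi> x) \<le> (\<Sum>i\<in>UNIV. \<bar>z $ i\<bar> * norm (?d i))"
    using norm_sum[of "\<lambda>i. z $ i *\<^sub>R ?d i" UNIV] by simp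
  then have "(norm (dir_deriv z \<phi> x))\<^sup>2 \<le> (\<Sum>i\<in>UNIV. \<bar>z $ i\<bar> * norm (?d i))\<^sup>2"
    by (intro power_mono) auto
  also have "\<dots> \<le> (\<Sum>i\<in>UNIV. \<bar>z $ i\<bar>\<^sup>2) * (\<Sum>i\<in>UNIV. (norm (?d i))\<^sup>2)"
    by (rule Cauchy_Schwarz_ineq_sum)
  also have "(\<Sum>i\<in>UNIV. \<bar>z $ i\<bar>\<^sup>2) = (norm z)\<^sup>2"
    by (simp add: norm_vec_def L2_set_def sum_nonneg)
  finally show ?thesis by (simp add: grad_power2_def)
qed

text \<open>The fundamental theorem of calculus along the segment from \<open>x\<close> to
  \<open>x + z\<close>, then Jensen's inequality on the unit interval, obtained from the
  nonnegativity of the variance of \<open>n\<close>.\<close>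

lemma increment_power2_le_integral:
  assumes "smooth \<phi>"
  shows "(norm (\<phi> (x + z) - \<phi> x))\<^sup>2
    \<le> (norm z)\<^sup>2 * integral {0..1} (\<lambda>t. grad_power2 \<phi> (x + t *\<^sub>R z))"
proof -
  define n where "n t = norm (dir_deriv z \<phi> (x + t *\<^sub>R z))" for t
  have line: "continuous_on {0..1} (\<lambda>t. x + t *\<^sub>R z)" by (intro continuous_intros)
  have cd: "continuous_on {0..1} (\<lambda>t. dir_deriv z \<phi> (x + t *\<^sub>R z))"
    by (rule continuous_on_compose2[OF smooth_continuous_on[OF smooth_dir_deriv[OF assms], of UNIV] line]) simp
  have cn: "continuous_on {0..1} n" unfolding n_def using cd by (rule continuous_on_norm)
  have cg: "continuous_on {0..1} (\<lambda>t. grad_power2 \<phi> (x + t *\<^sub>R z))"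
    by (rule continuous_on_compose2[OF continuous_on_grad_power2[OF assms, of UNIV] line]) simp
  have ftc: "((\<lambda>t. dir_deriv z \<phi> (x + t *\<^sub>R z)) has_integral \<phi> (x + 1 *\<^sub>R z) - \<phi> (x + 0 *\<^sub>R z)) {0..1}"
    by (rule fundamental_theorem_of_calculus)
      (auto simp: has_vector_derivative_def intro!: has_derivative_along_line smooth_differentiable assms)
  let ?m = "integral {0..1} n"
  have ni: "n integrable_on {0..1}" "(\<lambda>t. (n t)\<^sup>2) integrable_on {0..1}"
    by (intro integrable_continuous_real cn continuous_on_power)+
  have "norm (\<phi> (x + z) - \<phi> x) \<le> ?m"
    using ftc integral_norm_bound_integral[OF integrable_continuous_real[OF cd] ni(1)]
    by (simp add: integral_unique n_def)
  then have "(norm (\<phi> (x + z) - \<phi> x))\<^sup>2 \<le> ?m\<^sup>2" by (intro power_mono) auto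
  also have "\<dots> \<le> integral {0..1} (\<lambda>t. (n t)\<^sup>2)"
  proof -
    have "0 \<le> integral {0..1} (\<lambda>t. (n t - ?m)\<^sup>2)"
      by (intro Henstock_Kurzweil_Integration.integral_nonneg integrable_continuous_real continuous_intros cn) auto
    also have "(\<lambda>t. (n t - ?m)\<^sup>2) = (\<lambda>t. (n t)\<^sup>2 - (2 * ?m) * n t + ?m\<^sup>2)"
      by (auto simp: power2_diff algebra_simps)
    also have "integral {0..1} \<dots> = integral {0..1} (\<lambda>t. (n t)\<^sup>2) - (2 * ?m) * ?m + ?m\<^sup>2"
    proof -
      have "((\<lambda>t. (n t)\<^sup>2 - (2 * ?m) * n t + ?m\<^sup>2) has_integral
          integral {0..1} (\<lambda>t. (n t)\<^sup>2) - (2 * ?m) * ?m + (1 - 0) *\<^sub>R ?m\<^sup>2) {0..1}"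
        using has_integral_const_real[of "?m\<^sup>2" 0 1]
        by (intro has_integral_add has_integral_diff has_integral_mult_right integrable_integral ni) auto
      then show ?thesis by (simp add: integral_unique)
    qed
    finally show ?thesis by (simp add: power2_eq_square)
  qed
  also have "\<dots> \<le> integral {0..1} (\<lambda>t. (norm z)\<^sup>2 * grad_power2 \<phi> (x + t *\<^sub>R z))"
    by (intro integral_le ni integrable_continuous_real continuous_intros cg)
      (auto simp: n_def dir_deriv_power2_le[OF assms])
  finally show ?thesis by simp
qed

text \<open>The form for nonnegative integrals, in which Tonelli's theorem exchanges the order of
  integration without integrability conditions.\<close>

lemma increment_power2_le:
  assumes "smooth \<phi>"
  shows "ennreal ((norm (\<phi> (x + z) - \<phi> x))\<^sup>2)
    \<le> ennreal ((norm z)\<^sup>2) * (\<integral>\<^sup>+ t. indicator {0..1} t * ennreal (grad_power2 \<phi> (x + t *\<^sub>R z)) \<partial>lborel)"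
proof -
  let ?g = "\<lambda>t. grad_power2 \<phi> (x + t *\<^sub>R z)"
  have cg: "continuous_on {0..1} ?g"
    by (rule continuous_on_compose2[OF continuous_on_grad_power2[OF assms, of UNIV]]) (auto intro!: continuous_intros)
  have "(?g has_integral integral {0..1} ?g) {0..1}"
    by (rule integrable_integral[OF integrable_continuous_real[OF cg]])
  then have "(\<integral>\<^sup>+ t. ennreal (indicator {0..1} t * ?g t) \<partial>lborel) = ennreal (integral {0..1} ?g)"
    by (intro nn_integral_has_integral_lebesgue grad_power2_nonneg)
  moreover have "ennreal (indicator {0..1} t * ?g t) = indicator {0..1} t * ennreal (?g t)" for t
    by (auto simp: indicator_def)
  ultimately have "(\<integral>\<^sup>+ t. indicator {0..1} t * ennreal (?g t) \<partial>lborel) = ennreal (integral {0..1} ?g)"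
    by simp
  then show ?thesis
    using increment_power2_le_integral[OF assms, of x z]
    by (simp add: ennreal_mult'[symmetric] ennreal_leI)
qed

lemma nn_integral_translate:
  fixes f :: "'a::euclidean_space \<Rightarrow> ennreal"
  assumes "f \<in> borel_measurable borel"
  shows "(\<integral>\<^sup>+ x. f (x + c) \<partial>lborel) = (\<integral>\<^sup>+ x. f x \<partial>lborel)"
proof -
  have m: "(+) c \<in> lborel \<rightarrow>\<^sub>M borel" by simp
  have eq: "distr lborel borel ((+) c) = lborel" by (rule lborel_distr_plus)
  show ?thesis
    using nn_integral_distr[OF m, of f] assms unfolding eq by (simp add: add.commute)
qed

text \<open>Substituting \<open>y = x + z\<close>, the segment from \<open>x\<close> to \<open>y\<close> stays in \<open>Q\<close>, and for fixed \<open>z\<close> and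
  \<open>t\<close> the integral over \<open>x\<close> of the squared gradient at \<open>x + t z\<close> is at most that over \<open>Q\<close>.\<close>

lemma double_integral_increment_le:
  assumes "smooth \<phi>" "convex Q" "Q \<in> sets borel" "D \<in> sets borel"
    and D: "\<And>x y. x \<in> Q \<Longrightarrow> y \<in> Q \<Longrightarrow> y - x \<in> D" "\<And>z. z \<in> D \<Longrightarrow> (norm z)\<^sup>2 \<le> \<rho>"
  shows "(\<integral>\<^sup>+ x. indicator Q x * (\<integral>\<^sup>+ y. indicator Q y * ennreal ((norm (\<phi> y - \<phi> x))\<^sup>2) \<partial>lborel) \<partial>lborel)
    \<le> ennreal \<rho> * emeasure lborel D * (\<integral>\<^sup>+ x. indicator Q x * ennreal (grad_power2 \<phi> x) \<partial>lborel)"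
proof -
  note [measurable] = assms(3,4)
  have [measurable]: "\<phi> \<in> borel_measurable borel" "grad_power2 \<phi> \<in> borel_measurable borel"
    by (intro borel_measurable_continuous_onI smooth_continuous_on continuous_on_grad_power2 assms(1))+
  define G where "G x = indicator Q x * ennreal (grad_power2 \<phi> x)" for x
  have [measurable]: "G \<in> borel_measurable borel" unfolding G_def by measurable
  define F where "F x z = ennreal \<rho> * indicator D z * (\<integral>\<^sup>+ t. indicator {0..1::real} t * G (x + t *\<^sub>R z) \<partial>lborel)" for x z
  have [measurable]: "case_prod F \<in> borel_measurable (lborel \<Otimes>\<^sub>M lborel)" unfolding F_def by measurable
  have pw: "indicator Q x * (indicator Q (z + x) * ennreal ((norm (\<phi> (z + x) - \<phi> x))\<^sup>2)) \<le> F x z" for x z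
  proof (cases "x \<in> Q \<and> z + x \<in> Q")
    case True
    then have z: "z \<in> D" using D(1)[of x "z + x"] by simp
    have seg: "x + t *\<^sub>R z \<in> Q" if "t \<in> {0..1}" for t
    proof -
      have "x + t *\<^sub>R z = (1 - t) *\<^sub>R x + t *\<^sub>R (z + x)" by (simp add: algebra_simps)
      then show ?thesis using True that assms(2) by (auto simp: convex_alt)
    qed
    have "ennreal ((norm (\<phi> (z + x) - \<phi> x))\<^sup>2)
        \<le> ennreal ((norm z)\<^sup>2) * (\<integral>\<^sup>+ t. indicator {0..1} t * ennreal (grad_power2 \<phi> (x + t *\<^sub>R z)) \<partial>lborel)"
      using increment_power2_le[OF assms(1), of x z] by (simp add: add.commute)
    also have "\<dots> \<le> ennreal \<rho> * (\<integral>\<^sup>+ t. indicator {0..1} t * ennreal (grad_power2 \<phi> (x + t *\<^sub>R z)) \<partial>lborel)"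
      using D(2)[OF z] by (intro mult_right_mono ennreal_leI) auto
    also have "(\<integral>\<^sup>+ t. indicator {0..1} t * ennreal (grad_power2 \<phi> (x + t *\<^sub>R z)) \<partial>lborel)
        = (\<integral>\<^sup>+ t. indicator {0..1} t * G (x + t *\<^sub>R z) \<partial>lborel)"
      using seg by (intro nn_integral_cong) (auto simp: G_def indicator_def)
    finally show ?thesis using True z by (simp add: F_def)
  qed auto
  have "(\<integral>\<^sup>+ x. indicator Q x * (\<integral>\<^sup>+ y. indicator Q y * ennreal ((norm (\<phi> y - \<phi> x))\<^sup>2) \<partial>lborel) \<partial>lborel)
    = (\<integral>\<^sup>+ x. (\<integral>\<^sup>+ z. indicator Q x * (indicator Q (z + x) * ennreal ((norm (\<phi> (z + x) - \<phi> x))\<^sup>2)) \<partial>lborel) \<partial>lborel)"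
  proof (rule nn_integral_cong)
    fix x
    have "(\<integral>\<^sup>+ y. indicator Q y * ennreal ((norm (\<phi> y - \<phi> x))\<^sup>2) \<partial>lborel)
      = (\<integral>\<^sup>+ z. indicator Q (z + x) * ennreal ((norm (\<phi> (z + x) - \<phi> x))\<^sup>2) \<partial>lborel)"
      by (rule nn_integral_translate[symmetric]) measurable
    then show "indicator Q x * (\<integral>\<^sup>+ y. indicator Q y * ennreal ((norm (\<phi> y - \<phi> x))\<^sup>2) \<partial>lborel)
      = (\<integral>\<^sup>+ z. indicator Q x * (indicator Q (z + x) * ennreal ((norm (\<phi> (z + x) - \<phi> x))\<^sup>2)) \<partial>lborel)"
      by (simp add: nn_integral_cmult)
  qed
  also have "\<dots> \<le> (\<integral>\<^sup>+ x. (\<integral>\<^sup>+ z. F x z \<partial>lborel) \<partial>lborel)"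
    by (intro nn_integral_mono pw)
  also have "\<dots> = (\<integral>\<^sup>+ z. (\<integral>\<^sup>+ x. F x z \<partial>lborel) \<partial>lborel)"
    by (rule lborel_pair.Fubini') measurable
  also have "\<dots> = (\<integral>\<^sup>+ z. ennreal \<rho> * indicator D z * (\<integral>\<^sup>+ x. G x \<partial>lborel) \<partial>lborel)"
  proof (rule nn_integral_cong)
    fix z :: "real^3"
    have "(\<integral>\<^sup>+ x. (\<integral>\<^sup>+ t. indicator {0..1::real} t * G (x + t *\<^sub>R z) \<partial>lborel) \<partial>lborel)
      = (\<integral>\<^sup>+ t. (\<integral>\<^sup>+ x. indicator {0..1::real} t * G (x + t *\<^sub>R z) \<partial>lborel) \<partial>lborel)"
      by (rule lborel_pair.Fubini') measurable
    also have "\<dots> = (\<integral>\<^sup>+ t. indicator {0..1::real} t * (\<integral>\<^sup>+ x. G x \<partial>lborel) \<partial>lborel)"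
      by (intro nn_integral_cong) (simp add: nn_integral_cmult nn_integral_translate)
    also have "\<dots> = (\<integral>\<^sup>+ x. G x \<partial>lborel)"
      by (simp add: nn_integral_multc)
    finally show "(\<integral>\<^sup>+ x. F x z \<partial>lborel) = ennreal \<rho> * indicator D z * (\<integral>\<^sup>+ x. G x \<partial>lborel)"
      unfolding F_def by (simp add: nn_integral_cmult)
  qed
  also have "\<dots> = ennreal \<rho> * emeasure lborel D * (\<integral>\<^sup>+ x. G x \<partial>lborel)"
    by (simp add: nn_integral_multc nn_integral_cmult)
  finally show ?thesis by (simp add: G_def)
qed

text \<open>The variance identity: when the square is expanded, the mixed term integrates to the
  squared norm of the integral. It expresses the square integral of \<open>\<phi>\<close> through
  its increments and its integral.\<close>

lemma (in finite_measure) double_integral_diff_power2: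
  fixes \<phi> :: "'a \<Rightarrow> 'b::euclidean_space"
  assumes [measurable]: "\<phi> \<in> borel_measurable M" and bd: "\<And>x. x \<in> space M \<Longrightarrow> norm (\<phi> x) \<le> C"
  shows "(\<integral>\<^sup>+ x. (\<integral>\<^sup>+ y. ennreal ((norm (\<phi> y - \<phi> x))\<^sup>2) \<partial>M) \<partial>M)
    = ennreal (2 * (measure M (space M) * (LINT x|M. (norm (\<phi> x))\<^sup>2)) - 2 * (norm (LINT x|M. \<phi> x))\<^sup>2)"
proof -
  let ?I = "LINT x|M. \<phi> x" and ?J = "LINT x|M. (norm (\<phi> x))\<^sup>2" and ?m = "measure M (space M)"
  have i1: "integrable M \<phi>"
    by (rule integrable_const_bound[where B = C]) (intro AE_I2 bd, assumption, measurable)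
  have i2: "integrable M (\<lambda>x. (norm (\<phi> x))\<^sup>2)"
    by (rule integrable_const_bound[where B = "C\<^sup>2"]) (use bd in \<open>auto intro!: AE_I2 power_mono\<close>)
  have i3: "integrable M (\<lambda>x. \<phi> x \<bullet> c)" for c using i1 by simp
  have eq: "(norm (\<phi> y - \<phi> x))\<^sup>2 = (norm (\<phi> y))\<^sup>2 - 2 * (\<phi> y \<bullet> \<phi> x) + (norm (\<phi> x))\<^sup>2" for x y
    by (simp add: power2_norm_eq_inner inner_diff inner_commute)
  have inner: "(LINT y|M. (norm (\<phi> y - \<phi> x))\<^sup>2) = ?J - 2 * (\<phi> x \<bullet> ?I) + ?m * (norm (\<phi> x))\<^sup>2" for x
    unfolding eq using i1 i2 i3 by (simp add: inner_commute)
  have ii: "integrable M (\<lambda>y. (norm (\<phi> y - \<phi> x))\<^sup>2)" for x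
    unfolding eq using i2 i3 by simp
  have "(\<integral>\<^sup>+ x. (\<integral>\<^sup>+ y. ennreal ((norm (\<phi> y - \<phi> x))\<^sup>2) \<partial>M) \<partial>M)
    = (\<integral>\<^sup>+ x. ennreal (LINT y|M. (norm (\<phi> y - \<phi> x))\<^sup>2) \<partial>M)"
    by (intro nn_integral_cong nn_integral_eq_integral ii) auto
  also have "\<dots> = ennreal (LINT x|M. (LINT y|M. (norm (\<phi> y - \<phi> x))\<^sup>2))"
  proof (rule nn_integral_eq_integral)
    show "integrable M (\<lambda>x. LINT y|M. (norm (\<phi> y - \<phi> x))\<^sup>2)"
      unfolding inner using i1 i2 i3 by simp
  qed (auto intro!: AE_I2 integral_nonneg_AE)
  also have "(LINT x|M. (LINT y|M. (norm (\<phi> y - \<phi> x))\<^sup>2)) = 2 * (?m * ?J) - 2 * (norm ?I)\<^sup>2"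
    unfolding inner using i1 i2 i3 by (simp add: power2_norm_eq_inner[of ?I])
  finally show ?thesis .
qed

text \<open>The variance identity turns the double integral of the increments into twice the
  difference to be bounded, whence the division by 2, and the estimate along segments bounds it by
  the gradient. The integral of \<open>\<phi>\<close> is kept on the right because it is the
  quantity that a choice of subsequence can control on each cell.\<close>

lemma poincare_convex:
  assumes "smooth \<phi>" "convex Q" "Q \<in> sets borel" "bounded Q" "D \<in> sets borel" "emeasure lborel D < \<infinity>"
    and D: "\<And>x y. x \<in> Q \<Longrightarrow> y \<in> Q \<Longrightarrow> y - x \<in> D" "\<And>z. z \<in> D \<Longrightarrow> (norm z)\<^sup>2 \<le> \<rho>" and "\<rho> \<ge> 0"
  shows "measure lborel Q * (LINT x|lborel. indicator Q x * (norm (\<phi> x))\<^sup>2)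
    \<le> (norm (LINT x|lborel. indicator Q x *\<^sub>R \<phi> x))\<^sup>2
      + \<rho> * measure lborel D / 2 * (LINT x|lborel. indicator Q x * grad_power2 \<phi> x)"
proof -
  let ?M = "restrict_space lborel Q"
  have Q: "Q \<inter> space lborel \<in> sets lborel" using assms(3) by simp
  have fin: "emeasure lborel Q < \<infinity>" using emeasure_bounded_finite[OF assms(4)] by simp
  interpret finite_measure ?M
    by (rule finite_measureI) (use fin assms(3) in \<open>simp add: emeasure_restrict_space\<close>)
  have cphi: "continuous_on UNIV \<phi>" by (rule smooth_continuous_on[OF assms(1)])
  have cQ: "compact (closure Q)" using assms(4) by (simp add: compact_closure)
  have "bounded (\<phi> ` closure Q)"
    by (intro compact_imp_bounded compact_continuous_image smooth_continuous_on assms(1) cQ)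
  moreover have "bounded (grad_power2 \<phi> ` closure Q)"
    by (intro compact_imp_bounded compact_continuous_image continuous_on_grad_power2 assms(1) cQ)
  ultimately obtain C C' where CC: "\<And>x. x \<in> closure Q \<Longrightarrow> norm (\<phi> x) \<le> C"
    "\<And>x. x \<in> closure Q \<Longrightarrow> norm (grad_power2 \<phi> x) \<le> C'"
    unfolding bounded_iff by blast
  have C: "norm (\<phi> x) \<le> C" and C': "norm (grad_power2 \<phi> x) \<le> C'" if "x \<in> Q" for x
    using CC[of x] closure_subset[of Q] that by auto
  have m: "\<phi> \<in> borel_measurable ?M"
    by (intro measurable_restrict_space1) (use borel_measurable_continuous_onI[OF cphi] in simp)
  have gm: "grad_power2 \<phi> \<in> borel_measurable ?M"
    by (intro measurable_restrict_space1)
      (use borel_measurable_continuous_onI[OF continuous_on_grad_power2[OF assms(1)]] in simp)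
  have gi: "integrable ?M (grad_power2 \<phi>)"
    by (rule integrable_const_bound[OF _ gm, where B = C']) (use C' in \<open>auto intro!: AE_I2 simp: space_restrict_space\<close>)
  have gI: "(\<integral>\<^sup>+ x. indicator Q x * ennreal (grad_power2 \<phi> x) \<partial>lborel) = ennreal (LINT x|?M. grad_power2 \<phi> x)"
    using nn_integral_eq_integral[OF gi] grad_power2_nonneg
    by (simp add: nn_integral_restrict_space[OF Q] mult.commute)
  have "(\<integral>\<^sup>+ x. (\<integral>\<^sup>+ y. ennreal ((norm (\<phi> y - \<phi> x))\<^sup>2) \<partial>?M) \<partial>?M)
    = (\<integral>\<^sup>+ x. indicator Q x * (\<integral>\<^sup>+ y. indicator Q y * ennreal ((norm (\<phi> y - \<phi> x))\<^sup>2) \<partial>lborel) \<partial>lborel)"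
    by (simp add: nn_integral_restrict_space[OF Q] mult.commute)
  also have "\<dots> \<le> ennreal \<rho> * emeasure lborel D * ennreal (LINT x|?M. grad_power2 \<phi> x)"
    using double_integral_increment_le[OF assms(1-3,5) D] unfolding gI by simp
  also have "\<dots> = ennreal (\<rho> * measure lborel D * (LINT x|?M. grad_power2 \<phi> x))"
  proof -
    have "emeasure lborel D = ennreal (measure lborel D)"
      using assms(6) by (intro emeasure_eq_ennreal_measure) auto
    moreover have "0 \<le> (LINT x|?M. grad_power2 \<phi> x)" by (intro integral_nonneg_AE AE_I2 grad_power2_nonneg)
    ultimately show ?thesis using \<open>\<rho> \<ge> 0\<close> by (simp add: ennreal_mult')
  qed
  finally have "ennreal (2 * (measure ?M (space ?M) * (LINT x|?M. (norm (\<phi> x))\<^sup>2)) - 2 * (norm (LINT x|?M. \<phi> x))\<^sup>2)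
    \<le> ennreal (\<rho> * measure lborel D * (LINT x|?M. grad_power2 \<phi> x))"
    by (subst (asm) double_integral_diff_power2[OF m, of C]) (auto simp: space_restrict_space C)
  moreover have "0 \<le> \<rho> * measure lborel D * (LINT x|?M. grad_power2 \<phi> x)"
    using \<open>\<rho> \<ge> 0\<close> by (intro mult_nonneg_nonneg integral_nonneg_AE AE_I2 grad_power2_nonneg) auto
  ultimately have "2 * (measure ?M (space ?M) * (LINT x|?M. (norm (\<phi> x))\<^sup>2)) - 2 * (norm (LINT x|?M. \<phi> x))\<^sup>2
    \<le> \<rho> * measure lborel D * (LINT x|?M. grad_power2 \<phi> x)"
    by (simp add: ennreal_le_iff)
  moreover have "measure ?M (space ?M) = measure lborel Q"
    using assms(3) by (simp add: space_restrict_space measure_restrict_space)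
  ultimately show ?thesis
    by (simp add: integral_restrict_space[OF Q])
qed

subsection \<open>Compactness of the embedding of \<open>V\<close> into \<open>H\<close>\<close>

text \<open>Half-open boxes tile exactly, so that the indicator of a large box is the sum of those
  of its cells at every point.\<close>

definition half_open_box :: "real^3 \<Rightarrow> real^3 \<Rightarrow> (real^3) set" where
  "half_open_box p q = {x. \<forall>i. p $ i \<le> x $ i \<and> x $ i < q $ i}"

lemma half_open_box_borel [measurable, simp]: "half_open_box p q \<in> sets borel"
  unfolding half_open_box_def by measurable

lemma box_subset_half_open_box: "box p q \<subseteq> half_open_box p q"
  by (auto simp: half_open_box_def mem_box_cart less_imp_le)

lemma half_open_box_subset_cbox: "half_open_box p q \<subseteq> cbox p q"
  by (auto simp: half_open_box_def mem_box_cart less_imp_le)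

lemma convex_half_open_box: "convex (half_open_box p q)"
  unfolding convex_alt
proof (intro ballI allI impI)
  fix x y and u :: real
  assume xy: "x \<in> half_open_box p q" "y \<in> half_open_box p q" and u: "0 \<le> u \<and> u \<le> 1"
  have "(1 - u) *\<^sub>R x $ i + u *\<^sub>R y $ i \<in> {p $ i..<q $ i}" for i
    by (rule convexD_alt[OF convex_real_interval(7)]) (use xy u in \<open>auto simp: half_open_box_def\<close>)
  then show "(1 - u) *\<^sub>R x + u *\<^sub>R y \<in> half_open_box p q"
    by (simp add: half_open_box_def)
qed

lemma measure_half_open_box:
  assumes "\<And>i. p $ i \<le> q $ i"
  shows "measure lborel (half_open_box p q) = (\<Prod>i\<in>UNIV. q $ i - p $ i)"
proof -
  have c: "measure lborel (cbox p q) = (\<Prod>i\<in>UNIV. q $ i - p $ i)"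
    using assms by (intro content_cbox_cart) (auto simp: interval_ne_empty_cart)
  have "measure lborel (half_open_box p q) \<le> measure lborel (cbox p q)"
    by (intro measure_mono_fmeasurable half_open_box_subset_cbox) auto
  moreover have "measure lborel (box p q) \<le> measure lborel (half_open_box p q)"
    by (intro measure_mono_fmeasurable box_subset_half_open_box fmeasurableI2[OF _ half_open_box_subset_cbox]) auto
  moreover have "measure lborel (box p q) = measure lborel (cbox p q)"
    by (simp add: measure_lborel_box_eq measure_lborel_cbox_eq)
  ultimately show ?thesis using c by linarith
qed

lemma poincare_half_open_box:
  fixes p h :: "real^3"
  assumes "smooth \<phi>" and h: "\<And>i. 0 < h $ i"
  defines "Q \<equiv> half_open_box p (p + h)"
  shows "(LINT x|lborel. indicator Q x * (norm (\<phi> x))\<^sup>2)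
    \<le> (norm (LINT x|lborel. indicator Q x *\<^sub>R \<phi> x))\<^sup>2 / (\<Prod>i\<in>UNIV. h $ i)
      + 4 * (norm h)\<^sup>2 * (LINT x|lborel. indicator Q x * grad_power2 \<phi> x)"
proof -
  let ?m = "\<Prod>i\<in>UNIV. h $ i"
  have mQ: "measure lborel Q = ?m"
    using measure_half_open_box[of p "p + h"] h unfolding Q_def by (simp add: less_imp_le)
  have m0: "?m > 0" using h by (simp add: prod_pos)
  \<comment> \<open>Differences of points of \<open>Q\<close> lie in \<open>cbox (- h) h\<close>,
    whose volume is \<open>2^3\<close> times that of \<open>Q\<close>; together with the factor 1/2
    in \<open>poincare_convex\<close> this yields the constant 4.\<close>
  have mD: "measure lborel (cbox (- h) h) = 8 * ?m"
  proof -
    have "measure lborel (cbox (- h) h) = (\<Prod>i\<in>UNIV. h $ i - (- h) $ i)"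
      using h by (intro content_cbox_cart) (auto simp: interval_ne_empty_cart intro: order.trans[of _ 0] less_imp_le)
    also have "\<dots> = (\<Prod>i\<in>UNIV. 2 * h $ i)" by simp
    also have "\<dots> = 8 * ?m" by (simp add: prod.distrib)
    finally show ?thesis .
  qed
  have "measure lborel Q * (LINT x|lborel. indicator Q x * (norm (\<phi> x))\<^sup>2)
    \<le> (norm (LINT x|lborel. indicator Q x *\<^sub>R \<phi> x))\<^sup>2
      + (norm h)\<^sup>2 * measure lborel (cbox (- h) h) / 2 * (LINT x|lborel. indicator Q x * grad_power2 \<phi> x)"
  proof (rule poincare_convex[OF assms(1)])
    show "convex Q" "Q \<in> sets borel" unfolding Q_def by (auto simp: convex_half_open_box)
    show "bounded Q" unfolding Q_def
      using half_open_box_subset_cbox bounded_cbox bounded_subset by blast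
    show "y - x \<in> cbox (- h) h" if "x \<in> Q" "y \<in> Q" for x y
    proof -
      have "p $ i \<le> x $ i" "x $ i < p $ i + h $ i" "p $ i \<le> y $ i" "y $ i < p $ i + h $ i" for i
        using that by (auto simp: Q_def half_open_box_def)
      then have "- h $ i \<le> y $ i - x $ i \<and> y $ i - x $ i \<le> h $ i" for i
        by (smt (verit))
      then show ?thesis by (simp add: mem_box_cart)
    qed
    show "(norm z)\<^sup>2 \<le> (norm h)\<^sup>2" if "z \<in> cbox (- h) h" for z
    proof -
      have "\<bar>z $ i\<bar> \<le> \<bar>h $ i\<bar>" for i using that h[of i] by (auto simp: mem_box_cart abs_le_iff) (metis minus_le_iff)
      then have "norm z \<le> norm h" by (intro norm_le_componentwise_cart) simp
      then show ?thesis by (intro power_mono) auto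
    qed
  qed (auto simp: emeasure_lborel_cbox_eq)
  moreover have "X \<le> A / m + 4 * r * B" if "m * X \<le> A + r * (8 * m) / 2 * B" "m > 0" for m X A r B :: real
    using that by (simp add: field_simps)
  ultimately show ?thesis using m0 unfolding mQ mD by blast
qed

definition grid_cell :: "real^3 \<Rightarrow> real^3 \<Rightarrow> nat \<Rightarrow> (3 \<Rightarrow> nat) \<Rightarrow> (real^3) set" where
  "grid_cell a b N k = half_open_box (a + (\<chi> i. real (k i) * (b $ i - a $ i) / real N))
     (a + (\<chi> i. real (k i) * (b $ i - a $ i) / real N) + (1 / real N) *\<^sub>R (b - a))"

definition grid :: "nat \<Rightarrow> (3 \<Rightarrow> nat) set" where
  "grid N = {k. \<forall>i. k i < N}"

lemma finite_grid: "finite (grid N)"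
proof -
  have "grid N = (\<Pi>\<^sub>E i\<in>UNIV. {..<N})" by (auto simp: grid_def)
  then show ?thesis by (simp add: finite_PiE)
qed

lemma mem_grid_cell:
  assumes "N > 0" "\<And>i. a $ i < b $ i"
  shows "x \<in> grid_cell a b N k \<longleftrightarrow> (\<forall>i. real (k i) \<le> real N * (x $ i - a $ i) / (b $ i - a $ i)
    \<and> real N * (x $ i - a $ i) / (b $ i - a $ i) < real (k i) + 1)"
proof -
  have "(a $ i + real (k i) * (b $ i - a $ i) / real N \<le> x $ i \<and>
      x $ i < a $ i + real (k i) * (b $ i - a $ i) / real N + (b $ i - a $ i) / real N) \<longleftrightarrow>
    (real (k i) \<le> real N * (x $ i - a $ i) / (b $ i - a $ i)
    \<and> real N * (x $ i - a $ i) / (b $ i - a $ i) < real (k i) + 1)" for i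
  proof -
    define d where "d = b $ i - a $ i"
    define y where "y = x $ i - a $ i"
    have d: "d > 0" using assms(2)[of i] by (simp add: d_def)
    have N: "real N > 0" using assms(1) by simp
    have "(real (k i) * d / real N \<le> y \<and> y < real (k i) * d / real N + d / real N) \<longleftrightarrow>
      (real (k i) \<le> real N * y / d \<and> real N * y / d < real (k i) + 1)"
      using d N by (auto simp: field_simps)
    then show ?thesis unfolding d_def y_def by (simp add: algebra_simps)
  qed
  then show ?thesis by (simp add: grid_cell_def half_open_box_def)
qed

lemma indicator_half_open_box_eq_sum:
  assumes N: "N > 0" and ab: "\<And>i. a $ i < b $ i"
  shows "indicator (half_open_box a b) x = (\<Sum>k\<in>grid N. indicator (grid_cell a b N k) x :: real)"
proof -
  \<comment> \<open>The coordinates of \<open>x\<close> relative to \<open>a\<close> in units of the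
    mesh width. A cell contains \<open>x\<close> exactly when its index consists of the integer
    parts of \<open>r\<close>.\<close>
  define r where "r i = real N * (x $ i - a $ i) / (b $ i - a $ i)" for i
  have mem: "x \<in> grid_cell a b N k \<longleftrightarrow> (\<forall>i. real (k i) \<le> r i \<and> r i < real (k i) + 1)" for k
    using mem_grid_cell[OF N ab] by (simp add: r_def)
  have R: "x \<in> half_open_box a b \<longleftrightarrow> (\<forall>i. 0 \<le> r i \<and> r i < real N)"
  proof -
    have "(a $ i \<le> x $ i \<and> x $ i < b $ i) \<longleftrightarrow> (0 \<le> r i \<and> r i < real N)" for i
      using ab[of i] N by (auto simp: r_def field_simps)
    then show ?thesis by (simp add: half_open_box_def)
  qed
  show ?thesis
  proof (cases "x \<in> half_open_box a b")
    case True
    define k0 where "k0 i = nat \<lfloor>r i\<rfloor>" for i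
    have k0: "x \<in> grid_cell a b N k \<longleftrightarrow> k = k0" for k
    proof -
      have "(real (k i) \<le> r i \<and> r i < real (k i) + 1) \<longleftrightarrow> k i = k0 i" for i
      proof -
        have "0 \<le> r i" using True R by blast
        then have "\<lfloor>r i\<rfloor> = int (k i) \<longleftrightarrow> k i = k0 i" unfolding k0_def by auto
        then show ?thesis by (simp add: floor_eq_iff)
      qed
      then show ?thesis by (simp add: mem fun_eq_iff)
    qed
    have "real (k0 i) < real N" for i
    proof -
      have "real (k0 i) \<le> r i" using k0[of k0] mem[of k0] by auto
      then show ?thesis using True R by (meson le_less_trans)
    qed
    then have "k0 \<in> grid N" by (simp add: grid_def)
    have "(\<Sum>k\<in>grid N. indicator (grid_cell a b N k) x :: real) = (\<Sum>k\<in>grid N. if k = k0 then 1 else 0)"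
      by (intro sum.cong) (auto simp: indicator_def k0)
    then show ?thesis using True \<open>k0 \<in> grid N\<close> finite_grid by simp
  next
    case False
    have "x \<notin> grid_cell a b N k" if "k \<in> grid N" for k
    proof
      assume "x \<in> grid_cell a b N k"
      then have "0 \<le> r i \<and> r i < real N" for i
        using that unfolding mem grid_def by (smt (verit) mem_Collect_eq of_nat_0_le_iff of_nat_Suc of_nat_le_iff Suc_leI)
      then show False using False R by blast
    qed
    then show ?thesis using False by (simp add: indicator_def)
  qed
qed

lemma integrable_indicator_continuous:
  fixes f :: "real^3 \<Rightarrow> 'b::euclidean_space"
  assumes "continuous_on UNIV f" "S \<in> sets borel" "bounded S"
  shows "integrable lborel (\<lambda>x. indicator S x *\<^sub>R f x)"
proof -
  have "compact (closure S)" using assms(3) by (simp add: compact_closure)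
  then have "integrable lborel (\<lambda>x. indicator (closure S) x *\<^sub>R f x)"
    by (rule borel_integrable_compact[OF _ continuous_on_subset[OF assms(1)]]) simp
  then have "integrable lborel (\<lambda>x. indicator S x *\<^sub>R indicator (closure S) x *\<^sub>R f x)"
    by (rule integrable_mult_indicator[rotated]) (use assms(2) in simp)
  moreover have "(\<lambda>x. indicator S x *\<^sub>R indicator (closure S) x *\<^sub>R f x) = (\<lambda>x. indicator S x *\<^sub>R f x)"
    using closure_subset[of S] by (auto simp: indicator_def fun_eq_iff)
  ultimately show ?thesis by (simp only:)
qed

text \<open>The finite-dimensional approximation behind Rellich's theorem: apart from finitely many
  cell integrals, only a gradient term with the factor \<open>1 / N^2\<close> remains. The factor in
  front of the cell integrals is the reciprocal volume of a cell.\<close>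

lemma poincare_grid:
  assumes "smooth \<phi>" "N > 0" and ab: "\<And>i. a $ i < b $ i"
  shows "(LINT x|lborel. indicator (half_open_box a b) x * (norm (\<phi> x))\<^sup>2)
    \<le> (real N)^3 / (\<Prod>i\<in>UNIV. b $ i - a $ i)
        * (\<Sum>k\<in>grid N. (norm (LINT x|lborel. indicator (grid_cell a b N k) x *\<^sub>R \<phi> x))\<^sup>2)
      + 4 * (norm (b - a))\<^sup>2 / (real N)\<^sup>2 * (LINT x|lborel. indicator (half_open_box a b) x * grad_power2 \<phi> x)"
proof -
  let ?h = "(1 / real N) *\<^sub>R (b - a)" and ?Q = "grid_cell a b N"
  have hpos: "0 < ?h $ i" for i using ab[of i] assms(2) by simp
  have nh: "(norm ?h)\<^sup>2 = (norm (b - a))\<^sup>2 / (real N)\<^sup>2"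
    using assms(2) by (simp add: power_divide)
  have ph: "(\<Prod>i\<in>UNIV. ?h $ i) = (\<Prod>i\<in>UNIV. b $ i - a $ i) / (real N)^3"
    using assms(2) by (simp add: prod_dividef)
  have Qb: "?Q k \<in> sets borel" "bounded (?Q k)" for k
    using bounded_subset[OF bounded_cbox half_open_box_subset_cbox] by (auto simp: grid_cell_def)
  have sum: "(LINT x|lborel. indicator (half_open_box a b) x * g x) = (\<Sum>k\<in>grid N. LINT x|lborel. indicator (?Q k) x * g x)"
    if "continuous_on UNIV g" for g :: "real^3 \<Rightarrow> real"
    unfolding indicator_half_open_box_eq_sum[OF assms(2) ab] sum_distrib_right
    using integrable_indicator_continuous[OF that Qb] by (intro Bochner_Integration.integral_sum) simp
  have "(LINT x|lborel. indicator (half_open_box a b) x * (norm (\<phi> x))\<^sup>2)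
    = (\<Sum>k\<in>grid N. LINT x|lborel. indicator (?Q k) x * (norm (\<phi> x))\<^sup>2)"
    by (intro sum continuous_intros smooth_continuous_on assms(1))
  also have "\<dots> \<le> (\<Sum>k\<in>grid N. (norm (LINT x|lborel. indicator (?Q k) x *\<^sub>R \<phi> x))\<^sup>2 / (\<Prod>i\<in>UNIV. ?h $ i)
      + 4 * (norm ?h)\<^sup>2 * (LINT x|lborel. indicator (?Q k) x * grad_power2 \<phi> x))"
    unfolding grid_cell_def by (intro sum_mono poincare_half_open_box[OF assms(1) hpos])
  also have "\<dots> = (real N)^3 / (\<Prod>i\<in>UNIV. b $ i - a $ i)
        * (\<Sum>k\<in>grid N. (norm (LINT x|lborel. indicator (?Q k) x *\<^sub>R \<phi> x))\<^sup>2)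
      + 4 * (norm (b - a))\<^sup>2 / (real N)\<^sup>2 * (\<Sum>k\<in>grid N. LINT x|lborel. indicator (?Q k) x * grad_power2 \<phi> x)"
    unfolding ph nh sum.distrib sum_distrib_left by (simp add: mult.commute)
  also have "(\<Sum>k\<in>grid N. LINT x|lborel. indicator (?Q k) x * grad_power2 \<phi> x)
      = (LINT x|lborel. indicator (half_open_box a b) x * grad_power2 \<phi> x)"
    by (rule sum[symmetric]) (rule continuous_on_grad_power2[OF assms(1)])
  finally show ?thesis .
qed

lemma tendsto_norm_diff_le:
  fixes f :: "'c \<Rightarrow> 'd::real_normed_vector"
  assumes "\<And>n. norm (f n - l) \<le> g n" "(g \<longlongrightarrow> 0) F"
  shows "(f \<longlongrightarrow> l) F"
proof -
  have "((\<lambda>n. f n - l) \<longlongrightarrow> 0) F"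
    by (rule Lim_null_comparison[OF always_eventually assms(2)]) (intro allI assms(1))
  then show ?thesis by (rule LIM_zero_cancel)
qed

text \<open>What the two kinds of flow share. Unlike \<open>\<Omega>\<close>, the box can be cut
  into full cells. By \<open>vanish_off_dom\<close> the integrals that occur for fields in
  \<open>\<V>\<close> are the same over the box and over \<open>\<Omega>\<close>, so that estimates
  on the grid become estimates on \<open>\<Omega>\<close>.\<close>

locale flow_domain = bounded_domain +
  fixes \<V> :: "field3 set" and a b :: "real^3"
  assumes smooth_flow: "\<And>\<phi>. \<phi> \<in> \<V> \<Longrightarrow> smooth \<phi>"
    and a_less_b: "\<And>i. a $ i < b $ i"
    and dom_subset_box: "\<Omega> \<subseteq> half_open_box a b"
    and vanish_off_dom: "\<And>\<phi>. \<phi> \<in> \<V> \<Longrightarrow> AE x in lborel. x \<in> half_open_box a b - \<Omega> \<longrightarrow>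
      \<phi> x = 0 \<and> (\<forall>i. dir_deriv (axis i 1) \<phi> x = 0)"

context bounded_domain
begin

lemma V_norm_smooth:
  assumes "smooth \<phi>"
  shows "(V_norm \<Omega> \<phi>)\<^sup>2 = (LINT x|lebesgue_on \<Omega>. grad_power2 \<phi> x)"
proof -
  have L: "dir_deriv (axis i 1) \<phi> \<in> L2 \<Omega>" for i
    by (intro continuous_in_L2 smooth_continuous_on smooth_dir_deriv assms)
  have "(V_norm \<Omega> \<phi>)\<^sup>2 = (\<Sum>i\<in>UNIV. (L2_norm \<Omega> (dir_deriv (axis i 1) \<phi>))\<^sup>2)"
    unfolding V_norm_power2[OF smooth_H1[OF assms]]
    using weak_partial_smooth[OF assms] weak_partial_L2[OF smooth_H1[OF assms]] L
    by (intro sum.cong refl arg_cong[where f = power2] L2_norm_AE_cong)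
  also have "\<dots> = (LINT x|lebesgue_on \<Omega>. grad_power2 \<phi> x)"
    unfolding grad_power2_def L2_norm_power2 ip_def dot_square_norm
    by (rule Bochner_Integration.integral_sum[symmetric]) (rule L2_integrable_power2[OF L])
  finally show ?thesis .
qed

lemma L2_norm_le_H1_norm: "L2_norm \<Omega> u \<le> H1_norm \<Omega> u"
  unfolding H1_norm_def by (rule real_le_rsqrt) simp

lemma V_norm_le_H1_norm: "V_norm \<Omega> u \<le> H1_norm \<Omega> u"
  unfolding H1_norm_def by (rule real_le_rsqrt) simp

text \<open>Only the part of \<open>Q\<close> inside \<open>\<Omega>\<close> counts. As functionals
  of \<open>v\<close> these integrals are continuous in the norm of \<open>L2\<close>, and they are
  the data along which convergent subsequences are selected.\<close>

definition cell_integral :: "(real^3) set \<Rightarrow> field3 \<Rightarrow> real^3" where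
  "cell_integral Q v = (LINT x|lebesgue_on \<Omega>. indicator Q x *\<^sub>R v x)"

lemma integrable_cell:
  assumes "Q \<in> sets borel" "v \<in> L2 \<Omega>"
  shows "integrable (lebesgue_on \<Omega>) (\<lambda>x. indicator Q x *\<^sub>R v x)"
proof -
  have "Q \<inter> \<Omega> \<in> sets (lebesgue_on \<Omega>)" using assms(1) by (auto simp: sets_restrict_space_iff)
  then have "integrable (lebesgue_on \<Omega>) (\<lambda>x. indicator (Q \<inter> \<Omega>) x *\<^sub>R v x)"
    by (rule integrable_mult_indicator[OF _ L2_integrable[OF assms(2)]])
  then show ?thesis
    by (rule Bochner_Integration.integrable_cong[THEN iffD1, rotated 2]) (auto simp: indicator_def)
qed

lemma cell_integral_diff:
  assumes "Q \<in> sets borel" "u \<in> L2 \<Omega>" "v \<in> L2 \<Omega>"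
  shows "cell_integral Q (u - v) = cell_integral Q u - cell_integral Q v"
  unfolding cell_integral_def
  using integrable_cell[OF assms(1,2)] integrable_cell[OF assms(1,3)] by (simp add: scaleR_diff_right)

lemma cell_integral_le:
  assumes "Q \<in> sets borel" "v \<in> L2 \<Omega>"
  shows "norm (cell_integral Q v) \<le> L2_norm \<Omega> v * L2_norm \<Omega> (\<lambda>_. axis 1 1)"
proof -
  have c: "(\<lambda>_. axis 1 1) \<in> L2 \<Omega>" by (rule L2_const)
  have "norm (cell_integral Q v) \<le> (LINT x|lebesgue_on \<Omega>. norm (v x) * norm (axis 1 (1::real) :: real^3))"
    unfolding cell_integral_def
  proof (rule integral_norm_bound[THEN order_trans], rule integral_mono)
    show "integrable (lebesgue_on \<Omega>) (\<lambda>x. norm (indicat_real Q x *\<^sub>R v x))"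
      using integrable_cell[OF assms] by (rule integrable_norm)
    show "integrable (lebesgue_on \<Omega>) (\<lambda>x. norm (v x) * norm (axis 1 (1::real) :: real^3))"
      by (rule L2_integrable_inner(2)[OF assms(2) c])
  qed (auto simp: indicator_def norm_axis_1)
  then show ?thesis using L2_norm_mult_le[OF assms(2) c] by linarith
qed

lemma L2_norm_tendsto:
  assumes "\<And>n. v n \<in> L2 \<Omega>" "w \<in> L2 \<Omega>" "((\<lambda>n. L2_norm \<Omega> (v n - w)) \<longlongrightarrow> 0) F"
  shows "((\<lambda>n. L2_norm \<Omega> (v n)) \<longlongrightarrow> L2_norm \<Omega> w) F"
  by (rule tendsto_norm_diff_le[OF _ assms(3)]) (use L2_norm_diff_abs[OF assms(1,2)] in simp)

lemma ip_tendsto: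
  assumes "\<And>n. v n \<in> L2 \<Omega>" "w \<in> L2 \<Omega>" "x \<in> L2 \<Omega>" "((\<lambda>n. L2_norm \<Omega> (v n - w)) \<longlongrightarrow> 0) F"
  shows "((\<lambda>n. ip \<Omega> (v n) x) \<longlongrightarrow> ip \<Omega> w x) F"
proof (rule tendsto_norm_diff_le)
  show "((\<lambda>n. L2_norm \<Omega> (v n - w) * L2_norm \<Omega> x) \<longlongrightarrow> 0) F"
    using tendsto_mult_right[OF assms(4)] by simp
  show "norm (ip \<Omega> (v n) x - ip \<Omega> w x) \<le> L2_norm \<Omega> (v n - w) * L2_norm \<Omega> x" for n
    using ip_abs_le[OF L2_diff[OF assms(1,2)] assms(3), of n] ip_diff_left[OF assms(1-3), of n] by simp
qed

lemma cell_integral_tendsto: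
  assumes "\<And>n. v n \<in> L2 \<Omega>" "w \<in> L2 \<Omega>" "Q \<in> sets borel" "((\<lambda>n. L2_norm \<Omega> (v n - w)) \<longlongrightarrow> 0) F"
  shows "((\<lambda>n. cell_integral Q (v n)) \<longlongrightarrow> cell_integral Q w) F"
proof (rule tendsto_norm_diff_le)
  let ?c = "L2_norm \<Omega> (\<lambda>_. axis 1 1)"
  show "((\<lambda>n. L2_norm \<Omega> (v n - w) * ?c) \<longlongrightarrow> 0) F"
    using tendsto_mult_right[OF assms(4)] by simp
  show "norm (cell_integral Q (v n) - cell_integral Q w) \<le> L2_norm \<Omega> (v n - w) * ?c" for n
    using cell_integral_le[OF assms(3) L2_diff[OF assms(1,2)], of n]
    by (simp only: cell_integral_diff[OF assms(3,1,2)])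
qed

lemma spaceH_L2: "u \<in> spaceH \<Omega> \<V> \<Longrightarrow> u \<in> L2 \<Omega>"
  by (simp add: spaceH_def)

lemma spaceV_H1: "u \<in> spaceV \<Omega> \<V> \<Longrightarrow> u \<in> H1 \<Omega>"
  by (simp add: spaceV_def)

lemma spaceV_subset_spaceH: "spaceV \<Omega> \<V> \<subseteq> spaceH \<Omega> \<V>"
proof
  fix u assume "u \<in> spaceV \<Omega> \<V>"
  then obtain \<phi> where \<phi>: "u \<in> H1 \<Omega>" "\<And>n::nat. \<phi> n \<in> \<V>" "(\<lambda>n. H1_norm \<Omega> (\<phi> n - u)) \<longlonglongrightarrow> 0"
    by (auto simp: spaceV_def)
  have "(\<lambda>n. L2_norm \<Omega> (\<phi> n - u)) \<longlonglongrightarrow> 0"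
    by (rule Lim_null_comparison[OF _ \<phi>(3)]) (simp add: L2_norm_nonneg L2_norm_le_H1_norm)
  then show "u \<in> spaceH \<Omega> \<V>" using \<phi> H1_L2 by (auto simp: spaceH_def)
qed

text \<open>Membership in \<open>spaceH\<close> asks for an approximating sequence from
  \<open>\<V>\<close>; each \<open>h n\<close> is replaced by a member of \<open>\<V>\<close> at
  distance below \<open>1 / (n + 1)\<close>.\<close>

lemma spaceH_closed:
  assumes V: "\<V> \<subseteq> L2 \<Omega>" and h: "\<And>n. h n \<in> spaceH \<Omega> \<V>" and w: "w \<in> L2 \<Omega>"
    and lim: "(\<lambda>n. L2_norm \<Omega> (h n - w)) \<longlonglongrightarrow> 0"
  shows "w \<in> spaceH \<Omega> \<V>"
proof -
  have "\<exists>\<phi>\<in>\<V>. L2_norm \<Omega> (\<phi> - h n) < inverse (real (Suc n))" for n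
  proof -
    obtain \<phi> where \<phi>: "\<And>k::nat. \<phi> k \<in> \<V>" "(\<lambda>k. L2_norm \<Omega> (\<phi> k - h n)) \<longlonglongrightarrow> 0"
      using h[of n] by (auto simp: spaceH_def)
    have "\<forall>\<^sub>F k in sequentially. L2_norm \<Omega> (\<phi> k - h n) < inverse (real (Suc n))"
      by (rule order_tendstoD(2)[OF \<phi>(2)]) simp
    then show ?thesis using \<phi>(1) by (auto simp: eventually_sequentially)
  qed
  then obtain \<phi> where \<phi>: "\<And>n. \<phi> n \<in> \<V>" "\<And>n. L2_norm \<Omega> (\<phi> n - h n) < inverse (real (Suc n))"
    by metis
  have "(\<lambda>n. inverse (real (Suc n)) + L2_norm \<Omega> (h n - w)) \<longlonglongrightarrow> 0 + 0"
    by (intro tendsto_add LIMSEQ_inverse_real_of_nat lim)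
  then have lim': "(\<lambda>n. inverse (real (Suc n)) + L2_norm \<Omega> (h n - w)) \<longlonglongrightarrow> 0" by simp
  have "norm (L2_norm \<Omega> (\<phi> n - w)) \<le> inverse (real (Suc n)) + L2_norm \<Omega> (h n - w)" for n
    using L2_norm_triangle[of "\<phi> n" "h n" w] \<phi>(2)[of n] V \<phi>(1)[of n] spaceH_L2[OF h] w L2_norm_nonneg[of "\<phi> n - w"]
    by (auto simp: subset_iff)
  then have "(\<lambda>n. L2_norm \<Omega> (\<phi> n - w)) \<longlonglongrightarrow> 0"
    by (intro tendsto_norm_diff_le[OF _ lim']) simp
  then show ?thesis using \<phi>(1) w by (auto simp: spaceH_def)
qed

end

context flow_domain
begin

lemma flow_subset_L2: "\<V> \<subseteq> L2 \<Omega>"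
  using smooth_H1 H1_L2 smooth_flow by auto

text \<open>The constant sequence approximates. That \<open>\<phi> - \<phi>\<close> has seminorm 0
  still rests on \<open>V_norm_smooth\<close>, as the weak derivative of the zero field is itself an
  arbitrary choice.\<close>

lemma flow_subset_spaceV: "\<V> \<subseteq> spaceV \<Omega> \<V>"
proof
  fix \<phi> assume \<phi>: "\<phi> \<in> \<V>"
  have eq: "\<phi> - \<phi> = (\<lambda>x. 0)" by auto
  have "grad_power2 (\<lambda>x. 0) x = 0" for x
    by (simp add: grad_power2_def dir_deriv_eqI[OF has_derivative_const])
  then have "V_norm \<Omega> (\<phi> - \<phi>) = 0"
    using V_norm_smooth[OF smooth_const[of "0 :: real^3"]] unfolding eq by simp
  moreover have "L2_norm \<Omega> (\<phi> - \<phi>) = 0" by (simp add: L2_norm_def ip_def)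
  ultimately have "H1_norm \<Omega> (\<phi> - \<phi>) = 0" by (simp add: H1_norm_def)
  then show "\<phi> \<in> spaceV \<Omega> \<V>"
    using \<phi> smooth_H1[OF smooth_flow] by (auto simp: spaceV_def intro!: exI[of _ "\<lambda>n. \<phi>"])
qed

lemma flow_subset_spaceH: "\<V> \<subseteq> spaceH \<Omega> \<V>"
  using flow_subset_spaceV spaceV_subset_spaceH by blast

lemma integral_dom_eq_box:
  fixes F :: "real^3 \<Rightarrow> 'b::euclidean_space"
  assumes [measurable]: "F \<in> borel_measurable borel"
    and "AE x in lborel. x \<in> half_open_box a b - \<Omega> \<longrightarrow> F x = 0"
  shows "(LINT x|lebesgue_on \<Omega>. F x) = (LINT x|lborel. indicator (half_open_box a b) x *\<^sub>R F x)"
proof -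
  have [measurable]: "\<Omega> \<in> sets borel" using open_dom by simp
  have "(LINT x|lebesgue_on \<Omega>. F x) = (LINT x|lebesgue. indicator \<Omega> x *\<^sub>R F x)"
    by (simp add: integral_restrict_space)
  also have "\<dots> = (LINT x|lborel. indicator \<Omega> x *\<^sub>R F x)"
    by (intro integral_completion) measurable
  also have "\<dots> = (LINT x|lborel. indicator (half_open_box a b) x *\<^sub>R F x)"
  proof (rule integral_cong_AE)
    show "AE x in lborel. indicat_real \<Omega> x *\<^sub>R F x = indicat_real (half_open_box a b) x *\<^sub>R F x"
      using assms(2) by eventually_elim (use dom_subset_box in \<open>auto simp: indicator_def\<close>)
  qed measurable
  finally show ?thesis .
qed

lemma grid_cell_borel: "grid_cell a b N k \<in> sets borel"
  by (simp add: grid_cell_def)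

definition grid_const :: "nat \<Rightarrow> real" where
  "grid_const N = (real N)^3 / (\<Prod>i\<in>UNIV. b $ i - a $ i)"

lemma grid_const_nonneg: "0 \<le> grid_const N"
  unfolding grid_const_def using a_less_b by (intro divide_nonneg_nonneg prod_nonneg) (auto simp: less_imp_le)

text \<open>Stated for differences, since Rellich's theorem compares two members of a sequence and
  the locale does not provide closure of \<open>\<V>\<close> under subtraction.\<close>

lemma grid_inequality_smooth:
  assumes "\<phi> \<in> \<V>" "\<psi> \<in> \<V>" "N > 0"
  shows "(L2_norm \<Omega> (\<phi> - \<psi>))\<^sup>2 \<le>
    grid_const N * (\<Sum>k\<in>grid N. (norm (cell_integral (grid_cell a b N k) (\<phi> - \<psi>)))\<^sup>2)
      + 4 * (norm (b - a))\<^sup>2 / (real N)\<^sup>2 * (V_norm \<Omega> (\<phi> - \<psi>))\<^sup>2"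
proof -
  let ?d = "\<phi> - \<psi>" and ?B = "half_open_box a b"
  have sm: "smooth ?d" unfolding fun_diff_def by (intro smooth_diff smooth_flow assms)
  have dd: "dir_deriv v ?d x = dir_deriv v \<phi> x - dir_deriv v \<psi> x" for v x
    unfolding fun_diff_def by (intro dir_deriv_diff smooth_differentiable smooth_flow assms)
  have van: "AE x in lborel. x \<in> ?B - \<Omega> \<longrightarrow> ?d x = 0 \<and> grad_power2 ?d x = 0"
    using vanish_off_dom[OF assms(1)] vanish_off_dom[OF assms(2)]
    by eventually_elim (auto simp: grad_power2_def dd)
  have [measurable]: "?d \<in> borel_measurable borel" "grad_power2 ?d \<in> borel_measurable borel"
    by (intro borel_measurable_continuous_onI smooth_continuous_on continuous_on_grad_power2 sm)+
  have 1: "(L2_norm \<Omega> ?d)\<^sup>2 = (LINT x|lborel. indicator ?B x * (norm (?d x))\<^sup>2)"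
  proof -
    have "(\<lambda>x. (norm (?d x))\<^sup>2) \<in> borel_measurable borel" by measurable
    moreover have "AE x in lborel. x \<in> ?B - \<Omega> \<longrightarrow> (norm (?d x))\<^sup>2 = 0" using van by eventually_elim simp
    ultimately show ?thesis
      unfolding L2_norm_power2 ip_def dot_square_norm by (subst integral_dom_eq_box) simp_all
  qed
  have 2: "(V_norm \<Omega> ?d)\<^sup>2 = (LINT x|lborel. indicator ?B x * grad_power2 ?d x)"
  proof -
    have "AE x in lborel. x \<in> ?B - \<Omega> \<longrightarrow> grad_power2 ?d x = 0" using van by eventually_elim simp
    then show ?thesis
      unfolding V_norm_smooth[OF sm] by (subst integral_dom_eq_box) simp_all
  qed
  have 3: "cell_integral (grid_cell a b N k) ?d = (LINT x|lborel. indicator (grid_cell a b N k) x *\<^sub>R ?d x)"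
    if k: "k \<in> grid N" for k
  proof -
    have sub: "grid_cell a b N k \<subseteq> ?B"
    proof
      fix x assume x: "x \<in> grid_cell a b N k"
      have "indicator (grid_cell a b N k) x \<le> (\<Sum>k\<in>grid N. indicator (grid_cell a b N k) x :: real)"
        by (rule member_le_sum[OF k]) (auto simp: finite_grid)
      then have "indicator ?B x \<noteq> (0::real)"
        using indicator_half_open_box_eq_sum[OF assms(3) a_less_b, of x] x by auto
      then show "x \<in> ?B" by (auto simp: indicator_def split: if_splits)
    qed
    have [measurable]: "grid_cell a b N k \<in> sets borel" by (rule grid_cell_borel)
    have "cell_integral (grid_cell a b N k) ?d
      = (LINT x|lborel. indicator ?B x *\<^sub>R (indicator (grid_cell a b N k) x *\<^sub>R ?d x))"
      unfolding cell_integral_def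
    proof (rule integral_dom_eq_box)
      show "AE x in lborel. x \<in> ?B - \<Omega> \<longrightarrow> indicator (grid_cell a b N k) x *\<^sub>R ?d x = 0"
        using van by eventually_elim auto
    qed measurable
    also have "(\<lambda>x. indicator ?B x *\<^sub>R (indicator (grid_cell a b N k) x *\<^sub>R ?d x))
        = (\<lambda>x. indicator (grid_cell a b N k) x *\<^sub>R ?d x)"
      using sub by (auto simp: indicator_def fun_eq_iff)
    finally show ?thesis .
  qed
  have "(\<Sum>k\<in>grid N. (norm (cell_integral (grid_cell a b N k) ?d))\<^sup>2)
    = (\<Sum>k\<in>grid N. (norm (LINT x|lborel. indicator (grid_cell a b N k) x *\<^sub>R ?d x))\<^sup>2)"
    by (intro sum.cong refl) (simp only: 3)
  then show ?thesis
    using poincare_grid[OF sm assms(3) a_less_b] unfolding 1 2 grid_const_def by (simp only:)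
qed

lemma spaceV_approx:
  assumes "v \<in> spaceV \<Omega> \<V>"
  obtains \<phi> where "\<And>n::nat. \<phi> n \<in> \<V>" "(\<lambda>n. L2_norm \<Omega> (\<phi> n - v)) \<longlonglongrightarrow> 0" "(\<lambda>n. V_norm \<Omega> (\<phi> n - v)) \<longlonglongrightarrow> 0"
proof -
  obtain \<phi> where \<phi>: "\<And>n::nat. \<phi> n \<in> \<V>" "(\<lambda>n. H1_norm \<Omega> (\<phi> n - v)) \<longlonglongrightarrow> 0"
    using assms by (auto simp: spaceV_def)
  show ?thesis
  proof (rule that[OF \<phi>(1)])
    show "(\<lambda>n. L2_norm \<Omega> (\<phi> n - v)) \<longlonglongrightarrow> 0"
      by (rule Lim_null_comparison[OF _ \<phi>(2)]) (simp add: L2_norm_nonneg L2_norm_le_H1_norm)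
    show "(\<lambda>n. V_norm \<Omega> (\<phi> n - v)) \<longlonglongrightarrow> 0"
      by (rule Lim_null_comparison[OF _ \<phi>(2)]) (simp add: V_norm_nonneg V_norm_le_H1_norm)
  qed
qed

text \<open>By density. The constant is 8 instead of 4 because the seminorms of the approximating
  differences are only bounded, by twice that of the limit plus \<open>e n\<close>; their
  convergence is not established.\<close>

lemma grid_inequality:
  assumes v: "v \<in> spaceV \<Omega> \<V>" and w: "w \<in> spaceV \<Omega> \<V>" and "N > 0"
  shows "(L2_norm \<Omega> (v - w))\<^sup>2 \<le>
    grid_const N * (\<Sum>k\<in>grid N. (norm (cell_integral (grid_cell a b N k) (v - w)))\<^sup>2)
      + 8 * (norm (b - a))\<^sup>2 / (real N)\<^sup>2 * (V_norm \<Omega> (v - w))\<^sup>2"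
proof -
  obtain \<phi> where \<phi>: "\<And>n::nat. \<phi> n \<in> \<V>" "(\<lambda>n. L2_norm \<Omega> (\<phi> n - v)) \<longlonglongrightarrow> 0" "(\<lambda>n. V_norm \<Omega> (\<phi> n - v)) \<longlonglongrightarrow> 0"
    using spaceV_approx[OF v] by metis
  obtain \<psi> where \<psi>: "\<And>n::nat. \<psi> n \<in> \<V>" "(\<lambda>n. L2_norm \<Omega> (\<psi> n - w)) \<longlonglongrightarrow> 0" "(\<lambda>n. V_norm \<Omega> (\<psi> n - w)) \<longlonglongrightarrow> 0"
    using spaceV_approx[OF w] by metis
  define d where "d n = \<phi> n - \<psi> n" for n
  define D where "D = v - w"
  have H: "\<phi> n \<in> H1 \<Omega>" "\<psi> n \<in> H1 \<Omega>" "v \<in> H1 \<Omega>" "w \<in> H1 \<Omega>" for n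
    using smooth_H1[OF smooth_flow] \<phi>(1) \<psi>(1) v w spaceV_H1 by auto
  have dH: "d n \<in> H1 \<Omega>" "D \<in> H1 \<Omega>" for n unfolding d_def D_def by (intro H1_diff H)+
  have eq: "d n - D = (\<phi> n - v) - (\<psi> n - w)" for n by (auto simp: d_def D_def fun_eq_iff)
  have L: "(\<lambda>n. L2_norm \<Omega> (d n - D)) \<longlonglongrightarrow> 0"
  proof (rule Lim_null_comparison)
    show "(\<lambda>n. L2_norm \<Omega> (\<phi> n - v) + L2_norm \<Omega> (\<psi> n - w)) \<longlonglongrightarrow> 0"
      using tendsto_add[OF \<phi>(2) \<psi>(2)] by simp
    show "\<forall>\<^sub>F n in sequentially. norm (L2_norm \<Omega> (d n - D)) \<le> L2_norm \<Omega> (\<phi> n - v) + L2_norm \<Omega> (\<psi> n - w)"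
      unfolding eq using L2_norm_diff_le[OF L2_diff L2_diff] H1_L2[OF H(1)] H1_L2[OF H(2)] H1_L2[OF H(3)] H1_L2[OF H(4)]
      by (auto simp: L2_norm_nonneg)
  qed
  define e where "e n = 4 * (V_norm \<Omega> (\<phi> n - v))\<^sup>2 + 4 * (V_norm \<Omega> (\<psi> n - w))\<^sup>2" for n
  have e0: "e \<longlonglongrightarrow> 0"
  proof -
    have "(\<lambda>n. 4 * (V_norm \<Omega> (\<phi> n - v))\<^sup>2 + 4 * (V_norm \<Omega> (\<psi> n - w))\<^sup>2) \<longlonglongrightarrow> 4 * 0\<^sup>2 + 4 * 0\<^sup>2"
      by (intro tendsto_intros \<phi> \<psi>)
    then show ?thesis by (simp add: e_def[abs_def])
  qed
  have Vd: "(V_norm \<Omega> (d n))\<^sup>2 \<le> 2 * (V_norm \<Omega> D)\<^sup>2 + e n" for n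
  proof -
    have "d n = D - (D - d n)" by (auto simp: fun_eq_iff)
    then have "(V_norm \<Omega> (d n))\<^sup>2 \<le> 2 * (V_norm \<Omega> D)\<^sup>2 + 2 * (V_norm \<Omega> (D - d n))\<^sup>2"
      using V_norm_diff_power2_le[OF dH(2) H1_diff[OF dH(2) dH(1)], of n] by simp
    also have "V_norm \<Omega> (D - d n) = V_norm \<Omega> ((\<phi> n - v) - (\<psi> n - w))"
      using V_norm_diff_commute[OF dH(2) dH(1), of n] by (simp add: eq)
    also have "2 * (V_norm \<Omega> ((\<phi> n - v) - (\<psi> n - w)))\<^sup>2 \<le> e n"
      using V_norm_diff_power2_le[OF H1_diff[OF H(1,3)] H1_diff[OF H(2,4)], of n n] by (simp add: e_def)
    finally show ?thesis by simp
  qed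
  let ?K = "4 * (norm (b - a))\<^sup>2 / (real N)\<^sup>2"
  let ?S = "\<lambda>u. grid_const N * (\<Sum>k\<in>grid N. (norm (cell_integral (grid_cell a b N k) u))\<^sup>2)"
  have "(\<lambda>n. (L2_norm \<Omega> (d n))\<^sup>2) \<longlonglongrightarrow> (L2_norm \<Omega> D)\<^sup>2"
    by (intro tendsto_intros L2_norm_tendsto H1_L2 dH L)
  moreover have "(\<lambda>n. ?S (d n) + ?K * (2 * (V_norm \<Omega> D)\<^sup>2 + e n)) \<longlonglongrightarrow> ?S D + ?K * (2 * (V_norm \<Omega> D)\<^sup>2 + 0)"
    by (intro tendsto_add tendsto_mult tendsto_sum tendsto_power tendsto_norm tendsto_const
        cell_integral_tendsto H1_L2 dH L grid_cell_borel e0)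
  moreover have "(L2_norm \<Omega> (d n))\<^sup>2 \<le> ?S (d n) + ?K * (2 * (V_norm \<Omega> D)\<^sup>2 + e n)" for n
  proof -
    have "?K * (V_norm \<Omega> (d n))\<^sup>2 \<le> ?K * (2 * (V_norm \<Omega> D)\<^sup>2 + e n)"
      by (intro mult_left_mono Vd) simp
    then show ?thesis
      using grid_inequality_smooth[OF \<phi>(1) \<psi>(1) \<open>N > 0\<close>, of n n] unfolding d_def by linarith
  qed
  ultimately have "(L2_norm \<Omega> D)\<^sup>2 \<le> ?S D + ?K * (2 * (V_norm \<Omega> D)\<^sup>2 + 0)"
    by (intro LIMSEQ_le) auto
  then show ?thesis by (simp add: D_def)
qed

lemma rellich_Cauchy:
  assumes v: "\<And>n. v n \<in> spaceV \<Omega> \<V>" and K: "\<And>n. V_norm \<Omega> (v n) \<le> K"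
    and conv: "\<And>N k. convergent (\<lambda>n. cell_integral (grid_cell a b N k) (v n))" and "0 < e"
  shows "\<exists>M. \<forall>m\<ge>M. \<forall>n\<ge>M. L2_norm \<Omega> (v m - v n) < e"
proof -
  have vL: "v n \<in> L2 \<Omega>" and vH: "v n \<in> H1 \<Omega>" for n using v spaceV_H1 H1_L2 by blast+
  \<comment> \<open>\<open>4 * K^2\<close> bounds the squared seminorm of any difference, so a fine
    grid makes the gradient term smaller than \<open>e^2 / 2\<close> for all pairs at once. With
    \<open>N\<close> fixed, the finitely many cell integrals can then be brought close to their
    limits.\<close>
  let ?c = "8 * (norm (b - a))\<^sup>2 * (4 * K\<^sup>2)"
  have "(\<lambda>N. ?c / (real N)\<^sup>2) \<longlonglongrightarrow> 0"
    by (intro real_tendsto_divide_at_top[OF tendsto_const] filterlim_pow_at_top filterlim_real_sequentially) simp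
  then have "\<forall>\<^sub>F N in sequentially. ?c / (real N)\<^sup>2 < e\<^sup>2 / 2"
    by (rule order_tendstoD(2)) (use \<open>0 < e\<close> in simp)
  then have "\<forall>\<^sub>F N in sequentially. ?c / (real N)\<^sup>2 < e\<^sup>2 / 2 \<and> N > 0"
    by (intro eventually_conj eventually_gt_at_top)
  then obtain N where N: "?c / (real N)\<^sup>2 < e\<^sup>2 / 2" "N > 0"
    by (auto simp: eventually_sequentially)
  define x where "x k n = cell_integral (grid_cell a b N k) (v n)" for k n
  define l where "l k = lim (x k)" for k
  have xl: "x k \<longlonglongrightarrow> l k" for k
    using conv[of N k] unfolding l_def x_def by (simp add: convergent_LIMSEQ_iff)
  define T where "T n = grid_const N * (\<Sum>k\<in>grid N. (norm (x k n - l k))\<^sup>2)" for n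
  have "T \<longlonglongrightarrow> grid_const N * (\<Sum>k\<in>grid N. (norm (l k - l k))\<^sup>2)"
    unfolding T_def by (intro tendsto_intros xl)
  then have "T \<longlonglongrightarrow> 0" by simp
  then have "\<forall>\<^sub>F n in sequentially. T n < e\<^sup>2 / 8"
    by (rule order_tendstoD(2)) (use \<open>0 < e\<close> in simp)
  then obtain M where M: "\<And>n. n \<ge> M \<Longrightarrow> T n < e\<^sup>2 / 8" by (auto simp: eventually_sequentially)
  have "L2_norm \<Omega> (v m - v n) < e" if mn: "m \<ge> M" "n \<ge> M" for m n
  proof -
    have "(norm (cell_integral (grid_cell a b N k) (v m - v n)))\<^sup>2
        \<le> 2 * (norm (x k m - l k))\<^sup>2 + 2 * (norm (x k n - l k))\<^sup>2" for k
      using norm_power2_diff_le[of "x k m - l k" "x k n - l k"]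
      by (simp add: cell_integral_diff[OF grid_cell_borel vL vL] x_def)
    then have "grid_const N * (\<Sum>k\<in>grid N. (norm (cell_integral (grid_cell a b N k) (v m - v n)))\<^sup>2)
        \<le> grid_const N * (\<Sum>k\<in>grid N. 2 * (norm (x k m - l k))\<^sup>2 + 2 * (norm (x k n - l k))\<^sup>2)"
      by (intro mult_left_mono sum_mono grid_const_nonneg)
    also have "\<dots> = 2 * T m + 2 * T n"
      by (simp add: T_def sum.distrib sum_distrib_left algebra_simps)
    also have "\<dots> < e\<^sup>2 / 2" using M[OF mn(1)] M[OF mn(2)] by simp
    finally have S: "grid_const N * (\<Sum>k\<in>grid N. (norm (cell_integral (grid_cell a b N k) (v m - v n)))\<^sup>2) < e\<^sup>2 / 2" .
    have "(V_norm \<Omega> (v i))\<^sup>2 \<le> K\<^sup>2" for i by (intro power_mono K V_norm_nonneg)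
    then have "(V_norm \<Omega> (v m - v n))\<^sup>2 \<le> 4 * K\<^sup>2"
      using V_norm_diff_power2_le[OF vH vH, of m n] by (smt (verit))
    then have "8 * (norm (b - a))\<^sup>2 / (real N)\<^sup>2 * (V_norm \<Omega> (v m - v n))\<^sup>2
        \<le> 8 * (norm (b - a))\<^sup>2 / (real N)\<^sup>2 * (4 * K\<^sup>2)"
      by (intro mult_left_mono) auto
    also have "\<dots> = ?c / (real N)\<^sup>2" by simp
    finally have "(L2_norm \<Omega> (v m - v n))\<^sup>2 < e\<^sup>2"
      using grid_inequality[OF v v \<open>N > 0\<close>, of m n] S N(1) by linarith
    then show ?thesis by (rule power2_less_imp_less) (use \<open>0 < e\<close> in simp)
  qed
  then show ?thesis by blast
qed

text \<open>A single subsequence has to serve every \<open>k\<close>, because its members for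
  different \<open>k\<close> are later compared with the same \<open>u (T n)\<close>. The cell
  integrals for all \<open>k\<close>, all grids and all cells form a countable family of bounded
  sequences, which one diagonal argument handles together.\<close>

lemma rellich_family:
  fixes v :: "nat \<Rightarrow> nat \<Rightarrow> field3"
  assumes v: "\<And>k n. v k n \<in> spaceV \<Omega> \<V>" and K: "\<And>k n. V_norm \<Omega> (v k n) \<le> K k"
    and R: "\<And>k n. L2_norm \<Omega> (v k n) \<le> R"
  obtains r where "strict_mono (r :: nat \<Rightarrow> nat)"
    "\<And>k. \<exists>w\<in>spaceH \<Omega> \<V>. (\<lambda>n. L2_norm \<Omega> (v k (r n) - w)) \<longlonglongrightarrow> 0"
proof -
  have vL: "v k n \<in> L2 \<Omega>" for k n using v spaceV_H1 H1_L2 by blast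
  define f where "f n = (\<lambda>(k, N, \<kappa>). cell_integral (grid_cell a b N \<kappa>) (v k n))" for n
  have bd: "norm (f n x) \<le> R * L2_norm \<Omega> (\<lambda>_. axis 1 1)" for n x
  proof -
    obtain k N \<kappa> where x: "x = (k, N, \<kappa>)" by (cases x) auto
    have "norm (f n x) \<le> L2_norm \<Omega> (v k n) * L2_norm \<Omega> (\<lambda>_. axis 1 1)"
      unfolding f_def x using cell_integral_le[OF grid_cell_borel vL] by simp
    also have "\<dots> \<le> R * L2_norm \<Omega> (\<lambda>_. axis 1 1)"
      by (intro mult_right_mono R L2_norm_nonneg)
    finally show ?thesis .
  qed
  have "countable (UNIV :: (nat \<times> nat \<times> (3 \<Rightarrow> nat)) set)" by simp
  then obtain r where r: "strict_mono (r :: nat \<Rightarrow> nat)" "\<And>x. \<exists>l. (\<lambda>n. f (r n) x) \<longlonglongrightarrow> l"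
    by (rule function_convergent_subsequence[of UNIV f, OF _ bd]) auto
  show ?thesis
  proof (rule that[OF r(1)])
    fix k
    have conv: "convergent (\<lambda>n. cell_integral (grid_cell a b N \<kappa>) (v k (r n)))" for N \<kappa>
      using r(2)[of "(k, N, \<kappa>)"] by (simp add: f_def convergent_def)
    have "\<exists>w\<in>L2 \<Omega>. (\<lambda>n. L2_norm \<Omega> (v k (r n) - w)) \<longlonglongrightarrow> 0"
    proof (rule L2_complete[OF vL])
      fix e :: real assume "0 < e"
      then show "\<exists>N. \<forall>m\<ge>N. \<forall>n\<ge>N. L2_norm \<Omega> (v k (r m) - v k (r n)) < e"
        by (rule rellich_Cauchy[OF v K conv])
    qed
    then obtain w where w: "w \<in> L2 \<Omega>" "(\<lambda>n. L2_norm \<Omega> (v k (r n) - w)) \<longlonglongrightarrow> 0" by blast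
    have "w \<in> spaceH \<Omega> \<V>"
      by (rule spaceH_closed[OF flow_subset_L2 _ w]) (use v spaceV_subset_spaceH in blast)
    then show "\<exists>w\<in>spaceH \<Omega> \<V>. (\<lambda>n. L2_norm \<Omega> (v k (r n) - w)) \<longlonglongrightarrow> 0" using w by blast
  qed
qed

end

text \<open>For periodic flows the box is the period cell, which exceeds the open cell by a null set
  only. For no-slip flows any cube around the domain serves, since the fields and their derivatives
  vanish off the support.\<close>

lemma flow_setting_flow_domain:
  assumes "flow_setting \<Omega> \<V>"
  obtains a b where "flow_domain \<Omega> \<V> a b"
  using assms unfolding flow_setting_def
proof (elim disjE exE conjE)
  fix L :: "real^3" assume L: "\<forall>i. 0 < L $ i" "\<Omega> = box 0 L" "\<V> = periodic_fields L"
  have null: "cbox 0 L - box 0 L \<in> null_sets lborel"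
    using negligible_frontier_interval[of 0 L] by (simp add: negligible_iff_null_sets null_sets_completion_iff)
  have "flow_domain \<Omega> \<V> 0 L"
  proof
    show "open \<Omega>" "bounded \<Omega>" using L(2) by auto
    show "\<phi> \<in> \<V> \<Longrightarrow> smooth \<phi>" for \<phi> using L(3) by (simp add: periodic_fields_def)
    show "0 $ i < L $ i" for i using L(1) by simp
    show "\<Omega> \<subseteq> half_open_box 0 L" using L(2) box_subset_half_open_box by blast
    show "AE x in lborel. x \<in> half_open_box 0 L - \<Omega> \<longrightarrow> \<phi> x = 0 \<and> (\<forall>i. dir_deriv (axis i 1) \<phi> x = 0)" for \<phi>
      using AE_not_in[OF null] by eventually_elim (use half_open_box_subset_cbox L(2) in blast)
  qed
  then show thesis by (rule that)
next
  assume O: "open \<Omega>" "bounded \<Omega>" "\<V> = noslip_fields \<Omega>"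
  obtain r where r: "\<And>x. x \<in> \<Omega> \<Longrightarrow> norm x \<le> r" using O(2) unfolding bounded_iff by blast
  define c where "c = max r 0 + 1"
  have c: "norm x < c" if "x \<in> \<Omega>" for x using r[OF that] by (simp add: c_def)
  have "flow_domain \<Omega> \<V> (\<chi> i. - c) (\<chi> i. c)"
  proof
    show "open \<Omega>" "bounded \<Omega>" by fact+
    show "\<phi> \<in> \<V> \<Longrightarrow> smooth \<phi>" for \<phi> using O(3) by (simp add: noslip_fields_def test_functions_def)
    show "(\<chi> i. - c) $ i < (\<chi> i. c) $ i" for i by (simp add: c_def)
    show "\<Omega> \<subseteq> half_open_box (\<chi> i. - c) (\<chi> i. c)"
    proof
      fix x assume "x \<in> \<Omega>"
      then have "\<bar>x $ i\<bar> < c" for i using component_le_norm_cart[of x i] c[of x] by linarith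
      then have "- c \<le> x $ i \<and> x $ i < c" for i by (smt (verit))
      then show "x \<in> half_open_box (\<chi> i. - c) (\<chi> i. c)" by (simp add: half_open_box_def)
    qed
    show "AE x in lborel. x \<in> half_open_box (\<chi> i. - c) (\<chi> i. c) - \<Omega> \<longrightarrow>
        \<phi> x = 0 \<and> (\<forall>i. dir_deriv (axis i 1) \<phi> x = 0)" if "\<phi> \<in> \<V>" for \<phi>
    proof -
      let ?K = "closure {x. \<phi> x \<noteq> 0}"
      have K: "?K \<subseteq> \<Omega>" using that O(3) by (simp add: noslip_fields_def test_functions_def)
      have z: "\<phi> x = 0" if "x \<notin> ?K" for x using that closure_subset[of "{x. \<phi> x \<noteq> 0}"] by auto
      have "\<phi> x = 0 \<and> (\<forall>i. dir_deriv (axis i 1) \<phi> x = 0)" if "x \<notin> \<Omega>" for x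
      proof -
        have "x \<notin> ?K" using that K by blast
        then show ?thesis using z[of x] dir_deriv_vanish[of ?K \<phi> x, OF closed_closure z] by simp
      qed
      then show ?thesis by (intro AE_I2) simp
    qed
  qed
  then show thesis by (rule that)
qed

subsection \<open>Averages in time\<close>

lemma smooth_step_on_translate:
  assumes "smooth_step_on a b \<eta> \<sigma>"
  shows "smooth_step_on (a + t) (b + t) (\<lambda>x. \<eta> (x - t)) (\<lambda>x. \<sigma> (x - t))"
proof -
  note S = smooth_step_onD[OF assms]
  have "smooth (\<lambda>x. g (x - t))" if "smooth g" for g :: "real \<Rightarrow> real"
    using smooth_compose_inner[OF that, of t 1] by simp
  moreover have "((\<lambda>x. \<sigma> (x - t)) has_real_derivative \<eta> (x - t)) (at x)" for x
  proof -
    have "((\<lambda>x. \<sigma> (x - t)) has_real_derivative \<eta> (x - t) * 1) (at x)"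
      by (rule DERIV_chain2[OF S(5)]) (auto intro!: derivative_eq_intros)
    then show ?thesis by simp
  qed
  ultimately show ?thesis
    using S unfolding smooth_step_on_def by auto
qed

lemma smooth_step_on_integral:
  assumes "smooth_step_on a b \<eta> \<sigma>" "a < b"
  shows "integrable lebesgue \<eta>" and "(LINT x|lebesgue. \<eta> x) = 1"
proof -
  note S = smooth_step_onD[OF assms(1)]
  have "(\<eta> has_integral (\<sigma> b - \<sigma> a)) {a..b}"
    using assms(2) S(5) by (intro fundamental_theorem_of_calculus)
      (auto simp flip: has_real_derivative_iff_has_vector_derivative intro: has_field_derivative_at_within)
  then have "(\<eta> has_integral 1) {a..b}" using S(6)[of a] S(7)[of b] by simp
  then have "(\<eta> has_integral 1) UNIV"
    by (rule has_integral_on_superset) (use S(4) in auto)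
  moreover have c: "continuous_on UNIV \<eta>" using S(1) by (rule smooth_continuous_on)
  have i: "integrable lborel \<eta>"
    by (rule integrable_compact_support[OF c, of "{a..b}"]) (use S(4) in auto)
  ultimately have "(LINT x|lborel. \<eta> x) = 1"
    using has_integral_integral_lborel[OF i] has_integral_unique by blast
  then show "integrable lebesgue \<eta>" "(LINT x|lebesgue. \<eta> x) = 1"
    using i by (simp_all add: integrable_completion integral_completion)
qed

text \<open>A non-integrable function has integral 0 by convention, and 0 obeys the bound too.
  Integrands such as \<open>g t w\<close> times a test function, for which only a bound almost
  everywhere is at hand, are thereby covered.\<close>

lemma abs_integral_le_AE:
  fixes f g :: "'a \<Rightarrow> real"
  assumes "integrable M g" "AE x in M. \<bar>f x\<bar> \<le> g x"
  shows "\<bar>LINT x|M. f x\<bar> \<le> (LINT x|M. g x)"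
proof (cases "integrable M f")
  case True
  then show ?thesis
    using integral_abs_bound[of M f] integral_mono_AE[OF integrable_abs[OF True] assms] by linarith
next
  case False
  have "0 \<le> (LINT x|M. g x)" using assms(2) by (intro integral_nonneg_AE) (auto elim: eventually_mono)
  then show ?thesis using False by (simp add: not_integrable_integral_eq)
qed

text \<open>A nonempty open interval has positive measure and so cannot consist of exceptional
  points.\<close>

lemma AE_interval_ex:
  fixes c d :: real
  assumes "AE t in lebesgue_on I. P t" "I \<in> sets lebesgue" "{c<..<d} \<subseteq> I" "c < d"
  obtains t where "c < t" "t < d" "P t"
proof -
  have AE: "AE t in lebesgue. t \<in> I \<longrightarrow> P t"
    using assms(1,2) by (subst (asm) AE_restrict_space_iff) auto
  have "\<exists>t\<in>{c<..<d}. P t"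
  proof (rule ccontr)
    assume n: "\<not> (\<exists>t\<in>{c<..<d}. P t)"
    have "AE t in lebesgue. t \<notin> {c<..<d}"
      using AE by eventually_elim (use n assms(3) in blast)
    then have "{c<..<d} \<in> null_sets lebesgue"
      using AE_iff_null_sets[of "{c<..<d}" lebesgue] by simp
    then have "emeasure lebesgue {c<..<d} = 0" by auto
    then show False using assms(4) by simp
  qed
  then show thesis using that by auto
qed

text \<open>Integration against \<open>\<eta>\<close> is an average over \<open>(a, b)\<close>:
  bounds of the integrand there pass to the integral with constant 1. The condition
  \<open>t0 \<le> a\<close> keeps the whole mass of \<open>\<eta>\<close> inside the time interval
  of the solution.\<close>

locale time_average =
  fixes t0 a b :: real and \<eta> \<sigma> :: "real \<Rightarrow> real"
  assumes step: "smooth_step_on a b \<eta> \<sigma>" and t0a: "t0 \<le> a" and ab: "a < b"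
begin

lemmas eta = smooth_step_onD[OF step]

lemma eta_measurable [measurable]: "\<eta> \<in> borel_measurable (lebesgue_on S)"
proof -
  have "\<eta> \<in> borel_measurable borel"
    by (intro borel_measurable_continuous_onI smooth_continuous_on eta(1))
  then have "\<eta> \<in> borel_measurable lebesgue" by (simp add: measurable_completion)
  then show ?thesis by (rule measurable_restrict_space1)
qed

lemma eta_integral:
  shows "integrable (lebesgue_on {t0<..}) \<eta>" and "(LINT t|lebesgue_on {t0<..}. \<eta> t) = 1"
proof -
  have eq: "(\<lambda>t. indicator {t0<..} t *\<^sub>R \<eta> t) = \<eta>"
    using eta(4) t0a by (fastforce simp: indicator_def fun_eq_iff)
  note eq = eq[unfolded real_scaleR_def]
  show "integrable (lebesgue_on {t0<..}) \<eta>"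
    using smooth_step_on_integral(1)[OF step ab] by (simp add: integrable_restrict_space eq)
  show "(LINT t|lebesgue_on {t0<..}. \<eta> t) = 1"
    using smooth_step_on_integral(2)[OF step ab] by (simp add: integral_restrict_space eq)
qed

lemma integrable_average:
  fixes m :: "real \<Rightarrow> real"
  assumes "m \<in> borel_measurable (lebesgue_on {t0<..})" "\<And>t. t0 < t \<Longrightarrow> \<bar>m t\<bar> \<le> C"
  shows "integrable (lebesgue_on {t0<..}) (\<lambda>t. \<eta> t * m t)"
proof -
  note [measurable] = assms(1)
  have i: "integrable (lebesgue_on {t0<..}) (\<lambda>t. C * \<eta> t)" using eta_integral(1) by simp
  show ?thesis
  proof (rule Bochner_Integration.integrable_bound[OF i])
    have "norm (\<eta> t * m t) \<le> norm (C * \<eta> t)" if "t0 < t" for t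
    proof -
      have "norm (\<eta> t * m t) = \<bar>m t\<bar> * \<eta> t" using eta(3)[of t] by (simp add: abs_mult)
      also have "\<dots> \<le> C * \<eta> t" by (intro mult_right_mono assms(2) that eta(3))
      finally show ?thesis by simp
    qed
    then show "AE t in lebesgue_on {t0<..}. norm (\<eta> t * m t) \<le> norm (C * \<eta> t)" by (intro AE_I2) simp
  qed measurable
qed

lemma average_le:
  assumes "integrable (lebesgue_on {t0<..}) (\<lambda>t. \<eta> t * m t)"
    and "\<And>t. t0 < t \<Longrightarrow> a < t \<Longrightarrow> t < b \<Longrightarrow> m t \<le> C"
  shows "(LINT t|lebesgue_on {t0<..}. \<eta> t * m t) \<le> C"
proof -
  have "(LINT t|lebesgue_on {t0<..}. \<eta> t * m t) \<le> (LINT t|lebesgue_on {t0<..}. \<eta> t * C)"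
  proof (rule integral_mono[OF assms(1)])
    show "integrable (lebesgue_on {t0<..}) (\<lambda>t. \<eta> t * C)" using eta_integral(1) by simp
    show "\<eta> t * m t \<le> \<eta> t * C" if "t \<in> space (lebesgue_on {t0<..})" for t
      using assms(2)[of t] eta(3)[of t] eta(4)[of t] that by (cases "t \<in> {a<..<b}") (auto intro: mult_left_mono)
  qed
  then show ?thesis using eta_integral by simp
qed

lemma average_ge:
  assumes "integrable (lebesgue_on {t0<..}) (\<lambda>t. \<eta> t * m t)"
    and "\<And>t. t0 < t \<Longrightarrow> a < t \<Longrightarrow> t < b \<Longrightarrow> C \<le> m t"
  shows "C \<le> (LINT t|lebesgue_on {t0<..}. \<eta> t * m t)"
  using average_le[of "\<lambda>t. - m t" "- C"] assms by simp

end

subsection \<open>Estimates for weak solutions\<close>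

lemma
  fixes F :: "real \<Rightarrow> real"
  assumes "S \<subseteq> I" "S \<in> sets lebesgue" "I \<in> sets lebesgue" "\<And>t. t \<notin> S \<Longrightarrow> F t = 0"
  shows integrable_lebesgue_on_superset: "integrable (lebesgue_on I) F \<longleftrightarrow> integrable (lebesgue_on S) F"
    and integral_lebesgue_on_superset: "(LINT t|lebesgue_on I. F t) = (LINT t|lebesgue_on S. F t)"
proof -
  have eq: "(\<lambda>t. indicator I t * F t) = (\<lambda>t. indicator S t * F t)"
    using assms(1,4) by (fastforce simp: indicator_def fun_eq_iff)
  show "integrable (lebesgue_on I) F \<longleftrightarrow> integrable (lebesgue_on S) F"
    using assms(2,3) by (simp add: integrable_restrict_space eq)
  show "(LINT t|lebesgue_on I. F t) = (LINT t|lebesgue_on S. F t)"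
    using assms(2,3) by (simp add: integral_restrict_space eq)
qed

text \<open>The witness \<open>g\<close> for the time derivative is fixed, so that the equation can
  be used as an identity at almost every time.\<close>

locale leray_hopf = flow_domain +
  fixes \<nu> t0 :: real and f :: field3 and u :: "real \<Rightarrow> field3" and g :: "real \<Rightarrow> functional"
  assumes nu_pos: "0 < \<nu>" and force: "f \<in> spaceH \<Omega> \<V>"
    and u_Linf: "u \<in> bochner_Linf (spaceH \<Omega> \<V>) (L2_norm \<Omega>) {t0<..}"
    and u_L2V: "u \<in> bochner_Lp_loc 2 (spaceV \<Omega> \<V>) (V_norm \<Omega>) {t0<..}"
    and u_weakly_continuous: "weakly_continuous_on \<Omega> \<V> {t0<..} u"
    and u_time_derivative: "time_derivative \<Omega> \<V> {t0<..} u g"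
    and u_equation: "AE t in lebesgue_on {t0<..}. \<forall>w\<in>spaceV \<Omega> \<V>.
      g t w + \<nu> * stokes \<Omega> (u t) w + convection \<Omega> (u t) (u t) w = ip \<Omega> f w"
    and u_energy: "energy_inequality \<Omega> \<nu> f {t0<..} u"
begin

abbreviation "J \<equiv> lebesgue_on {t0<..}"

lemma u_spaceH: "t0 < t \<Longrightarrow> u t \<in> spaceH \<Omega> \<V>"
  using u_weakly_continuous by (simp add: weakly_continuous_on_def)

lemma u_L2: "t0 < t \<Longrightarrow> u t \<in> L2 \<Omega>"
  using u_spaceH spaceH_L2 by blast

lemma continuous_ip_u: "w \<in> spaceH \<Omega> \<V> \<Longrightarrow> continuous_on {t0<..} (\<lambda>t. ip \<Omega> (u t) w)"
  using u_weakly_continuous by (simp add: weakly_continuous_on_def)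

lemma ip_u_measurable: "w \<in> spaceH \<Omega> \<V> \<Longrightarrow> (\<lambda>t. ip \<Omega> (u t) w) \<in> borel_measurable J"
  by (rule continuous_imp_measurable_on_sets_lebesgue[OF continuous_ip_u]) auto

text \<open>Weak continuity upgrades the essential bound to all times: times obeying it accumulate
  at \<open>t\<close>, and testing with \<open>u t\<close> itself gives
  \<open>|u t|^2 \<le> C * |u t|\<close> in the limit.\<close>

lemma u_bounded: "\<exists>R\<ge>0. \<forall>t>t0. L2_norm \<Omega> (u t) \<le> R"
proof -
  obtain C where C: "AE t in J. L2_norm \<Omega> (u t) \<le> C"
    using u_Linf by (auto simp: bochner_Linf_def)
  have "L2_norm \<Omega> (u t) \<le> C" if t: "t0 < t" for t
  proof -
    have "\<exists>s. t < s \<and> s < t + inverse (real (Suc n)) \<and> L2_norm \<Omega> (u s) \<le> C" for n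
      by (rule AE_interval_ex[OF C, of t "t + inverse (real (Suc n))"]) (use t in auto)
    then obtain s where s: "\<And>n. t < s n" "\<And>n. s n < t + inverse (real (Suc n))" "\<And>n. L2_norm \<Omega> (u (s n)) \<le> C"
      by metis
    have lim: "s \<longlonglongrightarrow> t"
    proof (rule tendsto_norm_diff_le[OF _ LIMSEQ_inverse_real_of_nat])
      show "norm (s n - t) \<le> inverse (real (Suc n))" for n
        using s(1)[of n] s(2)[of n] by (auto simp: abs_le_iff)
    qed
    have "(\<lambda>n. ip \<Omega> (u (s n)) (u t)) \<longlonglongrightarrow> ip \<Omega> (u t) (u t)"
      by (rule continuous_on_tendsto_compose[OF continuous_ip_u[OF u_spaceH[OF t]] lim])
        (use t s(1) in \<open>auto intro!: always_eventually intro: less_trans\<close>)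
    moreover have "ip \<Omega> (u (s n)) (u t) \<le> C * L2_norm \<Omega> (u t)" for n
    proof -
      have "ip \<Omega> (u (s n)) (u t) \<le> L2_norm \<Omega> (u (s n)) * L2_norm \<Omega> (u t)"
        using ip_abs_le[OF u_L2[OF less_trans[OF t s(1)]] u_L2[OF t], of n] by linarith
      also have "\<dots> \<le> C * L2_norm \<Omega> (u t)" by (intro mult_right_mono s(3) L2_norm_nonneg)
      finally show ?thesis .
    qed
    ultimately have le: "L2_norm \<Omega> (u t) * L2_norm \<Omega> (u t) \<le> C * L2_norm \<Omega> (u t)"
      using LIMSEQ_le_const2[of "\<lambda>n. ip \<Omega> (u (s n)) (u t)"]
      by (simp add: L2_norm_power2[symmetric] power2_eq_square)
    show ?thesis
    proof (cases "L2_norm \<Omega> (u t) = 0")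
      case True
      have "0 \<le> L2_norm \<Omega> (u (s 0))" by (rule L2_norm_nonneg)
      then show ?thesis using True s(3)[of 0] by linarith
    next
      case False
      then have "0 < L2_norm \<Omega> (u t)" using L2_norm_nonneg[of "u t"] by linarith
      then show ?thesis using le by (simp add: mult_le_cancel_right)
    qed
  qed
  then show ?thesis by (intro exI[of _ "max C 0"]) (auto simp: le_max_iff_disj)
qed

definition R :: real where
  "R = (SOME R. R \<ge> 0 \<and> (\<forall>t>t0. L2_norm \<Omega> (u t) \<le> R))"

lemma R_nonneg: "0 \<le> R" and L2_norm_u_le: "t0 < t \<Longrightarrow> L2_norm \<Omega> (u t) \<le> R"
  using someI_ex[OF u_bounded] unfolding R_def by blast+

lemma L2_norm_u_power2_le: "t0 < t \<Longrightarrow> \<bar>(L2_norm \<Omega> (u t))\<^sup>2\<bar> \<le> R\<^sup>2"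
  using power_mono[OF L2_norm_u_le L2_norm_nonneg, of t 2] by simp

lemma ip_u_abs_le:
  assumes "w \<in> L2 \<Omega>" "t0 < t"
  shows "\<bar>ip \<Omega> (u t) w\<bar> \<le> R * L2_norm \<Omega> w"
  using ip_abs_le[OF u_L2[OF assms(2)] assms(1)]
    mult_right_mono[OF L2_norm_u_le[OF assms(2)] L2_norm_nonneg[of w]] by linarith

text \<open>Measurability comes from the lower semicontinuity of the norm along a weakly continuous function.\<close>

lemma L2_norm_u_measurable [measurable]: "(\<lambda>t. L2_norm \<Omega> (u t)) \<in> borel_measurable J"
  unfolding borel_measurable_iff_greater
proof
  fix c :: real
  have "open {t \<in> {t0<..}. c < L2_norm \<Omega> (u t)}"
  proof (subst open_subopen, rule ballI)
    fix t assume "t \<in> {t \<in> {t0<..}. c < L2_norm \<Omega> (u t)}"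
    then have t: "t0 < t" "c < L2_norm \<Omega> (u t)" by auto
    show "\<exists>T. open T \<and> t \<in> T \<and> T \<subseteq> {t \<in> {t0<..}. c < L2_norm \<Omega> (u t)}"
    proof (cases "c < 0")
      case True
      have "c < L2_norm \<Omega> (u s)" for s using True L2_norm_nonneg[of "u s"] by linarith
      then show ?thesis using t by (intro exI[of _ "{t0<..}"]) auto
    next
      case False
      then have pos: "0 < L2_norm \<Omega> (u t)" using t by linarith
      let ?T = "{t0<..} \<inter> (\<lambda>s. ip \<Omega> (u s) (u t)) -` {c * L2_norm \<Omega> (u t)<..}"
      have "open ?T"
        by (rule continuous_open_preimage[OF continuous_ip_u[OF u_spaceH[OF t(1)]]]) auto
      moreover have "t \<in> ?T"
        using t pos by (simp add: L2_norm_power2[symmetric] power2_eq_square mult_strict_right_mono)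
      moreover have "c < L2_norm \<Omega> (u s)" if "s \<in> ?T" for s
      proof -
        have "c * L2_norm \<Omega> (u t) < ip \<Omega> (u s) (u t)" "t0 < s" using that by auto
        then have "c * L2_norm \<Omega> (u t) < L2_norm \<Omega> (u s) * L2_norm \<Omega> (u t)"
          using ip_abs_le[OF u_L2[of s] u_L2[OF t(1)]] by linarith
        then show ?thesis using pos by (simp add: mult_less_cancel_right)
      qed
      ultimately show ?thesis by (intro exI[of _ ?T]) auto
    qed
  qed
  then have "{t \<in> {t0<..}. c < L2_norm \<Omega> (u t)} \<in> sets lebesgue" by simp
  then show "{t \<in> space J. c < L2_norm \<Omega> (u t)} \<in> sets J"
    by (auto simp: sets_restrict_space_iff)
qed

lemma V_norm_u_interval:
  assumes "t0 < c"
  shows "integrable (lebesgue_on {c..d}) (\<lambda>t. (V_norm \<Omega> (u t))\<^sup>2)"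
    and "AE t in J. t \<in> {c..d} \<longrightarrow> u t \<in> spaceV \<Omega> \<V>"
proof -
  have "{c..d} \<subseteq> {t0<..}" using assms by auto
  then have L: "u \<in> bochner_Lp 2 (spaceV \<Omega> \<V>) (V_norm \<Omega>) {c..d}"
    using u_L2V unfolding bochner_Lp_loc_def by blast
  then have "integrable (lebesgue_on {c..d}) (\<lambda>t. V_norm \<Omega> (u t) powr 2)"
    by (simp add: bochner_Lp_def)
  then show "integrable (lebesgue_on {c..d}) (\<lambda>t. (V_norm \<Omega> (u t))\<^sup>2)"
    by (simp add: V_norm_nonneg)
  have "AE t in lebesgue_on {c..d}. u t \<in> spaceV \<Omega> \<V>"
    using L by (simp add: bochner_Lp_def bochner_measurable_def)
  then have "AE t in lebesgue. t \<in> {c..d} \<longrightarrow> u t \<in> spaceV \<Omega> \<V>"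
    by (subst (asm) AE_restrict_space_iff) auto
  then have "AE t in lebesgue. t \<in> {t0<..} \<longrightarrow> t \<in> {c..d} \<longrightarrow> u t \<in> spaceV \<Omega> \<V>"
    by eventually_elim simp
  then show "AE t in J. t \<in> {c..d} \<longrightarrow> u t \<in> spaceV \<Omega> \<V>"
    by (subst AE_restrict_space_iff) auto
qed

lemma integrable_indicator_V:
  assumes "t0 < c"
  shows "integrable J (\<lambda>t. indicator {c..d} t * (V_norm \<Omega> (u t))\<^sup>2)"
    and "(LINT t|J. indicator {c..d} t * (V_norm \<Omega> (u t))\<^sup>2) = (LINT t|lebesgue_on {c..d}. (V_norm \<Omega> (u t))\<^sup>2)"
proof -
  have sub: "{c..d} \<subseteq> {t0<..}" using assms by auto
  have eq: "integrable (lebesgue_on {c..d}) (\<lambda>t. indicator {c..d} t * (V_norm \<Omega> (u t))\<^sup>2)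
      \<longleftrightarrow> integrable (lebesgue_on {c..d}) (\<lambda>t. (V_norm \<Omega> (u t))\<^sup>2)"
    by (rule Bochner_Integration.integrable_cong) auto
  show "integrable J (\<lambda>t. indicator {c..d} t * (V_norm \<Omega> (u t))\<^sup>2)"
    using V_norm_u_interval(1)[OF assms, of d] eq by (subst integrable_lebesgue_on_superset[OF sub]) auto
  have "(LINT t|J. indicator {c..d} t * (V_norm \<Omega> (u t))\<^sup>2)
      = (LINT t|lebesgue_on {c..d}. indicator {c..d} t * (V_norm \<Omega> (u t))\<^sup>2)"
    by (rule integral_lebesgue_on_superset[OF sub]) auto
  also have "\<dots> = (LINT t|lebesgue_on {c..d}. (V_norm \<Omega> (u t))\<^sup>2)"
    by (rule Bochner_Integration.integral_cong) auto
  finally show "(LINT t|J. indicator {c..d} t * (V_norm \<Omega> (u t))\<^sup>2) = (LINT t|lebesgue_on {c..d}. (V_norm \<Omega> (u t))\<^sup>2)" .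
qed

lemma integrable_mult_V:
  assumes c: "t0 < c" and \<phi>: "continuous_on UNIV \<phi>" "\<And>t. t \<notin> {c..d} \<Longrightarrow> \<phi> t = 0" "\<And>t. \<bar>\<phi> t\<bar> \<le> B"
  shows "integrable J (\<lambda>t. \<phi> t * (V_norm \<Omega> (u t))\<^sup>2)"
proof -
  let ?F = "\<lambda>t. indicator {c..d} t * (V_norm \<Omega> (u t))\<^sup>2"
  have F: "integrable J ?F" by (rule integrable_indicator_V(1)[OF c])
  have "\<phi> \<in> borel_measurable lebesgue"
    using borel_measurable_continuous_onI[OF \<phi>(1)] by (simp add: measurable_completion)
  then have m: "\<phi> \<in> borel_measurable J" by (rule measurable_restrict_space1)
  have eq: "(\<lambda>t. \<phi> t * (V_norm \<Omega> (u t))\<^sup>2) = (\<lambda>t. \<phi> t * ?F t)"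
    using \<phi>(2) by (fastforce simp: indicator_def fun_eq_iff)
  have i: "integrable J (\<lambda>t. B * ?F t)" using F by simp
  show ?thesis unfolding eq
  proof (rule Bochner_Integration.integrable_bound[OF i])
    show "(\<lambda>t. \<phi> t * ?F t) \<in> borel_measurable J"
      using m borel_measurable_integrable[OF F] by (rule borel_measurable_times)
    have "norm (\<phi> t * ?F t) \<le> norm (B * ?F t)" for t
    proof -
      have "norm (\<phi> t * ?F t) = \<bar>\<phi> t\<bar> * ?F t" by (simp add: abs_mult)
      also have "\<dots> \<le> B * ?F t" by (intro mult_right_mono \<phi>(3)) auto
      also have "\<dots> \<le> norm (B * ?F t)" by simp
      finally show ?thesis .
    qed
    then show "AE t in J. norm (\<phi> t * ?F t) \<le> norm (B * ?F t)" by simp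
  qed
qed

lemma integral_indicator_const:
  assumes "t0 < c" "c \<le> d"
  shows "integrable J (\<lambda>t. C * indicator {c..d} t)" "(LINT t|J. C * indicator {c..d} t) = C * (d - c)"
proof -
  have sub: "{c..d} \<subseteq> {t0<..}" using assms by auto
  have eq: "(\<lambda>t. indicator {t0<..} t *\<^sub>R (C * indicator {c..d} t)) = (\<lambda>t. C * indicator {c..d} t)"
    using sub by (fastforce simp: indicator_def fun_eq_iff)
  have "integrable lebesgue (\<lambda>t. C * indicator {c..d} t)"
    by (intro integrable_mult_right integrable_real_indicator) (use assms(2) in auto)
  then show "integrable J (\<lambda>t. C * indicator {c..d} t)"
    by (subst integrable_restrict_space) (simp, simp only: eq)
  have "(LINT t|J. C * indicator {c..d} t) = (LINT t|lebesgue. C * indicator {c..d} t)"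
    by (subst integral_restrict_space) (simp, simp only: eq)
  then show "(LINT t|J. C * indicator {c..d} t) = C * (d - c)" using assms(2) by simp
qed

section \<open>Energy estimates on bounded intervals of time\<close>

definition F :: real where "F = L2_norm \<Omega> f * R"

lemma F_nonneg: "0 \<le> F"
  unfolding F_def by (intro mult_nonneg_nonneg L2_norm_nonneg R_nonneg)

lemma ip_force_le: "t0 < t \<Longrightarrow> \<bar>ip \<Omega> f (u t)\<bar> \<le> F"
  using ip_u_abs_le[OF spaceH_L2[OF force]] by (simp add: F_def ip_commute mult.commute)

lemma average_norm_integrable:
  assumes "time_average t0 p q \<eta> \<sigma>"
  shows "integrable J (\<lambda>t. \<eta> t * (L2_norm \<Omega> (u t))\<^sup>2)"
proof -
  have "(\<lambda>t. (L2_norm \<Omega> (u t))\<^sup>2) \<in> borel_measurable J" by measurable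
  then show ?thesis
    by (rule time_average.integrable_average[OF assms]) (rule L2_norm_u_power2_le)
qed

text \<open>Twice the energy inequality, tested with a plateau. Its derivative turns the energies
  into averages over the two ramps, and the force contributes at most \<open>F\<close> per unit of
  time on the support \<open>[p, s]\<close>.\<close>

lemma energy_steps:
  assumes S: "smooth_step_on p q \<eta>1 \<sigma>1" "smooth_step_on r s \<eta>2 \<sigma>2"
    and ord: "t0 < p" "p < q" "q \<le> r" "r < s"
  shows "(LINT t|J. \<eta>2 t * (L2_norm \<Omega> (u t))\<^sup>2) + 2 * \<nu> * (LINT t|J. (\<sigma>1 t - \<sigma>2 t) * (V_norm \<Omega> (u t))\<^sup>2)
    \<le> (LINT t|J. \<eta>1 t * (L2_norm \<Omega> (u t))\<^sup>2) + 2 * F * (s - p)"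
proof -
  note T = test_function_steps[OF S ord]
  have t1: "time_average t0 p q \<eta>1 \<sigma>1" "time_average t0 r s \<eta>2 \<sigma>2"
    using S ord by (auto simp: time_average_def)
  note I1 = average_norm_integrable[OF t1(1)] and I2 = average_norm_integrable[OF t1(2)]
  have nn: "\<forall>t. 0 \<le> \<sigma>1 t - \<sigma>2 t" using T(3) by (rule allI)
  have "- (1/2) * (LINT t|J. (\<eta>1 t - \<eta>2 t) * (L2_norm \<Omega> (u t))\<^sup>2)
        + \<nu> * (LINT t|J. (\<sigma>1 t - \<sigma>2 t) * (V_norm \<Omega> (u t))\<^sup>2)
      \<le> (LINT t|J. (\<sigma>1 t - \<sigma>2 t) * ip \<Omega> f (u t))"
    using mp[OF bspec[OF u_energy[unfolded energy_inequality_def] T(1)] nn] by (simp only: T(2))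
  moreover have "(LINT t|J. (\<eta>1 t - \<eta>2 t) * (L2_norm \<Omega> (u t))\<^sup>2)
      = (LINT t|J. \<eta>1 t * (L2_norm \<Omega> (u t))\<^sup>2) - (LINT t|J. \<eta>2 t * (L2_norm \<Omega> (u t))\<^sup>2)"
    using I1 I2 by (simp add: left_diff_distrib)
  moreover have "\<bar>LINT t|J. (\<sigma>1 t - \<sigma>2 t) * ip \<Omega> f (u t)\<bar> \<le> (LINT t|J. F * indicator {p..s} t)"
  proof (rule abs_integral_le_AE)
    show "integrable J (\<lambda>t. F * indicator {p..s} t)" using ord by (intro integral_indicator_const) auto
    have "\<bar>(\<sigma>1 t - \<sigma>2 t) * ip \<Omega> f (u t)\<bar> \<le> F * indicator {p..s} t" if "t0 < t" for t
    proof (cases "t \<in> {p..s}")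
      case True
      have "\<bar>(\<sigma>1 t - \<sigma>2 t) * ip \<Omega> f (u t)\<bar> \<le> 1 * F"
        unfolding abs_mult using T(3)[of t] T(4)[of t] by (intro mult_mono ip_force_le that) auto
      then show ?thesis using True by simp
    next
      case False
      then show ?thesis using T(5)[of t] by simp
    qed
    then show "AE t in J. \<bar>(\<sigma>1 t - \<sigma>2 t) * ip \<Omega> f (u t)\<bar> \<le> F * indicator {p..s} t"
      by (intro AE_I2) simp
  qed
  moreover have "(LINT t|J. F * indicator {p..s} t) = F * (s - p)"
    using ord by (intro integral_indicator_const) auto
  ultimately show ?thesis by linarith
qed

text \<open>The window covers both later uses: the interval before \<open>t\<close> in
  \<open>good_times\<close> and the slightly enlarged \<open>[s, t]\<close> in
  \<open>weak_equicontinuity\<close>. With a ramp of length 1 on either side the support has length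
  5, so \<open>R^2 + 10 * F\<close> bounds \<open>2 * \<nu>\<close> times the integral; the support
  starts at \<open>t - 3\<close>, whence the condition on \<open>t\<close>.\<close>

lemma dissipation_bounded: "\<exists>E\<ge>0. \<forall>t\<ge>t0 + 4. (LINT s|J. indicator {t - 2..t + 1} s * (V_norm \<Omega> (u s))\<^sup>2) \<le> E"
proof (intro exI[of _ "(R\<^sup>2 / 2 + 5 * F) / \<nu>"] conjI allI impI)
  show "0 \<le> (R\<^sup>2 / 2 + 5 * F) / \<nu>"
    using nu_pos F_nonneg by simp
  fix t assume t: "t0 + 4 \<le> t"
  obtain \<eta>1 \<sigma>1 where S1: "smooth_step_on (t - 3) (t - 2) \<eta>1 \<sigma>1" by (rule smooth_step_on_exists[of "t - 3" "t - 2"]) auto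
  obtain \<eta>2 \<sigma>2 where S2: "smooth_step_on (t + 1) (t + 2) \<eta>2 \<sigma>2" by (rule smooth_step_on_exists[of "t + 1" "t + 2"]) auto
  have ord: "t0 < t - 3" "t - 3 < t - 2" "t - 2 \<le> t + 1" "t + 1 < t + 2" using t by auto
  note T = test_function_steps[OF S1 S2 ord]
  have t1: "time_average t0 (t - 3) (t - 2) \<eta>1 \<sigma>1" "time_average t0 (t + 1) (t + 2) \<eta>2 \<sigma>2"
    using S1 S2 ord by (auto simp: time_average_def)
  have A1: "(LINT t|J. \<eta>1 t * (L2_norm \<Omega> (u t))\<^sup>2) \<le> R\<^sup>2"
    by (rule time_average.average_le[OF t1(1) average_norm_integrable[OF t1(1)]])
      (use L2_norm_u_power2_le in auto)
  have A2: "0 \<le> (LINT t|J. \<eta>2 t * (L2_norm \<Omega> (u t))\<^sup>2)"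
    by (rule time_average.average_ge[OF t1(2) average_norm_integrable[OF t1(2)]]) auto
  have "\<nu> * (LINT t|J. (\<sigma>1 t - \<sigma>2 t) * (V_norm \<Omega> (u t))\<^sup>2) \<le> R\<^sup>2 / 2 + 5 * F"
    using energy_steps[OF S1 S2 ord] A1 A2 by (simp add: algebra_simps)
  then have le: "(LINT t|J. (\<sigma>1 t - \<sigma>2 t) * (V_norm \<Omega> (u t))\<^sup>2) \<le> (R\<^sup>2 / 2 + 5 * F) / \<nu>"
    using nu_pos by (simp add: pos_le_divide_eq mult.commute)
  have "(LINT s|J. indicator {t - 2..t + 1} s * (V_norm \<Omega> (u s))\<^sup>2)
      \<le> (LINT t|J. (\<sigma>1 t - \<sigma>2 t) * (V_norm \<Omega> (u t))\<^sup>2)"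
  proof (rule integral_mono)
    show "integrable J (\<lambda>s. indicator {t - 2..t + 1} s * (V_norm \<Omega> (u s))\<^sup>2)"
      using t by (intro integrable_indicator_V) auto
    show "integrable J (\<lambda>t. (\<sigma>1 t - \<sigma>2 t) * (V_norm \<Omega> (u t))\<^sup>2)"
    proof (rule integrable_mult_V[OF ord(1)])
      show "continuous_on UNIV (\<lambda>t. \<sigma>1 t - \<sigma>2 t)"
        by (rule smooth_continuous_on[OF smooth_diff[OF smooth_step_onD(2)[OF S1] smooth_step_onD(2)[OF S2]]])
      show "\<bar>\<sigma>1 t - \<sigma>2 t\<bar> \<le> 1" for t using T(3)[of t] T(4)[of t] by auto
    qed (rule T(5))
    show "indicator {t - 2..t + 1} s * (V_norm \<Omega> (u s))\<^sup>2 \<le> (\<sigma>1 s - \<sigma>2 s) * (V_norm \<Omega> (u s))\<^sup>2" for s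
      using T(3)[of s] T(6)[of s] by (intro mult_right_mono) (auto simp: indicator_def)
  qed
  then show "(LINT s|J. indicator {t - 2..t + 1} s * (V_norm \<Omega> (u s))\<^sup>2) \<le> (R\<^sup>2 / 2 + 5 * F) / \<nu>"
    using le by linarith
qed

definition E :: real where
  "E = (SOME E. E \<ge> 0 \<and> (\<forall>t\<ge>t0 + 4. (LINT s|J. indicator {t - 2..t + 1} s * (V_norm \<Omega> (u s))\<^sup>2) \<le> E))"

lemma E_nonneg: "0 \<le> E"
  and dissipation_le: "t0 + 4 \<le> t \<Longrightarrow> (LINT s|J. indicator {t - 2..t + 1} s * (V_norm \<Omega> (u s))\<^sup>2) \<le> E"
  using someI_ex[OF dissipation_bounded] unfolding E_def by blast+

lemma ip_u_close:
  assumes "w \<in> spaceH \<Omega> \<V>" "t0 < t" "0 < e"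
  obtains \<delta> where "0 < \<delta>" "\<And>s. \<bar>s - t\<bar> < \<delta> \<Longrightarrow> t0 < s \<and> \<bar>ip \<Omega> (u s) w - ip \<Omega> (u t) w\<bar> < e"
proof -
  obtain d where d: "0 < d" "\<And>s. s \<in> {t0<..} \<Longrightarrow> dist s t < d \<Longrightarrow> dist (ip \<Omega> (u s) w) (ip \<Omega> (u t) w) < e"
    using continuous_ip_u[OF assms(1), unfolded continuous_on_iff, rule_format, of t e] assms(2,3) by auto
  show thesis
  proof (rule that[of "min d (t - t0)"])
    show "0 < min d (t - t0)" using d(1) assms(2) by simp
    show "t0 < s \<and> \<bar>ip \<Omega> (u s) w - ip \<Omega> (u t) w\<bar> < e" if "\<bar>s - t\<bar> < min d (t - t0)" for s
    proof -
      have "t0 < s" using that by (simp add: abs_less_iff)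
      then show ?thesis using d(2)[of s] that by (simp add: dist_real_def)
    qed
  qed
qed

text \<open>Reaches every single \<open>t\<close>, although the energy inequality speaks of
  averages: by \<open>|u s|^2 \<ge> 2 (u s, u t) - |u t|^2\<close> and weak continuity, an average
  of the energy close to \<open>t\<close> is at least \<open>|u t|^2\<close> up to
  \<open>e / 2\<close>.\<close>

lemma energy_decay_average:
  assumes S: "smooth_step_on p q \<eta> \<sigma>" and ord: "t0 < p" "p < q" "q < t" and "0 < e"
  shows "(L2_norm \<Omega> (u t))\<^sup>2 \<le> (LINT s|J. \<eta> s * (L2_norm \<Omega> (u s))\<^sup>2) + 2 * F * (t - p) + e"
proof -
  have t: "t0 < t" using ord by simp
  obtain \<delta> where \<delta>: "0 < \<delta>" "\<And>s. \<bar>s - t\<bar> < \<delta> \<Longrightarrow> t0 < s \<and> \<bar>ip \<Omega> (u s) (u t) - ip \<Omega> (u t) (u t)\<bar> < e / 4"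
    using ip_u_close[OF u_spaceH[OF t] t, of "e / 4"] \<open>0 < e\<close> by (metis zero_less_divide_iff zero_less_numeral)
  \<comment> \<open>The last bound pays for the averaging window reaching beyond \<open>t\<close> by
    \<open>d\<close>: the force adds \<open>2 * F * d\<close>, at most \<open>e / 2\<close>.\<close>
  define d where "d = min (min \<delta> (t - q)) (e / (4 * F + 4))"
  have d: "0 < d" "d \<le> \<delta>" "d \<le> t - q" "d \<le> e / (4 * F + 4)"
    using \<delta>(1) ord \<open>0 < e\<close> F_nonneg by (auto simp: d_def)
  have dF: "2 * F * d \<le> e / 2"
  proof -
    have "d * (4 * F + 4) \<le> e" using d(4) F_nonneg by (simp add: pos_le_divide_eq)
    then show ?thesis using d(1) by (simp add: algebra_simps)
  qed
  obtain \<eta>2 \<sigma>2 where S2: "smooth_step_on (t - d) (t + d) \<eta>2 \<sigma>2"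
    by (rule smooth_step_on_exists[of "t - d" "t + d"]) (use d in auto)
  have ord': "q \<le> t - d" "t - d < t + d" using d by auto
  have ta: "time_average t0 (t - d) (t + d) \<eta>2 \<sigma>2"
    using S2 ord ord' by (auto simp: time_average_def)
  have "(L2_norm \<Omega> (u t))\<^sup>2 - e / 2 \<le> (LINT s|J. \<eta>2 s * (L2_norm \<Omega> (u s))\<^sup>2)"
  proof (rule time_average.average_ge[OF ta average_norm_integrable[OF ta]])
    fix s assume s: "t0 < s" "t - d < s" "s < t + d"
    have "\<bar>s - t\<bar> < \<delta>" using s d by (simp add: abs_less_iff)
    then have "\<bar>ip \<Omega> (u s) (u t) - ip \<Omega> (u t) (u t)\<bar> < e / 4" using \<delta>(2) by blast
    then have "ip \<Omega> (u s) (u t) > (L2_norm \<Omega> (u t))\<^sup>2 - e / 4" unfolding L2_norm_power2 by linarith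
    moreover have "0 \<le> (L2_norm \<Omega> (u s))\<^sup>2 - 2 * ip \<Omega> (u s) (u t) + (L2_norm \<Omega> (u t))\<^sup>2"
      unfolding L2_norm_diff_power2[OF u_L2[OF s(1)] u_L2[OF t], symmetric] by simp
    ultimately show "(L2_norm \<Omega> (u t))\<^sup>2 - e / 2 \<le> (L2_norm \<Omega> (u s))\<^sup>2" by linarith
  qed
  moreover have "0 \<le> (LINT t|J. (\<sigma> t - \<sigma>2 t) * (V_norm \<Omega> (u t))\<^sup>2)"
    using test_function_steps(3)[OF S S2 ord(1,2) ord'] by (intro integral_nonneg_AE AE_I2) simp
  then have "0 \<le> 2 * \<nu> * (LINT t|J. (\<sigma> t - \<sigma>2 t) * (V_norm \<Omega> (u t))\<^sup>2)" using nu_pos by simp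
  ultimately show ?thesis
    using energy_steps[OF S S2 ord(1,2) ord'] dF by (simp add: algebra_simps)
qed

text \<open>The base step \<open>\<eta>0\<close> is chosen once and translated, so that \<open>K\<close> does not depend on \<open>t\<close>. If no
  \<open>s\<close> in \<open>(t - h, t)\<close> were good, then averaging against the translate would give
  \<open>A \<le> A - h + (R\<^sup>2 + 1) B E / K < A\<close>, where \<open>A\<close> is the average of the energy.\<close>

lemma good_times:
  assumes h: "0 < h" "h \<le> 1"
  shows "\<exists>K. \<forall>t\<ge>t0 + 4. \<exists>s. t - h < s \<and> s < t \<and> u s \<in> spaceV \<Omega> \<V> \<and> (V_norm \<Omega> (u s))\<^sup>2 \<le> K
    \<and> (L2_norm \<Omega> (u t))\<^sup>2 \<le> (L2_norm \<Omega> (u s))\<^sup>2 + (2 * F + 2) * h"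
proof -
  obtain \<eta>0 \<sigma>0 where S0: "smooth_step_on (- h) (- h / 2) \<eta>0 \<sigma>0"
    by (rule smooth_step_on_exists[of "- h" "- h / 2"]) (use h in auto)
  have c0: "continuous_on UNIV \<eta>0" by (rule smooth_continuous_on[OF smooth_step_onD(1)[OF S0]])
  have z0: "\<eta>0 x = 0" if "x \<notin> {- h..- h / 2}" for x using smooth_step_onD(4)[OF S0, of x] that by auto
  obtain B where B: "0 \<le> B" "\<And>x. norm (\<eta>0 x) \<le> B"
    by (rule bounded_compact_support[OF c0 _ z0]) auto
  define X where "X = (R\<^sup>2 + 1) * (B * E)"
  have X: "0 \<le> X" unfolding X_def using B(1) E_nonneg by simp
  define K where "K = (X + 1) / h"
  have K: "0 < K" using X h by (simp add: K_def)
  show ?thesis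
  proof (rule exI[of _ K], intro allI impI, rule ccontr)
    fix t assume t: "t0 + 4 \<le> t"
    assume no: "\<not> (\<exists>s. t - h < s \<and> s < t \<and> u s \<in> spaceV \<Omega> \<V> \<and> (V_norm \<Omega> (u s))\<^sup>2 \<le> K
      \<and> (L2_norm \<Omega> (u t))\<^sup>2 \<le> (L2_norm \<Omega> (u s))\<^sup>2 + (2 * F + 2) * h)"
    define \<eta> where "\<eta> x = \<eta>0 (x - t)" for x
    define \<sigma> where "\<sigma> x = \<sigma>0 (x - t)" for x
    have S: "smooth_step_on (t - h) (t - h / 2) \<eta> \<sigma>"
      using smooth_step_on_translate[OF S0, of t] unfolding \<eta>_def[abs_def] \<sigma>_def[abs_def] by (simp add: algebra_simps)
    have ord: "t0 < t - h" "t - h < t - h / 2" "t - h / 2 < t" using h t by auto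
    have ta: "time_average t0 (t - h) (t - h / 2) \<eta> \<sigma>" using S ord by (simp add: time_average_def)
    define A where "A = (LINT s|J. \<eta> s * (L2_norm \<Omega> (u s))\<^sup>2)"
    note iA = average_norm_integrable[OF ta]
    have A0: "0 \<le> A" unfolding A_def by (rule time_average.average_ge[OF ta iA]) simp
    \<comment> \<open>The error is taken to be \<open>h\<close>. The claim allows
      \<open>(2 * F + 2) * h\<close>, one \<open>h\<close> more than here, so a time at which the
      energy condition fails has energy at most \<open>A - h\<close>.\<close>
    have A: "(L2_norm \<Omega> (u t))\<^sup>2 \<le> A + (2 * F + 1) * h"
      using energy_decay_average[OF S ord h(1)] by (simp add: A_def algebra_simps)
    have iV: "integrable J (\<lambda>s. \<eta> s * (V_norm \<Omega> (u s))\<^sup>2)"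
    proof (rule integrable_mult_V[OF ord(1)])
      show "continuous_on UNIV \<eta>" by (rule smooth_continuous_on[OF smooth_step_onD(1)[OF S]])
      show "\<eta> s = 0" if "s \<notin> {t - h..t - h / 2}" for s using smooth_step_onD(4)[OF S, of s] that by auto
      show "\<bar>\<eta> s\<bar> \<le> B" for s using B(2)[of "s - t"] by (simp add: \<eta>_def)
    qed
    have eB: "(LINT s|J. \<eta> s * (V_norm \<Omega> (u s))\<^sup>2) \<le> B * E"
    proof -
      have "(LINT s|J. \<eta> s * (V_norm \<Omega> (u s))\<^sup>2)
          \<le> (LINT s|J. B * (indicator {t - 2..t + 1} s * (V_norm \<Omega> (u s))\<^sup>2))"
      proof (rule integral_mono[OF iV])
        show "integrable J (\<lambda>s. B * (indicator {t - 2..t + 1} s * (V_norm \<Omega> (u s))\<^sup>2))"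
          using integrable_indicator_V(1)[of "t - 2" "t + 1"] t by simp
        show "\<eta> s * (V_norm \<Omega> (u s))\<^sup>2 \<le> B * (indicator {t - 2..t + 1} s * (V_norm \<Omega> (u s))\<^sup>2)" for s
        proof (cases "s \<in> {t - h<..<t - h / 2}")
          case True
          then have "s \<in> {t - 2..t + 1}" using h by auto
          moreover have "\<eta> s \<le> B" using B(2)[of "s - t"] by (simp add: \<eta>_def)
          ultimately show ?thesis by (simp add: mult_right_mono)
        next
          case False
          then show ?thesis using smooth_step_onD(4)[OF S, of s] B(1) by simp
        qed
      qed
      also have "\<dots> \<le> B * E" using dissipation_le[OF t] B(1) by (simp add: mult_left_mono)
      finally show ?thesis .
    qed
    let ?G = "\<lambda>s. \<eta> s * (A - h) + (R\<^sup>2 + 1) / K * (\<eta> s * (V_norm \<Omega> (u s))\<^sup>2)"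
    have iG: "integrable J ?G"
      using time_average.eta_integral(1)[OF ta] iV by simp
    have "A \<le> (LINT s|J. ?G s)"
      unfolding A_def
    proof (rule integral_mono_AE[OF iA])
      show "integrable J (\<lambda>s. \<eta> s * ((LINT s|J. \<eta> s * (L2_norm \<Omega> (u s))\<^sup>2) - h)
          + (R\<^sup>2 + 1) / K * (\<eta> s * (V_norm \<Omega> (u s))\<^sup>2))"
        using iG unfolding A_def .
      have "AE s in J. s \<in> {t - h..t} \<longrightarrow> u s \<in> spaceV \<Omega> \<V>"
        by (rule V_norm_u_interval(2)[OF ord(1)])
      moreover have "AE s in J. t0 < s" by (intro AE_I2) simp
      ultimately have "AE s in J. \<eta> s * (L2_norm \<Omega> (u s))\<^sup>2 \<le> ?G s"
      proof eventually_elim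
        case (elim s)
        show ?case
        proof (cases "s \<in> {t - h<..<t - h / 2}")
          case True
          have s: "t - h < s" "s < t" using True h by auto
          then have sV: "u s \<in> spaceV \<Omega> \<V>" using elim by auto
          have "(L2_norm \<Omega> (u s))\<^sup>2 \<le> (A - h) + (R\<^sup>2 + 1) / K * (V_norm \<Omega> (u s))\<^sup>2"
          proof (cases "(V_norm \<Omega> (u s))\<^sup>2 \<le> K")
            case True
            then have "\<not> (L2_norm \<Omega> (u t))\<^sup>2 \<le> (L2_norm \<Omega> (u s))\<^sup>2 + (2 * F + 2) * h"
              using no s sV by blast
            then have "(L2_norm \<Omega> (u s))\<^sup>2 \<le> A - h" using A by (simp add: algebra_simps)
            moreover have "0 \<le> (R\<^sup>2 + 1) / K * (V_norm \<Omega> (u s))\<^sup>2" using K by simp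
            ultimately show ?thesis by linarith
          next
            case False
            \<comment> \<open>A large seminorm makes the second term at least
              \<open>R^2 + 1\<close>; the additional 1 makes up for
              \<open>A - h \<ge> - 1\<close>.\<close>
            then have "1 \<le> (V_norm \<Omega> (u s))\<^sup>2 / K" using K by simp
            then have "(R\<^sup>2 + 1) * 1 \<le> (R\<^sup>2 + 1) * ((V_norm \<Omega> (u s))\<^sup>2 / K)" by (intro mult_left_mono) auto
            then have "R\<^sup>2 + 1 \<le> (R\<^sup>2 + 1) / K * (V_norm \<Omega> (u s))\<^sup>2" by simp
            moreover have "(L2_norm \<Omega> (u s))\<^sup>2 \<le> R\<^sup>2" using L2_norm_u_power2_le[of s] elim by simp
            ultimately show ?thesis using A0 h by linarith
          qed
          then have "\<eta> s * (L2_norm \<Omega> (u s))\<^sup>2 \<le> \<eta> s * ((A - h) + (R\<^sup>2 + 1) / K * (V_norm \<Omega> (u s))\<^sup>2)"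
            by (intro mult_left_mono smooth_step_onD(3)[OF S])
          then show ?thesis by (simp add: algebra_simps)
        next
          case False
          then show ?thesis using smooth_step_onD(4)[OF S, of s] by simp
        qed
      qed
      then show "AE s in J. \<eta> s * (L2_norm \<Omega> (u s))\<^sup>2 \<le> \<eta> s * ((LINT s|J. \<eta> s * (L2_norm \<Omega> (u s))\<^sup>2) - h)
          + (R\<^sup>2 + 1) / K * (\<eta> s * (V_norm \<Omega> (u s))\<^sup>2)"
        unfolding A_def .
    qed
    also have "(LINT s|J. ?G s) = (A - h) + (R\<^sup>2 + 1) / K * (LINT s|J. \<eta> s * (V_norm \<Omega> (u s))\<^sup>2)"
      using time_average.eta_integral[OF ta] iV by simp
    finally have "h \<le> (R\<^sup>2 + 1) / K * (LINT s|J. \<eta> s * (V_norm \<Omega> (u s))\<^sup>2)" by simp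
    also have "\<dots> \<le> (R\<^sup>2 + 1) / K * (B * E)"
      using K by (intro mult_left_mono eB) simp
    also have "\<dots> = X / K" by (simp add: X_def)
    also have "\<dots> < h" using X h K unfolding K_def by (simp add: field_simps)
    finally show False by simp
  qed
qed

end

section \<open>The equation tested with a fixed smooth field\<close>

context bounded_domain
begin

lemma continuous_bounded_on_dom:
  assumes "continuous_on UNIV w"
  obtains S where "0 \<le> S" "\<And>x. x \<in> \<Omega> \<Longrightarrow> norm (w x) \<le> S"
proof -
  have "compact (closure \<Omega>)" using bounded_dom by (simp add: compact_closure)
  then have "bounded (w ` closure \<Omega>)"
    by (intro compact_imp_bounded compact_continuous_image continuous_on_subset[OF assms]) simp_all
  then obtain C where C: "\<And>x. x \<in> closure \<Omega> \<Longrightarrow> norm (w x) \<le> C" unfolding bounded_iff by blast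
  show thesis
  proof (rule that[of "max C 0"])
    show "norm (w x) \<le> max C 0" if "x \<in> \<Omega>" for x
      using C[of x] that closure_subset[of \<Omega>] by auto
  qed simp
qed

lemma ipV_abs_le:
  assumes "u \<in> H1 \<Omega>" "w \<in> H1 \<Omega>"
  shows "\<bar>ipV \<Omega> u w\<bar> \<le> 3 * V_norm \<Omega> w * V_norm \<Omega> u"
proof -
  have "\<bar>ip \<Omega> (weak_partial \<Omega> i u) (weak_partial \<Omega> i w)\<bar> \<le> V_norm \<Omega> u * V_norm \<Omega> w" for i
    by (rule order_trans[OF ip_abs_le[OF weak_partial_L2[OF assms(1)] weak_partial_L2[OF assms(2)]]])
      (intro mult_mono weak_partial_norm_le assms V_norm_nonneg L2_norm_nonneg)
  then have "(\<Sum>i\<in>UNIV. \<bar>ip \<Omega> (weak_partial \<Omega> i u) (weak_partial \<Omega> i w)\<bar>) \<le> (\<Sum>i\<in>(UNIV :: 3 set). V_norm \<Omega> u * V_norm \<Omega> w)"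
    by (intro sum_mono)
  then have "\<bar>ipV \<Omega> u w\<bar> \<le> (\<Sum>i\<in>(UNIV :: 3 set). V_norm \<Omega> u * V_norm \<Omega> w)"
    unfolding ipV_eq_sum[OF assms] by (rule order_trans[OF sum_abs])
  then show ?thesis by (simp add: mult_ac)
qed

text \<open>For bounded \<open>w\<close> the trilinear form is at most linear in the
  \<open>V\<close> seminorm once the norm in \<open>H\<close> is bounded, so the dissipation
  controls it without interpolation between norms.\<close>

lemma convection_abs_le:
  assumes u: "u \<in> H1 \<Omega>" and S: "0 \<le> S" "\<And>x. x \<in> \<Omega> \<Longrightarrow> norm (w x) \<le> S"
  shows "\<bar>convection \<Omega> u u w\<bar> \<le> 3 * S * L2_norm \<Omega> u * V_norm \<Omega> u"
proof -
  let ?p = "\<lambda>i. weak_partial \<Omega> i u"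
  let ?G = "\<lambda>x. \<Sum>i\<in>UNIV. S * (norm (u x) * norm (?p i x))"
  have ii: "integrable (lebesgue_on \<Omega>) (\<lambda>x. norm (u x) * norm (?p i x))" for i
    by (rule L2_integrable_inner(2)[OF H1_L2[OF u] weak_partial_L2[OF u]])
  have "\<bar>convection \<Omega> u u w\<bar> \<le> (LINT x|lebesgue_on \<Omega>. ?G x)"
    unfolding convection_def
  proof (rule abs_integral_le_AE)
    show "integrable (lebesgue_on \<Omega>) ?G" using ii by simp
    have "\<bar>(\<Sum>i\<in>UNIV. (u x $ i) *\<^sub>R ?p i x) \<bullet> w x\<bar> \<le> ?G x" if x: "x \<in> \<Omega>" for x
    proof -
      have "\<bar>(\<Sum>i\<in>UNIV. (u x $ i) *\<^sub>R ?p i x) \<bullet> w x\<bar> \<le> norm (\<Sum>i\<in>UNIV. (u x $ i) *\<^sub>R ?p i x) * norm (w x)"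
        by (rule Cauchy_Schwarz_ineq2)
      also have "\<dots> \<le> (\<Sum>i\<in>UNIV. norm (u x) * norm (?p i x)) * S"
      proof (intro mult_mono S(2)[OF x])
        show "norm (\<Sum>i\<in>UNIV. (u x $ i) *\<^sub>R ?p i x) \<le> (\<Sum>i\<in>UNIV. norm (u x) * norm (?p i x))"
          by (rule order_trans[OF norm_sum], rule sum_mono)
            (simp add: mult_right_mono component_le_norm_cart)
      qed (auto intro!: sum_nonneg)
      also have "\<dots> = ?G x" by (simp add: sum_distrib_left mult.commute)
      finally show ?thesis .
    qed
    then show "AE x in lebesgue_on \<Omega>. \<bar>(\<Sum>i\<in>UNIV. (u x $ i) *\<^sub>R ?p i x) \<bullet> w x\<bar> \<le> ?G x"
      by (intro AE_I2) simp
  qed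
  also have "\<dots> = (\<Sum>i\<in>UNIV. S * (LINT x|lebesgue_on \<Omega>. norm (u x) * norm (?p i x)))"
    using ii by simp
  also have "\<dots> \<le> (\<Sum>i\<in>(UNIV :: 3 set). S * (L2_norm \<Omega> u * V_norm \<Omega> u))"
  proof (intro sum_mono mult_left_mono S(1))
    fix i :: 3
    have "(LINT x|lebesgue_on \<Omega>. norm (u x) * norm (?p i x)) \<le> L2_norm \<Omega> u * L2_norm \<Omega> (?p i)"
      by (rule L2_norm_mult_le[OF H1_L2[OF u] weak_partial_L2[OF u]])
    also have "\<dots> \<le> L2_norm \<Omega> u * V_norm \<Omega> u"
      by (intro mult_left_mono weak_partial_norm_le u L2_norm_nonneg)
    finally show "(LINT x|lebesgue_on \<Omega>. norm (u x) * norm (?p i x)) \<le> L2_norm \<Omega> u * V_norm \<Omega> u" .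
  qed
  also have "\<dots> = 3 * S * L2_norm \<Omega> u * V_norm \<Omega> u" by (simp add: mult_ac)
  finally show ?thesis .
qed

end

context leray_hopf
begin

text \<open>Read off from the equation. The bound is affine in the \<open>V\<close> seminorm, hence
  square integrable on bounded intervals, and its constants depend on \<open>w\<close> but not on
  the interval.\<close>

lemma time_derivative_abs_le:
  assumes w: "w \<in> \<V>"
  obtains c1 c2 where "0 \<le> c1" "0 \<le> c2"
    "\<And>c d. t0 < c \<Longrightarrow> AE t in J. t \<in> {c..d} \<longrightarrow> \<bar>g t w\<bar> \<le> c1 + c2 * V_norm \<Omega> (u t)"
proof -
  have sw: "smooth w" by (rule smooth_flow[OF w])
  have wV: "w \<in> spaceV \<Omega> \<V>" using w flow_subset_spaceV by blast
  have wH1: "w \<in> H1 \<Omega>" by (rule smooth_H1[OF sw])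
  obtain S where S: "0 \<le> S" "\<And>x. x \<in> \<Omega> \<Longrightarrow> norm (w x) \<le> S"
    by (rule continuous_bounded_on_dom[OF smooth_continuous_on[OF sw]]) blast
  show thesis
  proof (rule that[of "\<bar>ip \<Omega> f w\<bar>" "\<nu> * (3 * V_norm \<Omega> w) + 3 * S * R"])
    show "0 \<le> \<nu> * (3 * V_norm \<Omega> w) + 3 * S * R"
      using nu_pos S(1) R_nonneg V_norm_nonneg by simp
    fix c d :: real assume c: "t0 < c"
    have "AE t in J. t0 < t" by (intro AE_I2) simp
    then show "AE t in J. t \<in> {c..d} \<longrightarrow> \<bar>g t w\<bar> \<le> \<bar>ip \<Omega> f w\<bar> + (\<nu> * (3 * V_norm \<Omega> w) + 3 * S * R) * V_norm \<Omega> (u t)"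
      using u_equation V_norm_u_interval(2)[OF c, of d]
    proof eventually_elim
      case (elim t)
      show ?case
      proof
        assume "t \<in> {c..d}"
        then have H: "u t \<in> H1 \<Omega>" using elim spaceV_H1 by blast
        have "g t w = ip \<Omega> f w - \<nu> * ipV \<Omega> (u t) w - convection \<Omega> (u t) (u t) w"
          using bspec[OF elim(2) wV] by (simp add: stokes_def)
        then have "\<bar>g t w\<bar> \<le> \<bar>ip \<Omega> f w\<bar> + \<bar>\<nu> * ipV \<Omega> (u t) w\<bar> + \<bar>convection \<Omega> (u t) (u t) w\<bar>"
          by linarith
        moreover have "\<bar>\<nu> * ipV \<Omega> (u t) w\<bar> \<le> \<nu> * (3 * V_norm \<Omega> w * V_norm \<Omega> (u t))"
          unfolding abs_mult using nu_pos ipV_abs_le[OF H wH1] by (simp add: mult_left_mono)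
        moreover have "\<bar>convection \<Omega> (u t) (u t) w\<bar> \<le> 3 * S * R * V_norm \<Omega> (u t)"
        proof -
          have "3 * S * L2_norm \<Omega> (u t) * V_norm \<Omega> (u t) \<le> 3 * S * R * V_norm \<Omega> (u t)"
            using S(1) L2_norm_u_le[OF elim(1)] by (intro mult_right_mono mult_left_mono V_norm_nonneg) auto
          then show ?thesis using convection_abs_le[where w = w, OF H S] by linarith
        qed
        ultimately show "\<bar>g t w\<bar> \<le> \<bar>ip \<Omega> f w\<bar> + (\<nu> * (3 * V_norm \<Omega> w) + 3 * S * R) * V_norm \<Omega> (u t)"
          by (simp add: algebra_simps)
      qed
    qed
  qed simp
qed

text \<open>The free parameter \<open>l\<close> comes from \<open>v \<le> l + v^2 / l\<close>, which
  bounds the integral of the seminorm by \<open>l * (t - s) + E / l\<close>. Taking \<open>l\<close>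
  as the inverse square root of \<open>t - s\<close> would give Hoelder continuity with exponent
  1/2. \<open>C\<close> is uniform in \<open>t\<close> because \<open>E\<close> is.\<close>

lemma weak_equicontinuity:
  assumes w: "w \<in> \<V>"
  shows "\<exists>C\<ge>0. \<forall>t\<ge>t0 + 4. \<forall>s l. t - 1 < s \<longrightarrow> s < t \<longrightarrow> 0 < l \<longrightarrow>
    \<bar>ip \<Omega> (u t) w - ip \<Omega> (u s) w\<bar> \<le> C * ((1 + l) * (t - s) + 1 / l)"
proof -
  obtain c1 c2 where c: "0 \<le> c1" "0 \<le> c2"
    and gb: "\<And>c d. t0 < c \<Longrightarrow> AE t in J. t \<in> {c..d} \<longrightarrow> \<bar>g t w\<bar> \<le> c1 + c2 * V_norm \<Omega> (u t)"
    by (rule time_derivative_abs_le[OF w]) blast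
  have wV: "w \<in> spaceV \<Omega> \<V>" and wH: "w \<in> spaceH \<Omega> \<V>"
    using w flow_subset_spaceV flow_subset_spaceH by blast+
  have wL: "w \<in> L2 \<Omega>" by (rule spaceH_L2[OF wH])
  let ?m = "\<lambda>r. ip \<Omega> (u r) w"
  have main: "\<bar>?m t - ?m s\<bar> \<le> (c1 + c2 * l) * (t - s) + c2 * E / l + e"
    if t: "t0 + 4 \<le> t" and s: "t - 1 < s" "s < t" and l: "0 < l" and e: "0 < e" for t s l e
  proof -
    have t0': "t0 < s" "t0 < t" using t s by auto
    \<comment> \<open>Smearing out the end points costs \<open>2 * e'\<close> for replacing values
      by averages, and the interval grows by \<open>2 * d \<le> 2 * e'\<close>; the denominator
      makes both costs add up to \<open>e\<close>.\<close>
    define e' where "e' = e / (2 + 2 * (c1 + c2 * l))"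
    have den: "0 < 2 + 2 * (c1 + c2 * l)" using c l by (simp add: add_pos_nonneg)
    have e': "0 < e'" unfolding e'_def using e den by simp
    have e'e: "2 * e' + (c1 + c2 * l) * (2 * e') = e"
    proof -
      have "e' * (2 + 2 * (c1 + c2 * l)) = e" using den by (simp add: e'_def)
      then show ?thesis by (simp add: algebra_simps)
    qed
    obtain d1 where d1: "0 < d1" "\<And>r. \<bar>r - s\<bar> < d1 \<Longrightarrow> t0 < r \<and> \<bar>?m r - ?m s\<bar> < e'"
      by (rule ip_u_close[OF wH t0'(1) e']) blast
    obtain d2 where d2: "0 < d2" "\<And>r. \<bar>r - t\<bar> < d2 \<Longrightarrow> t0 < r \<and> \<bar>?m r - ?m t\<bar> < e'"
      by (rule ip_u_close[OF wH t0'(2) e']) blast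
    define d where "d = min (min (min d1 d2) (min e' 1)) ((t - s) / 2)"
    have "d \<le> (t - s) / 2" unfolding d_def by (rule min.cobounded2)
    moreover have "0 < d" "d \<le> d1" "d \<le> d2" "d \<le> e'" "d \<le> 1"
      using d1(1) d2(1) e' s by (auto simp: d_def)
    ultimately have d: "0 < d" "d \<le> d1" "d \<le> d2" "d \<le> e'" "d \<le> 1" "d \<le> (t - s) / 2"
      by auto
    obtain \<eta>1 \<sigma>1 where S1: "smooth_step_on (s - d) (s + d) \<eta>1 \<sigma>1"
      by (rule smooth_step_on_exists[of "s - d" "s + d"]) (use d in auto)
    obtain \<eta>2 \<sigma>2 where S2: "smooth_step_on (t - d) (t + d) \<eta>2 \<sigma>2"
      by (rule smooth_step_on_exists[of "t - d" "t + d"]) (use d in auto)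
    have ord: "t0 < s - d" "s - d < s + d" "s + d \<le> t - d" "t - d < t + d" using d t s by auto
    note T = test_function_steps[OF S1 S2 ord]
    have ta: "time_average t0 (s - d) (s + d) \<eta>1 \<sigma>1" "time_average t0 (t - d) (t + d) \<eta>2 \<sigma>2"
      using S1 S2 ord by (auto simp: time_average_def)
    have im: "integrable J (\<lambda>r. \<eta>1 r * ?m r)" "integrable J (\<lambda>r. \<eta>2 r * ?m r)"
      by (rule time_average.integrable_average[OF ta(1) ip_u_measurable[OF wH] ip_u_abs_le[OF wL]], assumption)
        (rule time_average.integrable_average[OF ta(2) ip_u_measurable[OF wH] ip_u_abs_le[OF wL]], assumption)
    let ?A1 = "LINT r|J. \<eta>1 r * ?m r" and ?A2 = "LINT r|J. \<eta>2 r * ?m r"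
    have m1: "?m s - e' \<le> ?m r \<and> ?m r \<le> ?m s + e'" if "s - d < r" "r < s + d" for r
    proof -
      have "\<bar>r - s\<bar> < d1" using that d by (simp add: abs_less_iff)
      then show ?thesis using d1(2)[of r] by linarith
    qed
    have m2: "?m t - e' \<le> ?m r \<and> ?m r \<le> ?m t + e'" if "t - d < r" "r < t + d" for r
    proof -
      have "\<bar>r - t\<bar> < d2" using that d by (simp add: abs_less_iff)
      then show ?thesis using d2(2)[of r] by linarith
    qed
    have A1: "?m s - e' \<le> ?A1" "?A1 \<le> ?m s + e'"
      by (rule time_average.average_ge[OF ta(1) im(1)] time_average.average_le[OF ta(1) im(1)]; use m1 in simp)+
    have A2: "?m t - e' \<le> ?A2" "?A2 \<le> ?m t + e'"
      by (rule time_average.average_ge[OF ta(2) im(2)] time_average.average_le[OF ta(2) im(2)]; use m2 in simp)+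
    have "(LINT r|J. (\<eta>1 r - \<eta>2 r) * ?m r) = - (LINT r|J. (\<sigma>1 r - \<sigma>2 r) * g r w)"
      using bspec[OF bspec[OF u_time_derivative[unfolded time_derivative_def] T(1)] wV] by (simp only: T(2))
    moreover have "(LINT r|J. (\<eta>1 r - \<eta>2 r) * ?m r) = ?A1 - ?A2"
      using im by (simp add: left_diff_distrib)
    moreover have "\<bar>LINT r|J. (\<sigma>1 r - \<sigma>2 r) * g r w\<bar>
      \<le> (LINT r|J. (c1 + c2 * l) * indicator {s - d..t + d} r
          + c2 / l * (indicator {t - 2..t + 1} r * (V_norm \<Omega> (u r))\<^sup>2))"
    proof (rule abs_integral_le_AE)
      show "integrable J (\<lambda>r. (c1 + c2 * l) * indicator {s - d..t + d} r
          + c2 / l * (indicator {t - 2..t + 1} r * (V_norm \<Omega> (u r))\<^sup>2))"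
        using ord d s t by (intro Bochner_Integration.integrable_add integral_indicator_const
            integrable_mult_right integrable_indicator_V) auto
      show "AE r in J. \<bar>(\<sigma>1 r - \<sigma>2 r) * g r w\<bar> \<le> (c1 + c2 * l) * indicator {s - d..t + d} r
          + c2 / l * (indicator {t - 2..t + 1} r * (V_norm \<Omega> (u r))\<^sup>2)"
        using gb[OF ord(1), of "t + d"]
      proof eventually_elim
        case (elim r)
        show ?case
        proof (cases "r \<in> {s - d..t + d}")
          case True
          let ?v = "V_norm \<Omega> (u r)"
          have in2: "r \<in> {t - 2..t + 1}" using True d s by auto
          have "0 \<le> (?v - l)\<^sup>2" by simp
          then have "2 * (l * ?v) \<le> ?v * ?v + l * l" by (simp add: power2_eq_square algebra_simps)
          moreover have "0 \<le> l * ?v" using l V_norm_nonneg[of "u r"] by simp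
          ultimately have "l * ?v \<le> ?v * ?v + l * l" by linarith
          then have "?v \<le> l + ?v\<^sup>2 / l" using l by (simp add: field_simps power2_eq_square)
          then have "c2 * ?v \<le> c2 * (l + ?v\<^sup>2 / l)" by (intro mult_left_mono c(2))
          then have "\<bar>g r w\<bar> \<le> (c1 + c2 * l) + c2 / l * ?v\<^sup>2"
            using elim True by (simp add: algebra_simps)
          moreover have "\<bar>(\<sigma>1 r - \<sigma>2 r) * g r w\<bar> \<le> 1 * \<bar>g r w\<bar>"
            unfolding abs_mult using T(3)[of r] T(4)[of r] by (intro mult_right_mono) auto
          ultimately show ?thesis using True in2 by simp
        next
          case False
          then show ?thesis using T(5)[of r] c l by simp
        qed
      qed
    qed
    moreover have "(LINT r|J. (c1 + c2 * l) * indicator {s - d..t + d} r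
          + c2 / l * (indicator {t - 2..t + 1} r * (V_norm \<Omega> (u r))\<^sup>2))
      = (c1 + c2 * l) * (t + d - (s - d)) + c2 / l * (LINT r|J. indicator {t - 2..t + 1} r * (V_norm \<Omega> (u r))\<^sup>2)"
    proof -
      have i1: "integrable J (\<lambda>r. (c1 + c2 * l) * indicator {s - d..t + d} r)"
        "(LINT r|J. (c1 + c2 * l) * indicator {s - d..t + d} r) = (c1 + c2 * l) * (t + d - (s - d))"
        using ord d s by (intro integral_indicator_const; simp)+
      have i2: "integrable J (\<lambda>r. c2 / l * (indicator {t - 2..t + 1} r * (V_norm \<Omega> (u r))\<^sup>2))"
        using t by (intro integrable_mult_right integrable_indicator_V) simp
      show ?thesis
        unfolding Bochner_Integration.integral_add[OF i1(1) i2] i1(2) by simp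
    qed
    moreover have "c2 / l * (LINT r|J. indicator {t - 2..t + 1} r * (V_norm \<Omega> (u r))\<^sup>2) \<le> c2 / l * E"
      using c l by (intro mult_left_mono dissipation_le t) simp
    moreover have "(c1 + c2 * l) * (t + d - (s - d)) \<le> (c1 + c2 * l) * (t - s) + (c1 + c2 * l) * (2 * e')"
    proof -
      have "(c1 + c2 * l) * (t + d - (s - d)) \<le> (c1 + c2 * l) * ((t - s) + 2 * e')"
        using c l d by (intro mult_left_mono) auto
      then show ?thesis by (simp only: distrib_left)
    qed
    moreover have "c2 / l * E = c2 * E / l" by simp
    ultimately show ?thesis using A1 A2 e'e by linarith
  qed
  define C where "C = c1 + c2 + c2 * E"
  have C: "0 \<le> C" using c E_nonneg by (simp add: C_def)
  show ?thesis
  proof (intro exI[of _ C] conjI allI impI C)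
    fix t s l :: real
    assume A: "t0 + 4 \<le> t" "t - 1 < s" "s < t" "0 < l"
    have "\<bar>?m t - ?m s\<bar> \<le> (c1 + c2 * l) * (t - s) + c2 * E / l"
      by (rule field_le_epsilon) (rule main[OF A])
    also have "\<dots> \<le> C * ((1 + l) * (t - s)) + C * (1 / l)"
    proof (rule add_mono)
      have "c1 + c2 * l \<le> C * (1 + l)"
      proof -
        have "0 \<le> c1 * l" "0 \<le> c2 * E * l" "0 \<le> c2 * E" using c A E_nonneg by auto
        then show ?thesis using c by (simp add: C_def algebra_simps)
      qed
      then have "(c1 + c2 * l) * (t - s) \<le> C * (1 + l) * (t - s)" using A by (intro mult_right_mono) auto
      then show "(c1 + c2 * l) * (t - s) \<le> C * ((1 + l) * (t - s))" by (simp only: mult.assoc)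
      have "c2 * E \<le> C" using c by (simp add: C_def)
      then show "c2 * E / l \<le> C * (1 / l)" using A by (simp add: divide_right_mono)
    qed
    finally show "\<bar>?m t - ?m s\<bar> \<le> C * ((1 + l) * (t - s) + 1 / l)" by (simp only: distrib_left)
  qed
qed

end

lemma weak_solution_leray_hopf:
  assumes "flow_domain \<Omega> \<V> a b" "0 < \<nu>" "f \<in> spaceH \<Omega> \<V>" "weak_solution_open \<Omega> \<V> \<nu> f (ereal t0) \<infinity> u"
  obtains g where "leray_hopf \<Omega> \<V> a b \<nu> t0 f u g"
proof -
  have I: "einterval (ereal t0) \<infinity> = {t0<..}" by (auto simp: einterval_def)
  show thesis
    using assms that unfolding weak_solution_open_def Let_def I leray_hopf_def leray_hopf_axioms_def by blast
qed

section \<open>Strong compactness of the solution along sequences of times\<close>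

context leray_hopf
begin

lemma omega_limitI:
  assumes "\<And>n. t0 < s n" "filterlim s at_top sequentially" "v \<in> spaceH \<Omega> \<V>"
    "(\<lambda>n. L2_norm \<Omega> (u (s n) - v)) \<longlonglongrightarrow> 0"
  shows "v \<in> weak_omega_limit \<Omega> \<V> t0 u"
proof -
  have "(\<lambda>n. ip \<Omega> (u (s n)) w) \<longlonglongrightarrow> ip \<Omega> v w" if "w \<in> spaceH \<Omega> \<V>" for w
    by (rule ip_tendsto[OF u_L2[OF assms(1)] spaceH_L2[OF assms(3)] spaceH_L2[OF that] assms(4)])
  then show ?thesis
    using assms by (auto simp: weak_omega_limit_def weakly_converges_def)
qed

lemma strongly_convergent_subsequence:
  assumes bounded: "bounded_in_V \<Omega> \<V> (weak_omega_limit \<Omega> \<V> t0 u)"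
    and T: "\<And>n. t0 + 4 + real n \<le> T n"
  obtains r v where "strict_mono (r :: nat \<Rightarrow> nat)" "v \<in> spaceH \<Omega> \<V>"
    "(\<lambda>n. L2_norm \<Omega> (u (T (r n)) - v)) \<longlonglongrightarrow> 0"
proof -
  have T4: "t0 + 4 \<le> T n" for n using T[of n] by linarith
  have T0: "t0 < T n" for n using T4[of n] by linarith
  define h where "h k = inverse (real (Suc k))" for k
  have h: "0 < h k" "h k \<le> 1" for k by (auto simp: h_def inverse_le_1_iff)
  have h0: "h \<longlonglongrightarrow> 0" unfolding h_def by (rule LIMSEQ_inverse_real_of_nat)
  have "\<exists>K. \<forall>t\<ge>t0 + 4. \<exists>s. t - h k < s \<and> s < t \<and> u s \<in> spaceV \<Omega> \<V> \<and> (V_norm \<Omega> (u s))\<^sup>2 \<le> K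
    \<and> (L2_norm \<Omega> (u t))\<^sup>2 \<le> (L2_norm \<Omega> (u s))\<^sup>2 + (2 * F + 2) * h k" for k
    by (rule good_times[OF h])
  then obtain K where K: "\<And>k t. t0 + 4 \<le> t \<Longrightarrow> \<exists>s. t - h k < s \<and> s < t \<and> u s \<in> spaceV \<Omega> \<V>
    \<and> (V_norm \<Omega> (u s))\<^sup>2 \<le> K k \<and> (L2_norm \<Omega> (u t))\<^sup>2 \<le> (L2_norm \<Omega> (u s))\<^sup>2 + (2 * F + 2) * h k"
    by metis
  define good where "good k n s \<longleftrightarrow> T n - h k < s \<and> s < T n \<and> u s \<in> spaceV \<Omega> \<V>
    \<and> (V_norm \<Omega> (u s))\<^sup>2 \<le> K k \<and> (L2_norm \<Omega> (u (T n)))\<^sup>2 \<le> (L2_norm \<Omega> (u s))\<^sup>2 + (2 * F + 2) * h k" for k n s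
  have "\<exists>s. good k n s" for k n
    unfolding good_def by (rule K[OF T4])
  then obtain s where "\<And>k n. good k n (s k n)" by metis
  then have s: "T n - h k < s k n" "s k n < T n" "u (s k n) \<in> spaceV \<Omega> \<V>"
    "(V_norm \<Omega> (u (s k n)))\<^sup>2 \<le> K k"
    "(L2_norm \<Omega> (u (T n)))\<^sup>2 \<le> (L2_norm \<Omega> (u (s k n)))\<^sup>2 + (2 * F + 2) * h k" for k n
    unfolding good_def by blast+
  have s1: "T n - 1 < s k n" for k n using s(1)[of n k] h(2)[of k] by linarith
  have st0: "t0 + real n < s k n" for k n using s1[of n k] T[of n] by linarith
  have s0: "t0 < s k n" for k n using st0[where n = n and k = k] by linarith
  obtain r where r: "strict_mono (r :: nat \<Rightarrow> nat)"
    "\<And>k. \<exists>w\<in>spaceH \<Omega> \<V>. (\<lambda>n. L2_norm \<Omega> (u (s k (r n)) - w)) \<longlonglongrightarrow> 0"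
  proof (rule rellich_family[of "\<lambda>k n. u (s k n)" "\<lambda>k. sqrt (K k)" R])
    show "u (s k n) \<in> spaceV \<Omega> \<V>" for k n by (rule s(3))
    show "V_norm \<Omega> (u (s k n)) \<le> sqrt (K k)" for k n by (rule real_le_rsqrt[OF s(4)])
    show "L2_norm \<Omega> (u (s k n)) \<le> R" for k n by (rule L2_norm_u_le[OF s0])
  qed blast
  obtain w where w: "\<And>k. w k \<in> spaceH \<Omega> \<V>" "\<And>k. (\<lambda>n. L2_norm \<Omega> (u (s k (r n)) - w k)) \<longlonglongrightarrow> 0"
    using r(2) by metis
  have rn: "n \<le> r n" for n by (rule strict_mono_imp_increasing[OF r(1)])
  have w\<omega>: "w k \<in> weak_omega_limit \<Omega> \<V> t0 u" for k
  proof (rule omega_limitI[of "\<lambda>n. s k (r n)", OF s0 _ w])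
    show "filterlim (\<lambda>n. s k (r n)) at_top sequentially"
    proof (rule filterlim_at_top_mono)
      show "filterlim (\<lambda>n. t0 + real n) at_top sequentially"
        by (intro filterlim_tendsto_add_at_top[OF tendsto_const] filterlim_real_sequentially)
      show "\<forall>\<^sub>F n in sequentially. t0 + real n \<le> s k (r n)"
      proof (intro always_eventually allI)
        fix n show "t0 + real n \<le> s k (r n)"
          using st0[where n = "r n" and k = k] rn[of n] by linarith
      qed
    qed
  qed
  \<comment> \<open>The assumption on the limit set enters here. It also places the
    \<open>w k\<close> in \<open>spaceV\<close>, whereas \<open>rellich_family\<close> yields limits
    in \<open>spaceH\<close> only.\<close>
  obtain M where wV: "\<And>k. w k \<in> spaceV \<Omega> \<V>" and M: "\<And>k. V_norm \<Omega> (w k) \<le> M"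
    using bounded w\<omega> unfolding bounded_in_V_def by (metis subsetD)
  have uL: "u (s k n) \<in> L2 \<Omega>" for k n by (rule u_L2[OF s0])
  have wL: "w k \<in> L2 \<Omega>" for k by (rule spaceH_L2[OF w(1)])
  have wn: "(\<lambda>n. L2_norm \<Omega> (u (s k (r n)))) \<longlonglongrightarrow> L2_norm \<Omega> (w k)" for k
    by (rule L2_norm_tendsto[OF uL wL w(2)])
  have wR: "L2_norm \<Omega> (w k) \<le> R" for k
    by (rule LIMSEQ_le_const2[OF wn]) (use L2_norm_u_le[OF s0] in blast)
  \<comment> \<open>\<open>rellich_family\<close> is applied to a family that is constant in its
    first index.\<close>
  obtain \<kappa> where \<kappa>: "strict_mono (\<kappa> :: nat \<Rightarrow> nat)"
    "\<And>k::nat. \<exists>v\<in>spaceH \<Omega> \<V>. (\<lambda>n. L2_norm \<Omega> (w (\<kappa> n) - v)) \<longlonglongrightarrow> 0"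
    by (rule rellich_family[of "\<lambda>k n. w n" "\<lambda>k. M" R, OF wV M wR]) blast
  then obtain v where v: "v \<in> spaceH \<Omega> \<V>" "(\<lambda>j. L2_norm \<Omega> (w (\<kappa> j) - v)) \<longlonglongrightarrow> 0" by blast
  have vL: "v \<in> L2 \<Omega>" by (rule spaceH_L2[OF v(1)])
  have h\<kappa>: "(\<lambda>j. h (\<kappa> j)) \<longlonglongrightarrow> 0"
    using LIMSEQ_subseq_LIMSEQ[OF h0 \<kappa>(1)] by (simp add: o_def)
  define y where "y n = u (T (r n))" for n
  have yL: "y n \<in> L2 \<Omega>" and yR: "L2_norm \<Omega> (y n) \<le> R" for n
    unfolding y_def by (rule u_L2[OF T0], rule L2_norm_u_le[OF T0])
  \<comment> \<open>First \<open>j\<close> brings the energy of \<open>w (\<kappa> j)\<close>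
    together with the error term below the target, and then \<open>n\<close> is taken large for this
    fixed \<open>j\<close>.\<close>
  have energy: "\<forall>\<^sub>F n in sequentially. (L2_norm \<Omega> (y n))\<^sup>2 < (L2_norm \<Omega> v)\<^sup>2 + e" if "0 < e" for e
  proof -
    have "(\<lambda>j. (L2_norm \<Omega> (w (\<kappa> j)))\<^sup>2 + (2 * F + 2) * h (\<kappa> j)) \<longlonglongrightarrow> (L2_norm \<Omega> v)\<^sup>2 + (2 * F + 2) * 0"
      by (intro tendsto_add tendsto_power tendsto_mult tendsto_const h\<kappa> L2_norm_tendsto[OF wL vL v(2)])
    then have "\<forall>\<^sub>F j in sequentially. (L2_norm \<Omega> (w (\<kappa> j)))\<^sup>2 + (2 * F + 2) * h (\<kappa> j) < (L2_norm \<Omega> v)\<^sup>2 + e"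
      by (rule order_tendstoD(2)) (use that in simp)
    then obtain j where j: "(L2_norm \<Omega> (w (\<kappa> j)))\<^sup>2 + (2 * F + 2) * h (\<kappa> j) < (L2_norm \<Omega> v)\<^sup>2 + e"
      by (auto simp: eventually_sequentially)
    have "(\<lambda>n. (L2_norm \<Omega> (u (s (\<kappa> j) (r n))))\<^sup>2) \<longlonglongrightarrow> (L2_norm \<Omega> (w (\<kappa> j)))\<^sup>2"
      by (intro tendsto_power wn)
    then have "\<forall>\<^sub>F n in sequentially. (L2_norm \<Omega> (u (s (\<kappa> j) (r n))))\<^sup>2 < (L2_norm \<Omega> v)\<^sup>2 + e - (2 * F + 2) * h (\<kappa> j)"
      by (rule order_tendstoD(2)) (use j in linarith)
    then show ?thesis
    proof eventually_elim
      case (elim n)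
      then show ?case using s(5)[of "r n" "\<kappa> j"] unfolding y_def by linarith
    qed
  qed
  have weak: "\<forall>\<^sub>F n in sequentially. \<bar>ip \<Omega> (y n) \<phi> - ip \<Omega> v \<phi>\<bar> < e" if \<phi>: "\<phi> \<in> \<V>" and "0 < e" for \<phi> e
  proof -
    have \<phi>L: "\<phi> \<in> L2 \<Omega>" using \<phi> flow_subset_L2 by blast
    obtain C where C: "0 \<le> C" "\<And>t s l. t0 + 4 \<le> t \<Longrightarrow> t - 1 < s \<Longrightarrow> s < t \<Longrightarrow> 0 < l \<Longrightarrow>
      \<bar>ip \<Omega> (u t) \<phi> - ip \<Omega> (u s) \<phi>\<bar> \<le> C * ((1 + l) * (t - s) + 1 / l)"
      using weak_equicontinuity[OF \<phi>] by blast
    \<comment> \<open>One third of \<open>e\<close> for each of three distances. A large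
      \<open>l\<close> makes \<open>C / l\<close> small, then \<open>j\<close> is chosen for the
      term with \<open>h (\<kappa> j)\<close> and for the distance of \<open>w (\<kappa> j)\<close>
      from \<open>v\<close>, and only then is \<open>n\<close> taken large.\<close>
    define l where "l = (3 * C + 1) / e"
    have l: "0 < l" using C(1) \<open>0 < e\<close> by (simp add: l_def)
    have Cl: "C * (1 / l) < e / 3"
      using C(1) \<open>0 < e\<close> by (simp add: l_def field_simps)
    have "(\<lambda>j. C * ((1 + l) * h (\<kappa> j)) + C * (1 / l)) \<longlonglongrightarrow> C * ((1 + l) * 0) + C * (1 / l)"
      by (intro tendsto_add tendsto_mult tendsto_const h\<kappa>)
    then have "\<forall>\<^sub>F j in sequentially. C * ((1 + l) * h (\<kappa> j)) + C * (1 / l) < e / 3"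
      by (rule order_tendstoD(2)) (use Cl in simp)
    moreover have "(\<lambda>j. \<bar>ip \<Omega> (w (\<kappa> j)) \<phi> - ip \<Omega> v \<phi>\<bar>) \<longlonglongrightarrow> \<bar>ip \<Omega> v \<phi> - ip \<Omega> v \<phi>\<bar>"
      by (intro tendsto_rabs tendsto_diff tendsto_const ip_tendsto[OF wL vL \<phi>L v(2)])
    then have "\<forall>\<^sub>F j in sequentially. \<bar>ip \<Omega> (w (\<kappa> j)) \<phi> - ip \<Omega> v \<phi>\<bar> < e / 3"
      by (rule order_tendstoD(2)) (use \<open>0 < e\<close> in simp)
    ultimately have "\<forall>\<^sub>F j in sequentially. C * ((1 + l) * h (\<kappa> j)) + C * (1 / l) < e / 3
        \<and> \<bar>ip \<Omega> (w (\<kappa> j)) \<phi> - ip \<Omega> v \<phi>\<bar> < e / 3"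
      by (rule eventually_conj)
    then obtain j where j: "C * ((1 + l) * h (\<kappa> j)) + C * (1 / l) < e / 3"
        "\<bar>ip \<Omega> (w (\<kappa> j)) \<phi> - ip \<Omega> v \<phi>\<bar> < e / 3"
      by (auto simp: eventually_sequentially)
    have "(\<lambda>n. \<bar>ip \<Omega> (u (s (\<kappa> j) (r n))) \<phi> - ip \<Omega> (w (\<kappa> j)) \<phi>\<bar>) \<longlonglongrightarrow> \<bar>ip \<Omega> (w (\<kappa> j)) \<phi> - ip \<Omega> (w (\<kappa> j)) \<phi>\<bar>"
      by (intro tendsto_rabs tendsto_diff tendsto_const ip_tendsto[OF uL wL \<phi>L w(2)])
    then have "\<forall>\<^sub>F n in sequentially. \<bar>ip \<Omega> (u (s (\<kappa> j) (r n))) \<phi> - ip \<Omega> (w (\<kappa> j)) \<phi>\<bar> < e / 3"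
      by (rule order_tendstoD(2)) (use \<open>0 < e\<close> in simp)
    then show ?thesis
    proof eventually_elim
      case (elim n)
      have "\<bar>ip \<Omega> (y n) \<phi> - ip \<Omega> (u (s (\<kappa> j) (r n))) \<phi>\<bar>
          \<le> C * ((1 + l) * (T (r n) - s (\<kappa> j) (r n)) + 1 / l)"
        unfolding y_def by (rule C(2)[OF T4 s1 s(2) l])
      also have "\<dots> \<le> C * ((1 + l) * h (\<kappa> j) + 1 / l)"
        using C(1) l s(1)[of "r n" "\<kappa> j"] by (intro mult_left_mono add_right_mono) auto
      also have "\<dots> < e / 3" using j(1) by (simp only: distrib_left)
      finally show ?case using elim j(2) by linarith
    qed
  qed
  \<comment> \<open>Weak convergence is used against \<open>v\<close> itself. As \<open>v\<close> is
    only a limit of fields in \<open>\<V>\<close>, it is approximated by some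
    \<open>\<phi> m\<close>; the error is uniform in \<open>n\<close> because the \<open>y n\<close>
    are bounded in \<open>H\<close>.\<close>
  have inner: "\<forall>\<^sub>F n in sequentially. \<bar>ip \<Omega> (y n) v - ip \<Omega> v v\<bar> < e" if "0 < e" for e
  proof -
    define R' where "R' = R + L2_norm \<Omega> v + 1"
    have R': "0 < R'" "R \<le> R'" "L2_norm \<Omega> v \<le> R'"
      using R_nonneg L2_norm_nonneg[of v] by (auto simp: R'_def)
    obtain \<phi> where \<phi>: "\<And>n::nat. \<phi> n \<in> \<V>" "(\<lambda>n. L2_norm \<Omega> (\<phi> n - v)) \<longlonglongrightarrow> 0"
      using v(1) by (auto simp: spaceH_def)
    have "\<forall>\<^sub>F n in sequentially. L2_norm \<Omega> (\<phi> n - v) < e / (3 * R')"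
      by (rule order_tendstoD(2)[OF \<phi>(2)]) (use that R'(1) in simp)
    then obtain m where m: "L2_norm \<Omega> (\<phi> m - v) < e / (3 * R')" by (auto simp: eventually_sequentially)
    have \<phi>L: "\<phi> m \<in> L2 \<Omega>" using \<phi>(1) flow_subset_L2 by blast
    have close: "\<bar>ip \<Omega> x (\<phi> m) - ip \<Omega> x v\<bar> < e / 3" if x: "x \<in> L2 \<Omega>" "L2_norm \<Omega> x \<le> R'" for x
    proof -
      have "\<bar>ip \<Omega> x (\<phi> m) - ip \<Omega> x v\<bar> \<le> L2_norm \<Omega> x * L2_norm \<Omega> (\<phi> m - v)"
        using ip_abs_le[OF x(1) L2_diff[OF \<phi>L vL]] by (simp only: ip_diff_right[OF \<phi>L vL x(1)])
      also have "\<dots> \<le> R' * L2_norm \<Omega> (\<phi> m - v)" by (intro mult_right_mono x(2) L2_norm_nonneg)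
      also have "\<dots> < R' * (e / (3 * R'))" by (rule mult_strict_left_mono[OF m R'(1)])
      also have "\<dots> = e / 3" using R'(1) by simp
      finally show ?thesis .
    qed
    have "\<forall>\<^sub>F n in sequentially. \<bar>ip \<Omega> (y n) (\<phi> m) - ip \<Omega> v (\<phi> m)\<bar> < e / 3"
      by (rule weak[OF \<phi>(1)]) (use that in simp)
    then show ?thesis
    proof eventually_elim
      case (elim n)
      then show ?case
        using close[OF yL order_trans[OF yR R'(2)], of n] close[OF vL R'(3)] by linarith
    qed
  qed
  have "(\<lambda>n. L2_norm \<Omega> (y n - v)) \<longlonglongrightarrow> 0"
  proof (rule order_tendstoI)
    fix e :: real assume "e < 0"
    then show "\<forall>\<^sub>F n in sequentially. e < L2_norm \<Omega> (y n - v)"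
      by (intro always_eventually allI less_le_trans[OF _ L2_norm_nonneg])
  next
    fix e :: real assume e: "0 < e"
    have "\<forall>\<^sub>F n in sequentially. (L2_norm \<Omega> (y n))\<^sup>2 < (L2_norm \<Omega> v)\<^sup>2 + e\<^sup>2 / 2"
      by (rule energy) (use e in simp)
    moreover have "\<forall>\<^sub>F n in sequentially. \<bar>ip \<Omega> (y n) v - ip \<Omega> v v\<bar> < e\<^sup>2 / 4"
      by (rule inner) (use e in simp)
    ultimately show "\<forall>\<^sub>F n in sequentially. L2_norm \<Omega> (y n - v) < e"
    proof eventually_elim
      case (elim n)
      \<comment> \<open>Expanding the square, the energy contributes less than
        \<open>e^2 / 2\<close> and the mixed term less than \<open>2 * e^2 / 4\<close>.\<close>
      have "(L2_norm \<Omega> (y n - v))\<^sup>2 < e\<^sup>2"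
        using elim unfolding L2_norm_diff_power2[OF yL vL] L2_norm_power2[of v] by linarith
      then show ?case by (rule power2_less_imp_less) (use e in simp)
    qed
  qed
  then show thesis
    using that[OF r(1) v(1)] by (simp add: y_def)
qed

lemma omega_limit_attracts:
  assumes "bounded_in_V \<Omega> \<V> (weak_omega_limit \<Omega> \<V> t0 u)"
  shows "strongly_attracts \<Omega> \<V> (weak_omega_limit \<Omega> \<V> t0 u) t0 u"
  unfolding strongly_attracts_def
proof (intro allI impI, rule ccontr)
  fix G assume G: "openH \<Omega> \<V> G \<and> weak_omega_limit \<Omega> \<V> t0 u \<subseteq> G"
    and no: "\<not> (\<exists>T>t0. \<forall>t\<ge>T. u t \<in> G)"
  have "\<exists>t\<ge>t0 + 4 + real n. u t \<notin> G" for n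
  proof -
    have "t0 < t0 + 4 + real n" by simp
    then show ?thesis using no by blast
  qed
  then obtain T where T: "\<And>n. t0 + 4 + real n \<le> T n" "\<And>n. u (T n) \<notin> G" by metis
  have T0: "t0 < T n" for n using T(1)[of n] by linarith
  obtain r v where r: "strict_mono (r :: nat \<Rightarrow> nat)" "v \<in> spaceH \<Omega> \<V>"
    "(\<lambda>n. L2_norm \<Omega> (u (T (r n)) - v)) \<longlonglongrightarrow> 0"
    by (rule strongly_convergent_subsequence[OF assms T(1)])
  have "v \<in> weak_omega_limit \<Omega> \<V> t0 u"
  proof (rule omega_limitI[of "\<lambda>n. T (r n)", OF T0 _ r(2,3)])
    show "filterlim (\<lambda>n. T (r n)) at_top sequentially"
    proof (rule filterlim_at_top_mono)
      show "filterlim (\<lambda>n. t0 + 4 + real n) at_top sequentially"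
        by (intro filterlim_tendsto_add_at_top[OF tendsto_const] filterlim_real_sequentially)
      show "\<forall>\<^sub>F n in sequentially. t0 + 4 + real n \<le> T (r n)"
      proof (intro always_eventually allI)
        fix n show "t0 + 4 + real n \<le> T (r n)"
          using T(1)[of "r n"] strict_mono_imp_increasing[OF r(1), of n] by linarith
      qed
    qed
  qed
  then have "v \<in> G" using G by blast
  then obtain e where e: "0 < e" "\<And>w. w \<in> spaceH \<Omega> \<V> \<Longrightarrow> L2_norm \<Omega> (w - v) < e \<Longrightarrow> w \<in> G"
    using G unfolding openH_def by blast
  have "\<forall>\<^sub>F n in sequentially. L2_norm \<Omega> (u (T (r n)) - v) < e"
    by (rule order_tendstoD(2)[OF r(3) e(1)])
  then obtain n where "L2_norm \<Omega> (u (T (r n)) - v) < e" by (auto simp: eventually_sequentially)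
  then have "u (T (r n)) \<in> G" by (rule e(2)[OF u_spaceH[OF T0]])
  then show False using T(2) by blast
qed

end

theorem theorem4p2:
  fixes \<Omega> :: "(real^3) set" and \<V> :: "field3 set" and \<nu> t0 :: real
    and f :: field3 and u :: "real \<Rightarrow> field3"
  assumes "flow_setting \<Omega> \<V>"
    and "\<nu> > 0"
    and "f \<in> spaceH \<Omega> \<V>"
    and "weak_solution_open \<Omega> \<V> \<nu> f (ereal t0) \<infinity> u \<or> weak_solution_closed \<Omega> \<V> \<nu> f t0 \<infinity> u"
    and "bounded_in_V \<Omega> \<V> (weak_omega_limit \<Omega> \<V> t0 u)"
  shows "strongly_attracts \<Omega> \<V> (weak_omega_limit \<Omega> \<V> t0 u) t0 u"
proof -
  have sol: "weak_solution_open \<Omega> \<V> \<nu> f (ereal t0) \<infinity> u"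
    using assms(4) by (auto simp: weak_solution_closed_def)
  obtain a b where "flow_domain \<Omega> \<V> a b"
    by (rule flow_setting_flow_domain[OF assms(1)])
  then obtain g where "leray_hopf \<Omega> \<V> a b \<nu> t0 f u g"
    by (rule weak_solution_leray_hopf[OF _ assms(2,3) sol])
  then show ?thesis by (rule leray_hopf.omega_limit_attracts[OF _ assms(5)])
qed

end
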